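(* For each integer $p\ge 1$ there exists an effectively computable algebraic function $g_p$ of $k$ (over $\mathbb{Q}$) such that $$\int_0^1 g_p(k)\,K'(k)^{4p-1}\,\mathrm dk=\frac{\Gamma\left(\frac14\right)^{8p}}{\pi^{2p}} .$$
   Context: For $0\le k<1$, $K(k)=\int_0^1\frac{\mathrm dx}{\sqrt{(1-x^2)(1-k^2x^2)}}$ is the complete elliptic integral of the first kind and $K'(k)=K(\sqrt{1-k^2})$; $\Gamma$ is the Gamma function. *)

theory Defs
  imports
    "HOL-Analysis.Analysis"
    "HOL-Library.Nat_Bijection"
    "HOL-Computational_Algebra.Polynomial"
begin

definition ellK :: "real \<Rightarrow> real" where
  "ellK k = integral {0..1} (\<lambda>x. 1 / sqrt ((1 - x\<^sup>2) * (1 - k\<^sup>2 * x\<^sup>2)))"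

text \<open>The value at \<open>k = 0\<close>, where the integral diverges, is a dummy.\<close>

definition ellK' :: "real \<Rightarrow> real" where
  "ellK' k = ellK (sqrt (1 - k\<^sup>2))"


text \<open>The library predicate \<open>analytic_on\<close> is restricted to complex functions.\<close>

definition real_analytic_on :: "(real \<Rightarrow> real) \<Rightarrow> real set \<Rightarrow> bool" where
  "real_analytic_on g S \<longleftrightarrow>
     (\<forall>x\<in>S. \<exists>r>0. \<exists>a. \<forall>y. \<bar>y - x\<bar> < r \<longrightarrow> (\<lambda>n. a n * (y - x) ^ n) sums g y)"

text \<open>A polynomial in \<open>\<rat>[x][y]\<close> is a polynomial in \<open>y\<close> whose coefficients are polynomials in \<open>x\<close>.\<close>

definition eval2 :: "rat poly poly \<Rightarrow> real \<Rightarrow> real \<Rightarrow> real" where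
  "eval2 P x y = poly (map_poly (\<lambda>c. poly (map_poly real_of_rat c) x) P) y"

definition branch_on :: "rat poly poly \<Rightarrow> real set \<Rightarrow> (real \<Rightarrow> real) \<Rightarrow> bool" where
  "branch_on P S g \<longleftrightarrow> real_analytic_on g S \<and> (\<forall>x\<in>S. eval2 P x (g x) = 0)"

text \<open>Without analyticity, the indicator function of any subset of \<open>S\<close> would count as algebraic,
  being a root of \<open>y * (y - 1)\<close>.\<close>

definition algebraic_function_on :: "real set \<Rightarrow> (real \<Rightarrow> real) \<Rightarrow> bool" where
  "algebraic_function_on S g \<longleftrightarrow> (\<exists>P. P \<noteq> 0 \<and> branch_on P S g)"


text \<open>The total recursive functions. Several arguments are passed as one natural number by means of
  the Cantor pairing function; minimization is only applied when it yields a total function.\<close>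

inductive total_recursive :: "(nat \<Rightarrow> nat) \<Rightarrow> bool" where
  zero: "total_recursive (\<lambda>_. 0)"
| succ: "total_recursive Suc"
| left: "total_recursive (\<lambda>n. fst (prod_decode n))"
| right: "total_recursive (\<lambda>n. snd (prod_decode n))"
| pair: "total_recursive f \<Longrightarrow> total_recursive g \<Longrightarrow> total_recursive (\<lambda>n. prod_encode (f n, g n))"
| comp: "total_recursive f \<Longrightarrow> total_recursive g \<Longrightarrow> total_recursive (\<lambda>n. f (g n))"
| prec: "total_recursive f \<Longrightarrow> total_recursive g \<Longrightarrow>
    total_recursive (\<lambda>n. rec_nat (f (fst (prod_decode n)))
       (\<lambda>i r. g (prod_encode (fst (prod_decode n), prod_encode (i, r)))) (snd (prod_decode n)))"
| mu: "total_recursive f \<Longrightarrow> (\<And>a. \<exists>m. f (prod_encode (a, m)) = 0) \<Longrightarrow>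
    total_recursive (\<lambda>a. LEAST m. f (prod_encode (a, m)) = 0)"

definition rat_decode :: "nat \<Rightarrow> rat" where
  "rat_decode n = (case prod_decode n of (a, b) \<Rightarrow> Fract (int_decode a) (int b + 1))"

definition poly_decode :: "nat \<Rightarrow> rat poly" where
  "poly_decode n = Poly (map rat_decode (list_decode n))"

definition poly2_decode :: "nat \<Rightarrow> rat poly poly" where
  "poly2_decode n = Poly (map poly_decode (list_decode n))"

text \<open>An algebraic function is given in finite terms by an annihilating polynomial \<open>P\<close> together
  with rational numbers \<open>x\<^sub>0\<close>, \<open>a\<close>, \<open>b\<close> that single out the branch: it is the only branch of \<open>P\<close>
  whose value at \<open>x\<^sub>0\<close> lies between \<open>a\<close> and \<open>b\<close>.\<close>

definition describes_algebraic_function_on :: "real set \<Rightarrow> nat \<Rightarrow> (real \<Rightarrow> real) \<Rightarrow> bool" where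
  "describes_algebraic_function_on S c g \<longleftrightarrow>
     (\<exists>u v w z.
        c = prod_encode (u, prod_encode (v, prod_encode (w, z))) \<and>
        (let P = poly2_decode u; x\<^sub>0 = real_of_rat (rat_decode v);
             a = real_of_rat (rat_decode w); b = real_of_rat (rat_decode z)
         in P \<noteq> 0 \<and> x\<^sub>0 \<in> S \<and> branch_on P S g \<and> a < g x\<^sub>0 \<and> g x\<^sub>0 < b \<and>
            (\<forall>h. branch_on P S h \<and> a < h x\<^sub>0 \<and> h x\<^sub>0 < b \<longrightarrow> (\<forall>x\<in>S. h x = g x))))"

text \<open>A family of algebraic functions is effectively computable if some algorithm computes from the
  index a finite description of the corresponding function.\<close>

definition effectively_computable_on :: "real set \<Rightarrow> nat set \<Rightarrow> (nat \<Rightarrow> real \<Rightarrow> real) \<Rightarrow> bool" where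
  "effectively_computable_on S I g \<longleftrightarrow>
     (\<exists>d. total_recursive d \<and> (\<forall>p\<in>I. describes_algebraic_function_on S (d p) (g p)))"

end

theory Submission
  imports Defs "HOL-Real_Asymp.Real_Asymp"
begin

text \<open>
  Parametrize the modulus by the nome \<open>q = exp (-pi x)\<close>. With \<open>\<theta> = \<Sum>n\<in>\<int>. q^(n\<^sup>2)\<close> and
  \<open>t = k\<^sup>2\<close> one has \<open>K'(k) = pi x \<theta>\<^sup>2 / 2\<close> and \<open>dk = - (pi / 2) k (1 - k\<^sup>2) \<theta>^4 dx\<close>. The Hecke theta series
  \<open>f\<^sub>p = \<Sum>m n. Re ((m + i n)^(4p)) q^(m\<^sup>2 + n\<^sup>2)\<close> is a modular form of weight \<open>4p + 1\<close>, so that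
  \<open>f\<^sub>p = \<theta>^(8p + 2) B\<^sub>p(t) / 16^p\<close> with a polynomial \<open>B\<^sub>p\<close>; concretely, the heat equation gives a recursion
  for the Taylor coefficients of \<open>\<theta>(z)\<close>, and the Gaussian factor carrying the quasimodular part cancels in
  \<open>\<theta>(z) \<theta>(i z)\<close>. Hence \<open>\<integral> B\<^sub>p(k\<^sup>2) / (k (1 - k\<^sup>2)) K'(k)^(4p - 1) dk\<close> is a multiple of
  \<open>\<integral> f\<^sub>p x^(4p - 1) dx\<close>, that is, of the lattice sum \<open>G\<^sub>p = \<Sum> (m + i n)^(-4p)\<close>.

  At \<open>x = 1\<close>, where \<open>t = 1/2\<close>, the triple product and the product formula for the cosine factor
  \<open>\<theta>(z) \<theta>(i z)\<close> over the odd Gaussian integers. Its Taylor coefficients are \<open>\<theta>^(8p + 2) B\<^sub>p(1/2)\<close> up to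
  rational factors, so Newton's identities express \<open>G\<^sub>p\<close> as a nonzero rational multiple of \<open>pi^(4p) \<theta>^(8p)\<close>, which
  is \<open>\<Gamma>(1/4)^(8p) / pi^(2p)\<close> up to the factor \<open>16^p\<close> by the lemniscatic value of \<open>K\<close>.

  The identities between theta constants are obtained from the duplication \<open>q \<mapsto> q\<^sup>2\<close>: the quantity to be
  determined is invariant (or scales) under it, and its limit for \<open>q \<rightarrow> 0\<close> is known.
\<close>

section \<open>Theta constants\<close>

text \<open>The exponent \<open>4 * p - 1\<close> is forced by two matches. Each factor
  \<open>ellK'\<close> supplies the square of the theta constant and \<open>dk\<close> its fourth
  power, and \<open>2 * (4 * p - 1) + 4 = 8 * p + 2\<close> is the power of theta in front of
  \<open>Bpoly p\<close>. The remaining \<open>x ^ (4 * p - 1)\<close> makes the integral a Mellin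
  transform at \<open>4 * p\<close>, where a lattice point \<open>w\<close> with coefficient
  \<open>Re (w ^ (4 * p))\<close> is divided by \<open>|w| ^ (8 * p)\<close>, which leaves
  \<open>Re (1 / w ^ (4 * p))\<close>.

  The obstacle is effectivity: \<open>gfun\<close> is divided by the rational number relating the
  lattice sum to the lemniscatic constant, so this number must be computable from \<open>p\<close>
  and nonzero. Newton's recursion, cleared of factorials and powers of 2, produces it inside the
  integers as \<open>newtonS p\<close>. That it is nonzero is invisible in the recursion; it is read
  off the lattice sum, in which the point \<open>1 + i\<close> outweighs all others. The odd
  Gaussian integers enter because, up to the factor \<open>pi / 2\<close>, they are the zeros of the
  theta function of the square lattice.\<close>

definition sqcount :: "nat \<Rightarrow> real" where
  "sqcount k = real (card {n::int. n\<^sup>2 = int k})"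

text \<open>The sum of \<open>n^(2j) q^(n^2)\<close> over all integers \<open>n\<close>, that is,
  \<open>(q d/dq)^j\<close> applied to Jacobi's theta constant. Collecting terms by the exponent
  \<open>k = n^2\<close> makes it an ordinary power series, which can be differentiated termwise and
  evaluated at \<open>q = 0\<close>.\<close>

definition theta :: "nat \<Rightarrow> real \<Rightarrow> real" where
  "theta j q = (\<Sum>k. sqcount k * real k ^ j * q ^ k)"

lemma finite_squares: "finite {n::int. n\<^sup>2 = k}"
  and card_squares: "card {n::int. n\<^sup>2 = k} \<le> 2"
proof -
  have "finite {n::int. n\<^sup>2 = k} \<and> card {n::int. n\<^sup>2 = k} \<le> 2"
  proof (cases "\<exists>n::int. n\<^sup>2 = k")
    case True
    then obtain n :: int where n: "n\<^sup>2 = k" by blast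
    have sub: "{n::int. n\<^sup>2 = k} \<subseteq> {n, -n}"
      unfolding n[symmetric] by (auto simp: power2_eq_iff)
    have "card {n, -n} \<le> 2"
      by (simp add: card_insert_if)
    then show ?thesis
      using card_mono[OF _ sub] finite_subset[OF sub] by auto
  next
    case False
    then show ?thesis by auto
  qed
  then show "finite {n::int. n\<^sup>2 = k}" "card {n::int. n\<^sup>2 = k} \<le> 2" by auto
qed

lemma sqcount_nonneg: "0 \<le> sqcount k" and sqcount_le: "sqcount k \<le> 2"
  using card_squares[of "int k"] by (auto simp: sqcount_def)

lemma sqcount_0: "sqcount 0 = 1"
proof -
  have "{n::int. n\<^sup>2 = int 0} = {0}" by auto
  then show ?thesis unfolding sqcount_def by simp
qed

lemma sqcount_1: "sqcount (Suc 0) = 2"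
proof -
  have "{n::int. n\<^sup>2 = int (Suc 0)} = {1, -1}"
    using power2_eq_1_iff by auto
  then show ?thesis unfolding sqcount_def by simp
qed

lemma summable_theta:
  assumes "\<bar>q\<bar> < 1"
  shows "summable (\<lambda>k. sqcount k * real k ^ j * q ^ k)"
  using assms
proof (induction j arbitrary: q)
  case 0
  show ?case
  proof (rule summable_comparison_test)
    show "\<exists>N. \<forall>n\<ge>N. norm (sqcount n * real n ^ 0 * q ^ n) \<le> 2 * \<bar>q\<bar> ^ n"
      using sqcount_nonneg sqcount_le
      by (intro exI[of _ 0] allI impI) (auto simp: abs_mult power_abs intro!: mult_right_mono)
    show "summable (\<lambda>n. 2 * \<bar>q\<bar> ^ n)"
      using 0 by (intro summable_mult summable_geometric) auto
  qed
next
  case (Suc j)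
  let ?c = "\<lambda>k. sqcount k * real k ^ j"
  \<comment> \<open>Multiplying the coefficients by \<open>k\<close> amounts to differentiating and
    then multiplying by \<open>q\<close>.\<close>
  have "summable (\<lambda>n. diffs ?c n * q ^ n)"
    by (rule termdiff_converges[where K = 1]) (use Suc in auto)
  then have "summable (\<lambda>n. diffs ?c n * q ^ n * q)"
    by (rule summable_mult2)
  then have "summable (\<lambda>n. sqcount (Suc n) * real (Suc n) ^ Suc j * q ^ Suc n)"
    by (rule summable_cong[THEN iffD1, rotated]) (auto simp: diffs_def algebra_simps)
  then show ?case
    by (subst (asm) summable_Suc_iff)
qed

lemma summable_norm_theta:
  assumes "\<bar>q\<bar> < 1"
  shows "summable (\<lambda>k. norm (sqcount k * real k ^ j * q ^ k))"
proof -
  have "norm (sqcount k * real k ^ j * q ^ k) = sqcount k * real k ^ j * \<bar>q\<bar> ^ k" for k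
    using sqcount_nonneg by (simp add: abs_mult power_abs)
  then show ?thesis
    using summable_theta[of "\<bar>q\<bar>" j] assms by simp
qed

lemma theta_has_derivative_diffs:
  assumes "\<bar>q\<bar> < 1"
  shows "(theta j has_real_derivative (\<Sum>n. diffs (\<lambda>k. sqcount k * real k ^ j) n * q ^ n)) (at q)"
  unfolding theta_def
  by (rule termdiffs_strong'[where K = 1]) (use assms summable_theta in auto)

lemma theta_has_derivative:
  assumes "\<bar>q\<bar> < 1" "q \<noteq> 0"
  shows "(theta j has_real_derivative theta (Suc j) q / q) (at q)"
proof -
  let ?c = "\<lambda>k. sqcount k * real k ^ j"
  have s: "summable (\<lambda>n. diffs ?c n * q ^ n)"
    by (rule termdiff_converges[where K = 1]) (use assms summable_theta in auto)
  have "theta (Suc j) q = (\<Sum>n. sqcount (Suc n) * real (Suc n) ^ Suc j * q ^ Suc n)"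
    unfolding theta_def using suminf_split_head[OF summable_theta[OF assms(1), of "Suc j"]] by simp
  also have "\<dots> = (\<Sum>n. diffs ?c n * q ^ n * q)"
    by (intro suminf_cong) (simp add: diffs_def algebra_simps)
  also have "\<dots> = (\<Sum>n. diffs ?c n * q ^ n) * q"
    by (rule suminf_mult2[symmetric, OF s])
  finally have "theta (Suc j) q / q = (\<Sum>n. diffs ?c n * q ^ n)"
    using assms(2) by simp
  then show ?thesis
    using theta_has_derivative_diffs[OF assms(1)] by simp
qed

lemma theta_at_0: "theta j 0 = (if j = 0 then 1 else 0)"
proof -
  have "theta j 0 = (\<Sum>k. if k = 0 then sqcount 0 * 0 ^ j else 0)"
    unfolding theta_def by (intro suminf_cong) auto
  also have "\<dots> = sqcount 0 * 0 ^ j"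
    using suminf_finite[of "{0::nat}" "\<lambda>k. if k = 0 then sqcount 0 * 0 ^ j else 0"] by simp
  finally show ?thesis by (simp add: sqcount_0)
qed

lemma theta_has_derivative_0: "(theta j has_real_derivative 2) (at 0)"
proof -
  let ?c = "\<lambda>k. sqcount k * real k ^ j"
  have "(\<Sum>n. diffs ?c n * 0 ^ n) = diffs ?c 0"
    using powser_zero[of "diffs ?c"] by simp
  then show ?thesis
    using theta_has_derivative_diffs[of 0 j] by (simp add: diffs_def sqcount_1)
qed

lemma isCont_theta: "\<bar>q\<bar> < 1 \<Longrightarrow> isCont (theta j) q"
  using theta_has_derivative_diffs DERIV_isCont by blast

text \<open>The integers are fibred over the value of \<open>n^2\<close>; absolute convergence
  permits the regrouping.\<close>

lemma theta_has_sum: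
  assumes "\<bar>q\<bar> < 1"
  shows "((\<lambda>n::int. real_of_int n ^ (2 * j) * q ^ nat (n\<^sup>2)) has_sum theta j q) UNIV"
proof -
  let ?B = "\<lambda>k::nat. {n::int. n\<^sup>2 = int k}"
  let ?f = "\<lambda>(k, n::int). real k ^ j * q ^ k"
  have inner: "((\<lambda>n. ?f (k, n)) has_sum sqcount k * real k ^ j * q ^ k) (?B k)" for k
    using finite_squares[of "int k"] by (intro has_sum_finiteI) (auto simp: sqcount_def)
  have outer: "((\<lambda>k. sqcount k * real k ^ j * q ^ k) has_sum theta j q) UNIV"
    unfolding theta_def
    using norm_summable_imp_has_sum[OF summable_norm_theta[OF assms] summable_sums[OF summable_theta[OF assms]]] .
  have "(\<lambda>x. norm (?f x)) summable_on Sigma UNIV ?B"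
  proof (subst Infinite_Sum.abs_summable_on_Sigma_iff, intro conjI ballI)
    fix k :: nat
    show "(\<lambda>n. norm (?f (k, n))) summable_on ?B k"
      using finite_squares by simp
  next
    have "(\<lambda>k. norm (sqcount k * real k ^ j * q ^ k)) summable_on UNIV"
      using norm_summable_imp_summable_on[of "\<lambda>k. norm (sqcount k * real k ^ j * q ^ k)"]
        summable_norm_theta[OF assms, of j] by simp
    moreover have "norm (infsum (\<lambda>n. norm (?f (k, n))) (?B k)) = norm (sqcount k * real k ^ j * q ^ k)" for k
      using finite_squares[of "int k"] by (simp add: sqcount_def abs_mult)
    ultimately show "(\<lambda>k. norm (infsum (\<lambda>n. norm (?f (k, n))) (?B k))) summable_on UNIV"
      by simp
  qed
  then have "?f summable_on Sigma UNIV ?B"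
    by (rule abs_summable_summable)
  then have "(?f has_sum theta j q) (Sigma UNIV ?B)"
    by (intro has_sum_SigmaI[OF inner outer])
  moreover have "bij_betw (\<lambda>n::int. (nat (n\<^sup>2), n)) UNIV (Sigma UNIV ?B)"
    by (rule bij_betwI[where g = snd]) auto
  ultimately have "((\<lambda>n. ?f (nat (n\<^sup>2), n)) has_sum theta j q) UNIV"
    by (subst has_sum_reindex_bij_betw)
  moreover have "real (nat (n\<^sup>2)) ^ j = real_of_int n ^ (2 * j)" for n :: int
    by (simp add: power_mult)
  ultimately show ?thesis by simp
qed

lemma has_sum_prod_real:
  fixes f g :: "_ \<Rightarrow> real"
  assumes "(f has_sum a) A" "(g has_sum b) B"
  shows "((\<lambda>(x, y). f x * g y) has_sum a * b) (A \<times> B)"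
proof -
  have "(\<lambda>x. norm (f x)) summable_on A" "(\<lambda>x. norm (g x)) summable_on B"
    using assms has_sum_imp_summable summable_on_iff_abs_summable_on_real by blast+
  then have "(\<lambda>x. norm (case x of (x, y) \<Rightarrow> f x * g y)) summable_on A \<times> B"
    by (subst Infinite_Sum.abs_summable_on_Sigma_iff)
       (auto simp: abs_mult infsum_cmult_right' infsum_nonneg
             intro!: summable_on_cmult_right summable_on_cmult_left)
  then have s: "(\<lambda>(x, y). f x * g y) summable_on A \<times> B"
    by (rule abs_summable_summable)
  have "((\<lambda>y. case (x, y) of (x, y) \<Rightarrow> f x * g y) has_sum f x * b) B" for x
    using has_sum_cmult_right[OF assms(2)] by simp
  then show ?thesis
    using has_sum_SigmaI[OF _ has_sum_cmult_left[OF assms(1), of b] s] by blast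
qed

section \<open>Duplication formulas from the index-two sublattice\<close>

lemma bij_betw_even_lattice:
  "bij_betw (\<lambda>(a, b). (a + b, a - b)) (UNIV :: (int \<times> int) set) {(m, n). even (m + n)}"
proof (rule bij_betwI[where g = "\<lambda>(m, n). ((m + n) div 2, (m - n) div 2)"])
  have "(m + n) div 2 + (m - n) div 2 = m" "(m + n) div 2 - (m - n) div 2 = n"
    if "even (m + n)" for m n :: int
    using that by presburger+
  then show "(case (case x of (m, n) \<Rightarrow> ((m + n) div 2, (m - n) div 2)) of (a, b) \<Rightarrow> (a + b, a - b)) = x"
    if "x \<in> {(m, n). even (m + n)}" for x :: "int \<times> int"
    using that by (auto simp del: even_add)
qed auto

lemma theta_square_has_sum:
  assumes "\<bar>q\<bar> < 1" "\<bar>r\<bar> < 1"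
  shows "((\<lambda>(m::int, n::int). q ^ nat (m\<^sup>2) * r ^ nat (n\<^sup>2)) has_sum theta 0 q * theta 0 r) UNIV"
  using has_sum_prod_real[OF theta_has_sum[OF assms(1), of 0] theta_has_sum[OF assms(2), of 0]]
  by simp

lemma minus_power_nat_square:
  "(- q :: real) ^ nat (n\<^sup>2) = (if even n then 1 else -1) * q ^ nat (n\<^sup>2)"
  by (auto simp: even_nat_iff)

lemma power_even_lattice:
  "(q::real) ^ nat ((a + b)\<^sup>2) * q ^ nat ((a - b)\<^sup>2) = (q\<^sup>2) ^ nat (a\<^sup>2) * (q\<^sup>2) ^ nat (b\<^sup>2)"
proof -
  have nat_sq: "int (nat (x\<^sup>2)) = x\<^sup>2" for x :: int
    by simp
  have "int (nat ((a + b)\<^sup>2) + nat ((a - b)\<^sup>2)) = int (2 * nat (a\<^sup>2) + 2 * nat (b\<^sup>2))"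
    unfolding of_nat_add of_nat_mult nat_sq by (simp add: power2_sum power2_diff)
  then have "nat ((a + b)\<^sup>2) + nat ((a - b)\<^sup>2) = 2 * nat (a\<^sup>2) + 2 * nat (b\<^sup>2)"
    by (simp only: of_nat_eq_iff)
  then show ?thesis by (simp add: power_add[symmetric] power_mult[symmetric])
qed

lemma abs_power2_less_1: "\<bar>q::real\<bar> < 1 \<Longrightarrow> \<bar>q\<^sup>2\<bar> < 1"
  using power_strict_mono[of "\<bar>q\<bar>" 1 2] by simp

text \<open>The second square carries the sign \<open>(-1)^(m + n)\<close>, so pairs of odd sum
  cancel and the others double. The substitution \<open>(a + b, a - b)\<close> parametrizes the
  latter and doubles the quadratic form, hence the nome \<open>q^2\<close>.\<close>

lemma theta_duplication_sum:
  assumes "\<bar>q\<bar> < 1"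
  shows "(theta 0 q)\<^sup>2 + (theta 0 (-q))\<^sup>2 = 2 * (theta 0 (q\<^sup>2))\<^sup>2"
proof -
  let ?g = "\<lambda>(m::int, n::int). q ^ nat (m\<^sup>2) * q ^ nat (n\<^sup>2)"
  let ?E = "{(m::int, n::int). even (m + n)}"
  have 1: "(?g has_sum (theta 0 q)\<^sup>2) UNIV"
    using theta_square_has_sum[OF assms assms] by (simp add: power2_eq_square)
  have "((\<lambda>x. ?g x + (case x of (m, n) \<Rightarrow> (-q) ^ nat (m\<^sup>2) * (-q) ^ nat (n\<^sup>2)))
      has_sum (theta 0 q)\<^sup>2 + (theta 0 (-q))\<^sup>2) UNIV"
    using has_sum_add[OF 1 theta_square_has_sum[of "-q" "-q"]] assms by (simp add: power2_eq_square)
  then have "((\<lambda>x. 2 * ?g x) has_sum (theta 0 q)\<^sup>2 + (theta 0 (-q))\<^sup>2) ?E"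
    by (rule has_sum_cong_neutral[THEN iffD1, rotated -1]) (auto simp: minus_power_nat_square split: if_splits)
  then have "((\<lambda>x. 2 * ?g (case x of (a, b) \<Rightarrow> (a + b, a - b))) has_sum (theta 0 q)\<^sup>2 + (theta 0 (-q))\<^sup>2) UNIV"
    by (subst has_sum_reindex_bij_betw[OF bij_betw_even_lattice])
  then have "((\<lambda>x. 2 * (case x of (a, b) \<Rightarrow> (q\<^sup>2) ^ nat (a\<^sup>2) * (q\<^sup>2) ^ nat (b\<^sup>2)))
      has_sum (theta 0 q)\<^sup>2 + (theta 0 (-q))\<^sup>2) UNIV"
    by (rule has_sum_cong[THEN iffD1, rotated]) (auto simp: power_even_lattice)
  moreover have "((\<lambda>x. 2 * (case x of (a, b) \<Rightarrow> (q\<^sup>2) ^ nat (a\<^sup>2) * (q\<^sup>2) ^ nat (b\<^sup>2)))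
      has_sum 2 * (theta 0 (q\<^sup>2) * theta 0 (q\<^sup>2))) UNIV"
    using assms by (intro has_sum_cmult_right theta_square_has_sum abs_power2_less_1)
  ultimately show ?thesis
    by (simp add: has_sum_unique power2_eq_square)
qed

lemma theta_duplication_prod:
  assumes "\<bar>q\<bar> < 1"
  shows "theta 0 q * theta 0 (-q) = (theta 0 (-(q\<^sup>2)))\<^sup>2"
proof -
  let ?g = "\<lambda>(m::int, n::int). q ^ nat (m\<^sup>2) * (-q) ^ nat (n\<^sup>2)"
  let ?h = "\<lambda>(m::int, n::int). (-q) ^ nat (m\<^sup>2) * q ^ nat (n\<^sup>2)"
  let ?E = "{(m::int, n::int). even (m + n)}"
  have 1: "(?g has_sum theta 0 q * theta 0 (-q)) UNIV"
    using theta_square_has_sum[of q "-q"] assms by simp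
  have 2: "(?h has_sum theta 0 q * theta 0 (-q)) UNIV"
    using theta_square_has_sum[of "-q" q] assms by (simp add: mult.commute)
  \<comment> \<open>\<open>?g\<close> alone carries the sign \<open>(-1)^n\<close> and does not
    vanish off \<open>?E\<close>; only the symmetrized sum, with sign
    \<open>(-1)^n + (-1)^m\<close>, does.\<close>
  have "((\<lambda>x. ?g x + ?h x) has_sum 2 * (theta 0 q * theta 0 (-q))) UNIV"
    using has_sum_add[OF 1 2] by simp
  then have "((\<lambda>x. 2 * ?g x) has_sum 2 * (theta 0 q * theta 0 (-q))) ?E"
    by (rule has_sum_cong_neutral[THEN iffD1, rotated -1]) (auto simp: minus_power_nat_square split: if_splits)
  then have "((\<lambda>x. 2 * ?g (case x of (a, b) \<Rightarrow> (a + b, a - b))) has_sum 2 * (theta 0 q * theta 0 (-q))) UNIV"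
    by (subst has_sum_reindex_bij_betw[OF bij_betw_even_lattice])
  then have "((\<lambda>x. 2 * (case x of (a, b) \<Rightarrow> (-(q\<^sup>2)) ^ nat (a\<^sup>2) * (-(q\<^sup>2)) ^ nat (b\<^sup>2)))
      has_sum 2 * (theta 0 q * theta 0 (-q))) UNIV"
    by (rule has_sum_cong[THEN iffD1, rotated])
       (auto simp: minus_power_nat_square power_even_lattice)
  moreover have "((\<lambda>x. 2 * (case x of (a, b) \<Rightarrow> (-(q\<^sup>2)) ^ nat (a\<^sup>2) * (-(q\<^sup>2)) ^ nat (b\<^sup>2)))
      has_sum 2 * (theta 0 (-(q\<^sup>2)) * theta 0 (-(q\<^sup>2)))) UNIV"
    using assms abs_power2_less_1 by (intro has_sum_cmult_right theta_square_has_sum) auto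
  ultimately show ?thesis
    using has_sum_unique by (fastforce simp: power2_eq_square)
qed

lemma theta_nonneg: "0 \<le> q \<Longrightarrow> q < 1 \<Longrightarrow> 0 \<le> theta j q"
  unfolding theta_def using sqcount_nonneg by (intro suminf_nonneg summable_theta) auto

lemma theta_ge_1:
  assumes "0 \<le> q" "q < 1"
  shows "1 \<le> theta 0 q"
proof -
  have "sum (\<lambda>k. sqcount k * real k ^ 0 * q ^ k) {0} \<le> theta 0 q"
    unfolding theta_def using assms sqcount_nonneg by (intro sum_le_suminf summable_theta) auto
  then show ?thesis by (simp add: sqcount_0)
qed

lemma theta_minus_less:
  assumes "0 < q" "q < 1"
  shows "theta 0 (-q) < theta 0 q"
proof -
  have s: "summable (\<lambda>k. sqcount k * real k ^ 0 * q ^ k)" "summable (\<lambda>k. sqcount k * real k ^ 0 * (-q) ^ k)"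
    using assms by (intro summable_theta; simp)+
  have "0 < (\<Sum>k. sqcount k * real k ^ 0 * q ^ k - sqcount k * real k ^ 0 * (-q) ^ k)"
  proof (rule suminf_pos2[where i = 1])
    show "summable (\<lambda>k. sqcount k * real k ^ 0 * q ^ k - sqcount k * real k ^ 0 * (-q) ^ k)"
      using s by (rule summable_diff)
    show "0 \<le> sqcount k * real k ^ 0 * q ^ k - sqcount k * real k ^ 0 * (-q) ^ k" for k
      using assms sqcount_nonneg[of k] by (cases "even k") auto
  qed (use assms sqcount_1 in auto)
  also have "\<dots> = theta 0 q - theta 0 (-q)"
    unfolding theta_def by (rule suminf_diff[symmetric, OF s])
  finally show ?thesis by simp
qed

lemma power_power_2_tendsto_0:
  assumes "0 \<le> q" "q < (1::real)"
  shows "(\<lambda>n. q ^ (2 ^ n)) \<longlonglongrightarrow> 0"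
proof -
  have "filterlim (\<lambda>n::nat. 2 ^ n :: nat) at_top sequentially"
    by (rule filterlim_subseq) (simp add: strict_mono_def)
  from filterlim_compose[OF LIMSEQ_power_zero[of q] this] assms show ?thesis by simp
qed

text \<open>By \<open>theta_duplication_prod\<close> a zero at \<open>q\<close> propagates to
  \<open>q^2\<close>, \<open>q^4\<close> and so on, contradicting the value 1 at the limit 0. The
  sign then follows from the same formula, whose right-hand side is a square.\<close>

lemma theta_minus_pos:
  assumes "0 < q" "q < 1"
  shows "0 < theta 0 (-q)"
proof -
  have step: "theta 0 (-(x\<^sup>2)) = 0" if "0 < x" "x < 1" "theta 0 (-x) = 0" for x
    using theta_duplication_prod[of x] that by auto
  have "theta 0 (-q) \<noteq> 0"
  proof
    assume 0: "theta 0 (-q) = 0"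
    have *: "theta 0 (-(q ^ (2 ^ n))) = 0" for n
    proof (induction n)
      case (Suc n)
      have "0 < q ^ (2 ^ n)" "q ^ (2 ^ n) < 1"
        using assms by (auto simp: power_less_one_iff)
      from step[OF this Suc] show ?case
        by (simp add: power_mult[symmetric] mult.commute)
    qed (use 0 in simp)
    have "(\<lambda>n. theta 0 (-(q ^ (2 ^ n)))) \<longlonglongrightarrow> theta 0 (-0)"
      using isCont_theta[of 0 0] power_power_2_tendsto_0[of q] assms
      by (intro isCont_tendsto_compose[of _ "theta 0"] tendsto_minus) auto
    then have "(\<lambda>n::nat. 0::real) \<longlonglongrightarrow> 1"
      by (simp add: * theta_at_0)
    then show False
      using LIMSEQ_unique tendsto_const by fastforce
  qed
  moreover have "0 \<le> theta 0 (-q)"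
  proof -
    have "0 \<le> theta 0 q * theta 0 (-q)"
      using theta_duplication_prod[of q] assms by simp
    then show ?thesis
      using theta_ge_1[of q] assms by (simp add: zero_le_mult_iff)
  qed
  ultimately show ?thesis by simp
qed

section \<open>Differential equations of the theta constants\<close>

definition ldtheta :: "real \<Rightarrow> real" where
  "ldtheta q = theta 1 q / theta 0 q"

lemma theta_minus_has_derivative:
  assumes "\<bar>q\<bar> < 1" "q \<noteq> 0"
  shows "((\<lambda>q. theta j (-q)) has_real_derivative theta (Suc j) (-q) / q) (at q)"
proof -
  have "((\<lambda>q. theta j (-q)) has_real_derivative theta (Suc j) (-q) / (-q) * (-1)) (at q)"
    by (rule DERIV_chain2[where f = "theta j" and g = uminus, OF theta_has_derivative[of "-q" j]]) (use assms in \<open>auto intro!: derivative_eq_intros\<close>)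
  then show ?thesis by simp
qed

lemma theta_square_has_derivative:
  assumes "\<bar>q\<bar> < 1" "q \<noteq> 0"
  shows "((\<lambda>q. theta j (q\<^sup>2)) has_real_derivative 2 * theta (Suc j) (q\<^sup>2) / q) (at q)"
proof -
  have "((\<lambda>q. theta j (q\<^sup>2)) has_real_derivative theta (Suc j) (q\<^sup>2) / q\<^sup>2 * (2 * q)) (at q)"
    by (rule DERIV_chain2[where f = "theta j" and g = "\<lambda>q. q\<^sup>2", OF theta_has_derivative[of "q\<^sup>2" j]])
       (use assms abs_power2_less_1 in \<open>auto intro!: derivative_eq_intros\<close>)
  then show ?thesis using assms by (simp add: power2_eq_square mult.commute)
qed

lemma theta_minus_square_has_derivative:
  assumes "\<bar>q\<bar> < 1" "q \<noteq> 0"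
  shows "((\<lambda>q. theta j (-(q\<^sup>2))) has_real_derivative 2 * theta (Suc j) (-(q\<^sup>2)) / q) (at q)"
proof -
  have "((\<lambda>q. theta j (-(q\<^sup>2))) has_real_derivative theta (Suc j) (-(q\<^sup>2)) / q\<^sup>2 * (2 * q)) (at q)"
    by (rule DERIV_chain2[where f = "\<lambda>q. theta j (-q)" and g = "\<lambda>q. q\<^sup>2", OF theta_minus_has_derivative[of "q\<^sup>2" j]])
       (use assms abs_power2_less_1 in \<open>auto intro!: derivative_eq_intros\<close>)
  then show ?thesis using assms by (simp add: power2_eq_square mult.commute)
qed

lemma DERIV_unique_on:
  assumes "(f has_real_derivative D) (at x)" "(g has_real_derivative E) (at x)"
    and "open S" "x \<in> S" "\<And>y. y \<in> S \<Longrightarrow> f y = g y"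
  shows "D = E"
  using has_field_derivative_transform_within_open[OF assms(1,3,4)] assms(2,5) DERIV_unique by metis

lemma theta_duplication_sum_deriv:
  assumes "0 < q" "q < 1"
  shows "theta 0 q * theta 1 q + theta 0 (-q) * theta 1 (-q) = 4 * (theta 0 (q\<^sup>2) * theta 1 (q\<^sup>2))"
proof -
  have q: "\<bar>q\<bar> < 1" "q \<noteq> 0" using assms by auto
  note D = theta_has_derivative[OF q, of 0] theta_minus_has_derivative[OF q, of 0]
    theta_square_has_derivative[OF q, of 0]
  have 1: "((\<lambda>q. (theta 0 q)\<^sup>2 + (theta 0 (-q))\<^sup>2) has_real_derivative
      2 * (theta 0 q * theta 1 q + theta 0 (-q) * theta 1 (-q)) / q) (at q)"
    by (rule derivative_eq_intros D refl)+ (use q in \<open>simp add: field_simps\<close>)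
  have 2: "((\<lambda>q. 2 * (theta 0 (q\<^sup>2))\<^sup>2) has_real_derivative
      8 * (theta 0 (q\<^sup>2) * theta 1 (q\<^sup>2)) / q) (at q)"
    by (rule derivative_eq_intros D refl)+ (use q in \<open>simp add: field_simps\<close>)
  have "2 * (theta 0 q * theta 1 q + theta 0 (-q) * theta 1 (-q)) / q
      = 8 * (theta 0 (q\<^sup>2) * theta 1 (q\<^sup>2)) / q"
    by (rule DERIV_unique_on[OF 1 2, of "{-1<..<1}"]) (use q in \<open>auto intro!: theta_duplication_sum\<close>)
  then show ?thesis using q by (simp add: field_simps)
qed

lemma theta_duplication_prod_deriv:
  assumes "0 < q" "q < 1"
  shows "theta 1 q * theta 0 (-q) + theta 0 q * theta 1 (-q) = 4 * (theta 0 (-(q\<^sup>2)) * theta 1 (-(q\<^sup>2)))"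
proof -
  have q: "\<bar>q\<bar> < 1" "q \<noteq> 0" using assms by auto
  note D = theta_has_derivative[OF q, of 0] theta_minus_has_derivative[OF q, of 0]
    theta_minus_square_has_derivative[OF q, of 0]
  have 1: "((\<lambda>q. theta 0 q * theta 0 (-q)) has_real_derivative
      (theta 1 q * theta 0 (-q) + theta 0 q * theta 1 (-q)) / q) (at q)"
    by (rule derivative_eq_intros D refl)+ (use q in \<open>simp add: field_simps\<close>)
  have 2: "((\<lambda>q. (theta 0 (-(q\<^sup>2)))\<^sup>2) has_real_derivative
      4 * (theta 0 (-(q\<^sup>2)) * theta 1 (-(q\<^sup>2))) / q) (at q)"
    by (rule derivative_eq_intros D refl)+ (use q in \<open>simp add: field_simps\<close>)
  have "(theta 1 q * theta 0 (-q) + theta 0 q * theta 1 (-q)) / q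
      = 4 * (theta 0 (-(q\<^sup>2)) * theta 1 (-(q\<^sup>2))) / q"
    by (rule DERIV_unique_on[OF 1 2, of "{-1<..<1}"]) (use q in \<open>auto intro!: theta_duplication_prod\<close>)
  then show ?thesis using q by (simp add: field_simps)
qed

lemma square_bounds: "0 < q \<Longrightarrow> q < 1 \<Longrightarrow> 0 < q\<^sup>2 \<and> q\<^sup>2 < (1::real)"
  by (simp add: power_less_one_iff)

lemma theta_pos: "0 < q \<Longrightarrow> q < 1 \<Longrightarrow> 0 < theta 0 q"
  using theta_ge_1[of q] by simp

text \<open>Logarithmic derivatives of the two duplication formulas.\<close>

lemma ldtheta_duplication:
  assumes "0 < q" "q < 1"
  shows "ldtheta q + ldtheta (-q) = 4 * ldtheta (-(q\<^sup>2))"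
    and "(theta 0 q)\<^sup>2 * ldtheta q + (theta 0 (-q))\<^sup>2 * ldtheta (-q)
      = 2 * ((theta 0 q)\<^sup>2 + (theta 0 (-q))\<^sup>2) * ldtheta (q\<^sup>2)"
proof -
  define x y z w where "x = theta 0 q" and "y = theta 0 (-q)" and "z = theta 0 (q\<^sup>2)" and "w = theta 0 (-(q\<^sup>2))"
  have pos: "x > 0" "y > 0" "z > 0" "w > 0"
    unfolding x_def y_def z_def w_def
    using theta_pos[OF assms] theta_minus_pos[OF assms] square_bounds[OF assms] theta_pos[of "q\<^sup>2"]
      theta_minus_pos[of "q\<^sup>2"] by auto
  have 1: "x * y = w\<^sup>2" "x\<^sup>2 + y\<^sup>2 = 2 * z\<^sup>2"
    unfolding x_def y_def z_def w_def using assms theta_duplication_prod theta_duplication_sum by auto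
  have T: "theta 1 q = ldtheta q * x" "theta 1 (-q) = ldtheta (-q) * y"
    "theta 1 (q\<^sup>2) = ldtheta (q\<^sup>2) * z" "theta 1 (-(q\<^sup>2)) = ldtheta (-(q\<^sup>2)) * w"
    using pos unfolding ldtheta_def x_def y_def z_def w_def by auto
  have "ldtheta q * x * y + x * (ldtheta (-q) * y) = 4 * (w * (ldtheta (-(q\<^sup>2)) * w))"
    using theta_duplication_prod_deriv[OF assms] unfolding T x_def y_def w_def .
  then have "(x * y) * (ldtheta q + ldtheta (-q)) = w\<^sup>2 * (4 * ldtheta (-(q\<^sup>2)))"
    by (simp add: algebra_simps power2_eq_square)
  then show "ldtheta q + ldtheta (-q) = 4 * ldtheta (-(q\<^sup>2))"
    using pos by (simp add: 1)
  have "x * (ldtheta q * x) + y * (ldtheta (-q) * y) = 4 * (z * (ldtheta (q\<^sup>2) * z))"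
    using theta_duplication_sum_deriv[OF assms] unfolding T x_def y_def z_def .
  also have "\<dots> = 2 * (2 * z\<^sup>2) * ldtheta (q\<^sup>2)"
    by (simp add: power2_eq_square)
  finally show "(theta 0 q)\<^sup>2 * ldtheta q + (theta 0 (-q))\<^sup>2 * ldtheta (-q)
      = 2 * ((theta 0 q)\<^sup>2 + (theta 0 (-q))\<^sup>2) * ldtheta (q\<^sup>2)"
    unfolding 1(2)[symmetric] x_def[symmetric] y_def[symmetric] by (simp add: algebra_simps power2_eq_square)
qed

lemma theta_quotient_tendsto: "((\<lambda>q. theta j q / q) \<longlongrightarrow> 2) (at 0)" if "j \<noteq> 0"
  using theta_has_derivative_0[of j] that by (simp add: has_field_derivative_iff theta_at_0)

lemma theta_tendsto_0: "((\<lambda>q. theta j q) \<longlongrightarrow> (if j = 0 then 1 else 0)) (at 0)"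
  using isCont_theta[of 0 j] by (simp add: isCont_def theta_at_0)

lemma at_0_uminus: "filterlim (\<lambda>q::real. - q) (at 0) (at 0)"
  by (intro filterlim_atI tendsto_eq_intros) (auto simp: eventually_at_filter)

lemma theta_minus_quotient_tendsto: "((\<lambda>q. theta j (-q) / q) \<longlongrightarrow> -2) (at 0)" if "j \<noteq> 0"
  using tendsto_minus[OF filterlim_compose[OF theta_quotient_tendsto[OF that] at_0_uminus]] by simp

lemma theta_minus_tendsto_0: "((\<lambda>q. theta j (-q)) \<longlongrightarrow> (if j = 0 then 1 else 0)) (at 0)"
  using filterlim_compose[OF theta_tendsto_0 at_0_uminus] .

text \<open>By Jacobi's identity this is the fourth power of the third theta constant; the
  difference is taken as its definition.\<close>

definition thetaX :: "real \<Rightarrow> real" where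
  "thetaX q = theta 0 q ^ 4 - theta 0 (-q) ^ 4"

lemma thetaX_pos: "0 < q \<Longrightarrow> q < 1 \<Longrightarrow> 0 < thetaX q"
  unfolding thetaX_def using theta_minus_less[of q] theta_minus_pos[of q]
  by (simp add: power_strict_mono)

lemma thetaX_quotient_tendsto: "((\<lambda>q. thetaX q / q) \<longlongrightarrow> 16) (at 0)"
proof -
  have "(theta 0 has_real_derivative 2) (at 0)" "((\<lambda>q. theta 0 (-q)) has_real_derivative -2) (at 0)"
    using theta_has_derivative_0[of 0] DERIV_chain2[of "theta 0" 2 uminus 0 "-1" UNIV]
      DERIV_minus[OF DERIV_ident, of 0 UNIV]
    by simp_all
  then have "(thetaX has_real_derivative 16) (at 0)"
    unfolding thetaX_def by (auto intro!: derivative_eq_intros simp: theta_at_0)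
  then show ?thesis
    by (simp add: has_field_derivative_iff thetaX_def theta_at_0)
qed

lemma ldtheta_quotient_tendsto:
  "((\<lambda>q. ldtheta q / q) \<longlongrightarrow> 2) (at 0)" "((\<lambda>q. ldtheta (-q) / q) \<longlongrightarrow> -2) (at 0)"
proof -
  have "((\<lambda>q. (theta 1 q / q) / theta 0 q) \<longlongrightarrow> 2 / 1) (at 0)"
    by (intro tendsto_divide theta_quotient_tendsto) (use theta_tendsto_0[of 0] in auto)
  then show "((\<lambda>q. ldtheta q / q) \<longlongrightarrow> 2) (at 0)"
    by (simp add: ldtheta_def mult.commute)
  have "((\<lambda>q. (theta 1 (-q) / q) / theta 0 (-q)) \<longlongrightarrow> -2 / 1) (at 0)"
    by (intro tendsto_divide theta_minus_quotient_tendsto) (use theta_minus_tendsto_0[of 0] in auto)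
  then show "((\<lambda>q. ldtheta (-q) / q) \<longlongrightarrow> -2) (at 0)"
    by (simp add: ldtheta_def mult.commute)
qed

lemma filterlim_power_power_2_at_0:
  assumes "0 < q" "q < (1::real)"
  shows "filterlim (\<lambda>n. q ^ (2 ^ n)) (at 0) sequentially"
  using power_power_2_tendsto_0[of q] assms by (intro filterlim_atI) auto

lemma power_power_2_bounds:
  assumes "0 < q" "q < (1::real)"
  shows "0 < q ^ (2 ^ n) \<and> q ^ (2 ^ n) < 1"
  using assms by (auto simp: power_less_one_iff)

lemma power_power_2_Suc: "(q::real) ^ (2 ^ Suc n) = (q ^ (2 ^ n))\<^sup>2"
  by (simp add: power_mult[symmetric] mult.commute)

text \<open>With \<open>a\<close> and \<open>b\<close> the squares of the two theta constants,
  numerator and denominator of \<open>h\<close> are both multiplied by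
  \<open>(a - b) / (4 * (a + b))\<close> when \<open>q\<close> is squared, so \<open>h\<close> is
  constant along the iteration. Its limit -1/4 comes from the leading terms: \<open>2 q\<close> and
  \<open>- 2 q\<close> for \<open>ldtheta\<close> at \<open>q\<close> and \<open>-q\<close>, and
  \<open>16 q\<close> for \<open>thetaX\<close>.\<close>

lemma ldtheta_diff:
  assumes q: "0 < q" "q < 1"
  shows "ldtheta (-q) = ldtheta q - thetaX q / 4"
proof -
  define h where "h = (\<lambda>q. (ldtheta (-q) - ldtheta q) / thetaX q)"
  have inv: "h (q\<^sup>2) = h q" if q: "0 < q" "q < 1" for q
  proof -
    define a b where "a = (theta 0 q)\<^sup>2" and "b = (theta 0 (-q))\<^sup>2"
    define p r where "p = ldtheta q" and "r = ldtheta (-q)"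
    have ab: "0 < b" "b < a"
      unfolding a_def b_def using theta_minus_pos[OF q] theta_minus_less[OF q]
      by (auto intro: power_strict_mono)
    have X: "thetaX q = (a - b) * (a + b)"
      by (simp add: thetaX_def a_def b_def algebra_simps power2_eq_square power4_eq_xxxx)
    have z: "(theta 0 (q\<^sup>2))\<^sup>2 = (a + b) / 2"
      using theta_duplication_sum[of q] q by (simp add: a_def b_def)
    have w: "(theta 0 (-(q\<^sup>2)))\<^sup>2 = theta 0 q * theta 0 (-q)"
      using theta_duplication_prod[of q] q by simp
    have "thetaX (q\<^sup>2) = ((theta 0 (q\<^sup>2))\<^sup>2)\<^sup>2 - ((theta 0 (-(q\<^sup>2)))\<^sup>2)\<^sup>2"
      by (simp add: thetaX_def power_mult[symmetric])
    also have "\<dots> = (a - b)\<^sup>2 / 4"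
      unfolding z w a_def b_def by (simp add: power2_eq_square field_simps)
    finally have X2: "thetaX (q\<^sup>2) = (a - b)\<^sup>2 / 4" .
    have r2: "ldtheta (-(q\<^sup>2)) = (p + r) / 4"
      using ldtheta_duplication(1)[OF q] by (simp add: p_def r_def)
    have p2: "ldtheta (q\<^sup>2) = (a * p + b * r) / (2 * (a + b))"
    proof -
      have "a * p + b * r = 2 * (a + b) * ldtheta (q\<^sup>2)"
        using ldtheta_duplication(2)[OF q] by (simp add: p_def r_def a_def b_def)
      moreover have "2 * (a + b) \<noteq> 0" using ab by simp
      ultimately show ?thesis by (simp only: nonzero_mult_div_cancel_left simp_thms)
    qed
    have "ldtheta (-(q\<^sup>2)) - ldtheta (q\<^sup>2) = (r - p) * (a - b) / (4 * (a + b))"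
      unfolding r2 p2 using ab by (simp add: field_simps)
    moreover have alg: "((r - p) * d / (4 * e)) / (d\<^sup>2 / 4) = (r - p) / (d * e)" if "d \<noteq> 0" "e \<noteq> 0" for d e :: real
      using that by (simp add: field_simps power2_eq_square)
    moreover have "a - b \<noteq> 0" "a + b \<noteq> 0" using ab by auto
    ultimately show ?thesis
      unfolding h_def X X2 p_def r_def by (simp only: not_False_eq_True)
  qed
  have const: "h (q ^ (2 ^ n)) = h q" for n
  proof (induction n)
    case (Suc n)
    then show ?case
      using inv[of "q ^ (2 ^ n)"] power_power_2_bounds[OF q] by (simp only: power_power_2_Suc)
  qed simp
  have "((\<lambda>q. (ldtheta (-q) / q - ldtheta q / q) / (thetaX q / q)) \<longlongrightarrow> (-2 - 2) / 16) (at 0)"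
    by (intro tendsto_intros ldtheta_quotient_tendsto thetaX_quotient_tendsto) auto
  then have "(h \<longlongrightarrow> (-2 - 2) / 16) (at 0)"
  proof (rule Lim_transform_eventually)
    show "\<forall>\<^sub>F x in at 0. (ldtheta (- x) / x - ldtheta x / x) / (thetaX x / x) = h x"
      by (auto simp: eventually_at_filter h_def diff_divide_distrib[symmetric])
  qed
  then have "(\<lambda>n. h (q ^ (2 ^ n))) \<longlonglongrightarrow> (-2 - 2) / 16"
    using filterlim_power_power_2_at_0[OF q] by (rule filterlim_compose)
  then have "h q = -1/4"
    by (simp add: const LIMSEQ_const_iff)
  then show ?thesis
    using thetaX_pos[OF q] by (simp add: h_def field_simps)
qed

lemma ldtheta_square:
  assumes q: "0 < q" "q < 1"
  shows "2 * ldtheta (q\<^sup>2) = ldtheta q - ((theta 0 q)\<^sup>2 - (theta 0 (-q))\<^sup>2) * (theta 0 (-q))\<^sup>2 / 4"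
proof -
  define a b where "a = (theta 0 q)\<^sup>2" and "b = (theta 0 (-q))\<^sup>2"
  have ab: "0 < a" "0 < b"
    unfolding a_def b_def using theta_minus_pos[OF q] theta_pos[OF q] by auto
  have X: "thetaX q = (a - b) * (a + b)"
    by (simp add: thetaX_def a_def b_def algebra_simps power2_eq_square power4_eq_xxxx)
  have "2 * (a + b) * ldtheta (q\<^sup>2) = a * ldtheta q + b * ldtheta (-q)"
    using ldtheta_duplication(2)[OF q] by (simp add: a_def b_def)
  also have "\<dots> = (a + b) * (ldtheta q - (a - b) * b / 4)"
    unfolding ldtheta_diff[OF q] X by (simp add: field_simps)
  finally have "(a + b) * (2 * ldtheta (q\<^sup>2)) = (a + b) * (ldtheta q - (a - b) * b / 4)"
    by (simp only: mult.commute mult.left_commute mult.assoc)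
  moreover have "a + b \<noteq> 0" using ab by simp
  ultimately show ?thesis unfolding a_def[symmetric] b_def[symmetric] by (simp only: mult_cancel_left simp_thms)
qed

text \<open>The derivative of \<open>ldtheta\<close> under \<open>q d/dq\<close>.\<close>

definition ldtheta2 :: "real \<Rightarrow> real" where
  "ldtheta2 q = theta 2 q / theta 0 q - (ldtheta q)\<^sup>2"

lemma ldtheta_has_derivative:
  assumes "0 < q" "q < 1"
  shows "(ldtheta has_real_derivative ldtheta2 q / q) (at q)"
proof -
  have q: "\<bar>q\<bar> < 1" "q \<noteq> 0" using assms by auto
  have "((\<lambda>q. theta 1 q / theta 0 q) has_real_derivative
     (theta (Suc 1) q / q * theta 0 q - theta 1 q * (theta (Suc 0) q / q)) / (theta 0 q * theta 0 q)) (at q)"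
    by (intro DERIV_divide theta_has_derivative q) (use theta_pos[OF assms] in simp)
  moreover have "(theta (Suc 1) q / q * theta 0 q - theta 1 q * (theta (Suc 0) q / q)) / (theta 0 q * theta 0 q)
      = ldtheta2 q / q"
    using theta_pos[OF assms] q unfolding ldtheta2_def ldtheta_def
    by (simp add: field_simps power2_eq_square numeral_2_eq_2)
  ultimately show ?thesis unfolding ldtheta_def[abs_def] by simp
qed

lemma square_mult_power_tendsto_0:
  assumes "0 \<le> q" "q < (1::real)"
  shows "(\<lambda>n. real n ^ 2 * q ^ n) \<longlonglongrightarrow> 0"
proof -
  have "(\<lambda>n. real n * sqrt q ^ n) \<longlonglongrightarrow> 0"
    using powser_times_n_limit_0[of "sqrt q"] assms by simp
  then have "(\<lambda>n. (real n * sqrt q ^ n) ^ 2) \<longlonglongrightarrow> 0 ^ 2"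
    by (rule tendsto_power)
  moreover have "(real n * sqrt q ^ n) ^ 2 = real n ^ 2 * q ^ n" for n
  proof -
    have "(sqrt q ^ n)\<^sup>2 = ((sqrt q)\<^sup>2) ^ n" by (metis power_mult mult.commute)
    then show ?thesis using assms by (simp add: power_mult_distrib)
  qed
  ultimately show ?thesis by simp
qed

text \<open>An analogue of Ramanujan's equation for the Eisenstein series of weight 2: the
  derivative of a quasimodular form is a multiple of its square plus a modular form of weight 4. The
  defect \<open>N\<close> satisfies \<open>N q = 4 * N (q^2)\<close>, so \<open>N q\<close> is
  \<open>4^n\<close> times the value at \<open>q^(2^n)\<close>. Since \<open>N q / q\<close> has a
  limit at 0 and \<open>4^n q^(2^n)\<close> tends to 0, the defect vanishes.\<close>

lemma ldtheta2_eq: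
  assumes q: "0 < q" "q < 1"
  shows "ldtheta2 q = 2 * (ldtheta q)\<^sup>2 + thetaX q * theta 0 (-q) ^ 4 / 8"
proof -
  define N where "N = (\<lambda>q. ldtheta2 q - 2 * (ldtheta q)\<^sup>2 - thetaX q * theta 0 (-q) ^ 4 / 8)"
  have inv: "N q = 4 * N (q\<^sup>2)" if q: "0 < q" "q < 1" for q
  proof -
    define a b where "a = (theta 0 q)\<^sup>2" and "b = (theta 0 (-q))\<^sup>2"
    define p where "p = ldtheta q"
    have q': "\<bar>q\<bar> < 1" "q \<noteq> 0" using q by auto
    have pos: "theta 0 q > 0" "theta 0 (-q) > 0" using theta_pos[OF q] theta_minus_pos[OF q] by auto
    have X: "thetaX q = (a - b) * (a + b)"
      by (simp add: thetaX_def a_def b_def algebra_simps power2_eq_square power4_eq_xxxx)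
    have z: "(theta 0 (q\<^sup>2))\<^sup>2 = (a + b) / 2"
      using theta_duplication_sum[of q] q by (simp add: a_def b_def)
    have w: "(theta 0 (-(q\<^sup>2)))\<^sup>2 = theta 0 q * theta 0 (-q)"
      using theta_duplication_prod[of q] q by simp
    have w4: "theta 0 (-(q\<^sup>2)) ^ 4 = a * b"
    proof -
      have "theta 0 (-(q\<^sup>2)) ^ 4 = ((theta 0 (-(q\<^sup>2)))\<^sup>2)\<^sup>2" by (simp add: power_mult[symmetric])
      then show ?thesis unfolding w by (simp add: a_def b_def power_mult_distrib)
    qed
    have z4: "theta 0 (q\<^sup>2) ^ 4 = ((a + b) / 2)\<^sup>2"
      unfolding z[symmetric] by (simp add: power_mult[symmetric])
    have X2: "thetaX (q\<^sup>2) = (a - b)\<^sup>2 / 4"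
      unfolding thetaX_def w4 z4 by (simp add: power2_eq_square field_simps)
    have r: "ldtheta (-q) = p - (a - b) * (a + b) / 4"
      using ldtheta_diff[OF q] X by (simp add: p_def)
    have p2: "ldtheta (q\<^sup>2) = (p - (a - b) * b / 4) / 2"
      using ldtheta_square[OF q] by (simp add: p_def a_def b_def)
    have T: "theta (Suc 0) q = p * theta 0 q" "theta (Suc 0) (-q) = ldtheta (-q) * theta 0 (-q)"
      using pos by (auto simp: p_def ldtheta_def)
    have Da: "((\<lambda>q. (theta 0 q)\<^sup>2) has_real_derivative 2 * a * p / q) (at q)"
      by (rule derivative_eq_intros theta_has_derivative[OF q'] refl)+
         (simp add: T a_def power2_eq_square)
    have Db: "((\<lambda>q. (theta 0 (-q))\<^sup>2) has_real_derivative 2 * b * ldtheta (-q) / q) (at q)"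
      by (rule derivative_eq_intros theta_minus_has_derivative[OF q'] refl)+
         (simp add: T b_def power2_eq_square)
    \<comment> \<open>Differentiating both sides of \<open>ldtheta_square\<close> relates
      \<open>ldtheta2\<close> at \<open>q^2\<close> and at \<open>q\<close>; the chain rule turns
      the factor 2 into 4.\<close>
    have 1: "((\<lambda>q. 2 * ldtheta (q\<^sup>2)) has_real_derivative 4 * ldtheta2 (q\<^sup>2) / q) (at q)"
    proof -
      have "((\<lambda>q. 2 * ldtheta (q\<^sup>2)) has_real_derivative 2 * (ldtheta2 (q\<^sup>2) / q\<^sup>2 * (2 * q))) (at q)"
        by (rule DERIV_cmult, rule DERIV_chain2[where f = ldtheta and g = "\<lambda>q. q\<^sup>2", OF ldtheta_has_derivative])
           (use square_bounds[OF q] in \<open>auto intro!: derivative_eq_intros\<close>)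
      then show ?thesis using q' by (simp add: power2_eq_square)
    qed
    have 2: "((\<lambda>q. ldtheta q - ((theta 0 q)\<^sup>2 - (theta 0 (-q))\<^sup>2) * (theta 0 (-q))\<^sup>2 / 4) has_real_derivative
        ldtheta2 q / q - ((2 * a * p / q - 2 * b * ldtheta (-q) / q) * b + (2 * b * ldtheta (-q) / q) * (a - b)) / 4) (at q)"
      unfolding a_def b_def
      by (intro DERIV_diff DERIV_cdivide DERIV_mult ldtheta_has_derivative q Da[unfolded a_def] Db[unfolded b_def])
    have "4 * ldtheta2 (q\<^sup>2) / q =
        ldtheta2 q / q - ((2 * a * p / q - 2 * b * ldtheta (-q) / q) * b + (2 * b * ldtheta (-q) / q) * (a - b)) / 4"
      by (rule DERIV_unique_on[OF 1 2, of "{0<..<1}"]) (use q ldtheta_square in auto)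
    also have "\<dots> = (ldtheta2 q - ((2 * a * p - 2 * b * ldtheta (-q)) * b + (2 * b * ldtheta (-q)) * (a - b)) / 4) / q"
      by (simp add: diff_divide_distrib add_divide_distrib left_diff_distrib right_diff_distrib)
    finally have D: "4 * ldtheta2 (q\<^sup>2) =
        ldtheta2 q - ((2 * a * p - 2 * b * ldtheta (-q)) * b + (2 * b * ldtheta (-q)) * (a - b)) / 4"
      using q'(2) by (simp only: divide_cancel_right simp_thms)
    have b2: "theta 0 (-q) ^ 4 = b\<^sup>2"
      by (simp add: b_def power_mult[symmetric])
    have "4 * N (q\<^sup>2) = 4 * ldtheta2 (q\<^sup>2) - 8 * (ldtheta (q\<^sup>2))\<^sup>2 - thetaX (q\<^sup>2) * theta 0 (-(q\<^sup>2)) ^ 4 / 2"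
      by (simp add: N_def)
    also have "\<dots> = N q"
      unfolding D X2 w4 N_def X r p2 b2 p_def[symmetric] by (simp add: field_simps power2_eq_square)
    finally show ?thesis ..
  qed
  have iter: "N q = (2 ^ n)\<^sup>2 * N (q ^ (2 ^ n))" for n
  proof (induction n)
    case (Suc n)
    then show ?case
      using inv[of "q ^ (2 ^ n)"] power_power_2_bounds[OF q, of n]
      by (simp add: power_power_2_Suc power2_eq_square del: power_Suc) (simp add: power2_eq_square)
  qed simp
  \<comment> \<open>The coefficient 3 collects the square of \<open>ldtheta\<close> hidden in
    \<open>ldtheta2\<close> and the two in \<open>N\<close>. The leading terms \<open>2 q\<close> of
    \<open>theta 2\<close> and \<open>16 q / 8\<close> of the modular part cancel.\<close>
  have "((\<lambda>q. (theta 2 q / q) / theta 0 q - 3 * (ldtheta q / q) * ldtheta q - (thetaX q / q) * theta 0 (-q) ^ 4 / 8)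
      \<longlongrightarrow> 2 / 1 - 3 * 2 * (0 / 1) - 16 * 1 ^ 4 / 8) (at 0)"
    unfolding ldtheta_def
    by (intro tendsto_intros ldtheta_quotient_tendsto[unfolded ldtheta_def] thetaX_quotient_tendsto theta_quotient_tendsto)
       (use theta_tendsto_0[of 0] theta_tendsto_0[of 1] theta_minus_tendsto_0[of 0] in auto)
  then have "((\<lambda>q. N q / q) \<longlongrightarrow> 2 / 1 - 3 * 2 * (0 / 1) - 16 * 1 ^ 4 / 8) (at 0)"
  proof (rule Lim_transform_eventually)
    show "\<forall>\<^sub>F x in at 0. (theta 2 x / x) / theta 0 x - 3 * (ldtheta x / x) * ldtheta x - (thetaX x / x) * theta 0 (-x) ^ 4 / 8 = N x / x"
      by (auto simp: eventually_at_filter N_def ldtheta2_def field_simps power2_eq_square)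
  qed
  then have "((\<lambda>q. N q / q) \<longlongrightarrow> 0) (at 0)" by simp
  then have 1: "(\<lambda>n. N (q ^ (2 ^ n)) / q ^ (2 ^ n)) \<longlonglongrightarrow> 0"
    using filterlim_power_power_2_at_0[OF q] by (rule filterlim_compose)
  have "filterlim (\<lambda>n::nat. 2 ^ n :: nat) at_top sequentially"
    by (rule filterlim_subseq) (simp add: strict_mono_def)
  from filterlim_compose[OF square_mult_power_tendsto_0 this] q
  have 2: "(\<lambda>n. (2 ^ n)\<^sup>2 * q ^ (2 ^ n)) \<longlonglongrightarrow> 0" by simp
  have "(\<lambda>n. (2 ^ n)\<^sup>2 * q ^ (2 ^ n) * (N (q ^ (2 ^ n)) / q ^ (2 ^ n))) \<longlonglongrightarrow> 0 * 0"
    by (rule tendsto_mult[OF 2 1])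
  moreover have "(2 ^ n)\<^sup>2 * q ^ (2 ^ n) * (N (q ^ (2 ^ n)) / q ^ (2 ^ n)) = N q" for n
    using iter[of n] q by simp
  ultimately have "N q = 0" by (simp add: LIMSEQ_const_iff)
  then show ?thesis by (simp add: N_def)
qed

text \<open>\<open>theta 0 q\<close> and \<open>theta 0 (-q)\<close> are Jacobi's theta constants, so \<open>lam\<close> is the modular
  lambda function, the square of the elliptic modulus.\<close>

definition lam :: "real \<Rightarrow> real" where
  "lam q = 1 - (theta 0 (-q) / theta 0 q) ^ 4"

lemma thetaX_lam: "0 < q \<Longrightarrow> q < 1 \<Longrightarrow> thetaX q = lam q * theta 0 q ^ 4"
  and theta_minus_lam: "0 < q \<Longrightarrow> q < 1 \<Longrightarrow> theta 0 (-q) ^ 4 = (1 - lam q) * theta 0 q ^ 4"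
  using theta_pos[of q] by (auto simp: lam_def thetaX_def field_simps)

lemma lam_bounds: "0 < q \<Longrightarrow> q < 1 \<Longrightarrow> 0 < lam q \<and> lam q < 1"
  using theta_pos[of q] theta_minus_less[of q] theta_minus_pos[of q]
  by (auto simp: lam_def power_less_one_iff)

lemma ldtheta2_lam:
  assumes "0 < q" "q < 1"
  shows "ldtheta2 q = 2 * (ldtheta q)\<^sup>2 + lam q * (1 - lam q) * theta 0 q ^ 8 / 8"
  using ldtheta2_eq[OF assms] thetaX_lam[OF assms] theta_minus_lam[OF assms]
    power_add[of "theta 0 q" 4 4] by simp

lemma lam_has_derivative:
  assumes q: "0 < q" "q < 1"
  shows "(lam has_real_derivative lam q * (1 - lam q) * theta 0 q ^ 4 / q) (at q)"
proof -
  have q': "\<bar>q\<bar> < 1" "q \<noteq> 0" using q by auto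
  define x y where "x = theta 0 q" and "y = theta 0 (-q)"
  have pos: "x > 0" "y > 0" using theta_pos[OF q] theta_minus_pos[OF q] by (auto simp: x_def y_def)
  have T: "theta (Suc 0) q = ldtheta q * x" "theta (Suc 0) (-q) = ldtheta (-q) * y"
    using pos by (auto simp: x_def y_def ldtheta_def)
  have "((\<lambda>q. theta 0 (-q) / theta 0 q) has_real_derivative
      (theta (Suc 0) (-q) / q * x - y * (theta (Suc 0) q / q)) / (x * x)) (at q)"
    unfolding x_def y_def
    by (intro DERIV_divide theta_has_derivative theta_minus_has_derivative q') (use theta_pos[OF q] in simp)
  also have "(theta (Suc 0) (-q) / q * x - y * (theta (Suc 0) q / q)) / (x * x)
      = (ldtheta (-q) - ldtheta q) * (y / x) / q"
    unfolding T using pos q' by (simp add: field_simps)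
  also have "\<dots> = - (lam q * x ^ 4 / 4) * (y / x) / q"
    using ldtheta_diff[OF q] thetaX_lam[OF q] by (simp add: x_def)
  finally have D: "((\<lambda>q. theta 0 (-q) / theta 0 q) has_real_derivative
      - (lam q * x ^ 4 / 4) * (y / x) / q) (at q)" .
  have "(lam has_real_derivative - (4 * (- (lam q * x ^ 4 / 4) * (y / x) / q) * (y / x) ^ 3)) (at q)"
    unfolding lam_def[abs_def]
    by (rule derivative_eq_intros D refl)+ (simp add: lam_def x_def y_def)
  also have "- (4 * (- (lam q * x ^ 4 / 4) * (y / x) / q) * (y / x) ^ 3) = lam q * (y / x) ^ 4 * x ^ 4 / q"
    by (simp add: power4_eq_xxxx power3_eq_cube)
  also have "(y / x) ^ 4 = 1 - lam q" by (simp add: lam_def x_def y_def)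
  finally show ?thesis by (simp add: x_def)
qed

section \<open>Derivatives of the theta constant as polynomials in the modulus\<close>

text \<open>\<open>beta j\<close> describes the part of weight \<open>2 j\<close> of
  \<open>theta j / theta 0\<close> that is free of \<open>ldtheta\<close>. The coefficient of
  \<open>beta j\<close> in the recursion is the one for which the terms in \<open>s\<close> cancel
  in \<open>heat_step\<close>. The value at 1 is 0 because \<open>theta 1\<close> is exactly
  \<open>ldtheta\<close> times \<open>theta 0\<close>.\<close>

fun beta :: "nat \<Rightarrow> real poly" where
  "beta 0 = 1"
| "beta (Suc 0) = 0"
| "beta (Suc (Suc j)) = [:0, 1, -1:] *
     (smult 4 (pderiv (beta (Suc j))) + smult (2 * (real j + 1) * (2 * real j + 1)) (beta j))"

definition Bpoly :: "nat \<Rightarrow> real poly" where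
  "Bpoly p = (\<Sum>j\<le>2 * p. smult ((-1) ^ j * real (4 * p choose (2 * j))) (beta j * beta (2 * p - j)))"

text \<open>\<open>theta j\<close> equals \<open>theta 0\<close> times a polynomial in the quasimodular form \<open>ldtheta\<close> whose
  coefficients are the modular forms \<open>alpha i\<close>.\<close>

definition alpha :: "nat \<Rightarrow> real \<Rightarrow> real" where
  "alpha j q = poly (beta j) (lam q) * theta 0 q ^ (4 * j) / 4 ^ j"

lemma poly_beta_Suc:
  "poly (beta (Suc j)) t = t * (1 - t) *
     (4 * poly (pderiv (beta j)) t + 2 * real j * (2 * real j - 1) * poly (beta (j - 1)) t)"
  by (cases j) (auto simp: algebra_simps)

text \<open>The derivative of \<open>lam\<close> reproduces the \<open>pderiv\<close> part of
  \<open>beta (Suc j)\<close>; the other part of the recursion is moved across and appears as the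
  term in \<open>alpha (j - 1)\<close>. The middle term is the derivative of the power of the theta
  constant.\<close>

lemma alpha_has_derivative:
  assumes q: "0 < q" "q < 1"
  shows "(alpha j has_real_derivative
     (alpha (Suc j) q + 4 * real j * ldtheta q * alpha j q
       - real j * (2 * real j - 1) * (lam q * (1 - lam q) * theta 0 q ^ 8 / 8) * alpha (j - 1) q) / q) (at q)"
proof -
  have q': "\<bar>q\<bar> < 1" "q \<noteq> 0" using q by auto
  define x t P where "x = theta 0 q" and "t = lam q" and "P = ldtheta q"
  have x: "x > 0" using theta_pos[OF q] by (simp add: x_def)
  have T: "theta (Suc 0) q = P * x"
    using x by (simp add: x_def P_def ldtheta_def)
  have D1: "((\<lambda>q. theta 0 q ^ (4 * j)) has_real_derivative 4 * real j * P * x ^ (4 * j) / q) (at q)"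
  proof -
    have "((\<lambda>q. theta 0 q ^ (4 * j)) has_real_derivative real (4 * j) * (theta (Suc 0) q / q * theta 0 q ^ (4 * j - Suc 0))) (at q)"
      by (rule DERIV_power[OF theta_has_derivative[OF q']])
    also have "real (4 * j) * (theta (Suc 0) q / q * theta 0 q ^ (4 * j - Suc 0)) = 4 * real j * P * x ^ (4 * j) / q"
      unfolding T x_def[symmetric] by (cases "j = 0") (auto simp: power_eq_if[of x "4 * j"])
    finally show ?thesis .
  qed
  have D2: "((\<lambda>q. poly (beta j) (lam q)) has_real_derivative poly (pderiv (beta j)) t * (t * (1 - t) * x ^ 4 / q)) (at q)"
    unfolding t_def x_def by (rule DERIV_chain2[OF poly_DERIV lam_has_derivative[OF q]])
  have D: "(alpha j has_real_derivative
      (poly (pderiv (beta j)) t * (t * (1 - t) * x ^ 4 / q) * x ^ (4 * j)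
        + 4 * real j * P * x ^ (4 * j) / q * poly (beta j) t) / 4 ^ j) (at q)"
    unfolding alpha_def[abs_def] x_def t_def
    by (rule DERIV_cdivide, rule DERIV_mult[OF D2[unfolded x_def t_def] D1[unfolded x_def]])
  \<comment> \<open>For \<open>j = 0\<close> the truncated index \<open>j - 1\<close> is wrong, but
    then the factor \<open>real j\<close> vanishes; carrying that factor along avoids a case
    distinction.\<close>
  have 8: "x ^ 8 * (real j * alpha (j - 1) q) = 16 * (real j * (poly (beta (j - 1)) t * x ^ (4 * j + 4) / 4 ^ Suc j))"
    by (cases j) (auto simp: alpha_def x_def t_def power_add field_simps)
  have "alpha (Suc j) q = poly (beta (Suc j)) t * x ^ (4 * j + 4) / 4 ^ Suc j"
    by (simp add: alpha_def x_def t_def add.commute)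
  also have "\<dots> = t * (1 - t) * poly (pderiv (beta j)) t * x ^ 4 * x ^ (4 * j) / 4 ^ j
      + (2 * real j - 1) * (t * (1 - t)) / 8 * (x ^ 8 * (real j * alpha (j - 1) q))"
    unfolding poly_beta_Suc 8 by (simp add: field_simps power_add)
  finally have S: "alpha (Suc j) q = \<dots>" .
  have "(poly (pderiv (beta j)) t * (t * (1 - t) * x ^ 4 / q) * x ^ (4 * j)
        + 4 * real j * P * x ^ (4 * j) / q * poly (beta j) t) / 4 ^ j
      = (alpha (Suc j) q + 4 * real j * ldtheta q * alpha j q
       - real j * (2 * real j - 1) * (lam q * (1 - lam q) * theta 0 q ^ 8 / 8) * alpha (j - 1) q) / q"
    unfolding S unfolding P_def[symmetric] t_def[symmetric] x_def[symmetric]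
    using q' by (simp add: alpha_def x_def[symmetric] t_def[symmetric] field_simps)
  with D show ?thesis by simp
qed

text \<open>Coefficients of Hermite type: divided by \<open>fact (2 * j)\<close> they become
  \<open>1 / (fact i * 2 ^ i * fact (2 * j - 2 * i))\<close>, which is what multiplication by an
  exponential series does to coefficients normalized by \<open>fact (2 * j)\<close>.\<close>

definition hcoef :: "nat \<Rightarrow> nat \<Rightarrow> real" where
  "hcoef j i = (if i \<le> j then fact (2 * j) / (fact i * 2 ^ i * fact (2 * j - 2 * i)) else 0)"

lemma hcoef_0: "hcoef j 0 = 1"
  by (simp add: hcoef_def)

lemma hcoef_Suc_right:
  assumes "k \<le> j"
  shows "hcoef j (Suc k) * (real k + 1) = hcoef j k * (real (j - k) * (2 * real (j - k) - 1))"
proof (cases "k = j")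
  case False
  then obtain d where d: "j = Suc (k + d)" using assms by (metis less_iff_Suc_add le_neq_implies_less)
  have "2 * j - 2 * k = Suc (Suc (2 * d))" "2 * j - 2 * Suc k = 2 * d" using d by auto
  then show ?thesis
    using assms False by (simp add: hcoef_def d field_simps del: of_nat_Suc) (simp add: algebra_simps)
qed (simp add: hcoef_def)

lemma hcoef_Suc_Suc:
  assumes "k \<le> j"
  shows "hcoef (Suc j) (Suc k) = hcoef j (Suc k) + hcoef j k * (1 + 4 * real j - 2 * real k)"
proof -
  have "2 * Suc j - 2 * Suc k = 2 * j - 2 * k" "2 * Suc j = Suc (Suc (2 * j))" by auto
  then have 1: "hcoef (Suc j) (Suc k) * (real k + 1) = hcoef j k * ((real j + 1) * (2 * real j + 1))"
    using assms by (simp add: hcoef_def field_simps del: of_nat_Suc) (simp add: algebra_simps)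
  have r: "real (j - k) = real j - real k" using assms by simp
  have "(hcoef j (Suc k) + hcoef j k * (1 + 4 * real j - 2 * real k)) * (real k + 1)
      = hcoef j k * ((real j + 1) * (2 * real j + 1))"
    unfolding distrib_right hcoef_Suc_right[OF assms] r by (simp add: algebra_simps)
  then show ?thesis
    using 1 by (metis mult_right_cancel of_nat_Suc add.commute of_nat_neq_0)
qed

text \<open>One application of \<open>q d/dq\<close> to the formula for \<open>theta j\<close>, with
  \<open>P\<close> for \<open>ldtheta\<close> and \<open>P' = 2 P^2 + s\<close>. The contributions
  to \<open>P ^ Suc i\<close> are 1 from the prefactor, \<open>2 i\<close> from \<open>P ^ i\<close>
  and \<open>4 (j - i)\<close> from \<open>al\<close>, in total \<open>1 + 4 j - 2 i\<close>. The
  terms in \<open>s\<close> cancel after an index shift, by \<open>hcoef_Suc_right\<close>.\<close>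

lemma heat_step:
  fixes P s :: real and al :: "nat \<Rightarrow> real"
  shows "(\<Sum>i\<le>j. hcoef j i * (P * P ^ i * al (j - i) + real i * P ^ (i - 1) * (2 * P\<^sup>2 + s) * al (j - i)
     + P ^ i * (al (Suc (j - i)) + 4 * real (j - i) * P * al (j - i)
         - real (j - i) * (2 * real (j - i) - 1) * s * al (j - i - 1))))
   = (\<Sum>i\<le>Suc j. hcoef (Suc j) i * P ^ i * al (Suc j - i))" (is "?L = ?R")
proof -
  define u where "u = (\<lambda>i. hcoef j i * P ^ i * al (Suc j - i))"
  define v where "v = (\<lambda>i. hcoef j i * (1 + 4 * real j - 2 * real i) * P ^ Suc i * al (j - i))"
  define w where "w = (\<lambda>i. hcoef j i * real i * P ^ (i - 1) * al (j - i))"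
  define z where "z = (\<lambda>i. hcoef j i * (real (j - i) * (2 * real (j - i) - 1)) * P ^ i * al (j - i - 1))"
  have "?L = (\<Sum>i\<le>j. u i + v i + s * (w i - z i))"
  proof (rule sum.cong[OF refl])
    fix i assume "i \<in> {..j}"
    then have i: "i \<le> j" by simp
    have 1: "Suc (j - i) = Suc j - i" using i by simp
    have 2: "real i * P ^ (i - 1) * (2 * P\<^sup>2 + s) = 2 * real i * P ^ Suc i + s * (real i * P ^ (i - 1))"
      by (cases i) (auto simp: power2_eq_square algebra_simps)
    have 3: "real (j - i) = real j - real i" using i by simp
    show "hcoef j i * (P * P ^ i * al (j - i) + real i * P ^ (i - 1) * (2 * P\<^sup>2 + s) * al (j - i)
     + P ^ i * (al (Suc (j - i)) + 4 * real (j - i) * P * al (j - i)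
         - real (j - i) * (2 * real (j - i) - 1) * s * al (j - i - 1))) = u i + v i + s * (w i - z i)"
      unfolding 1 2 u_def v_def w_def z_def 3 by (simp add: algebra_simps)
  qed
  also have "\<dots> = (\<Sum>i\<le>j. u i) + (\<Sum>i\<le>j. v i) + s * ((\<Sum>i\<le>j. w i) - (\<Sum>i\<le>j. z i))"
    by (simp add: sum.distrib sum_distrib_left[symmetric] sum_subtractf)
  also have "(\<Sum>i\<le>j. w i) = (\<Sum>i\<le>j. z i)"
  proof (cases j)
    case (Suc k)
    have "(\<Sum>i\<le>j. w i) = w 0 + (\<Sum>i\<le>k. w (Suc i))"
      unfolding Suc by (rule sum.atMost_Suc_shift)
    also have "\<dots> = (\<Sum>i\<le>k. z i)"
    proof -
      have "w (Suc i) = z i" if "i \<le> k" for i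
        using hcoef_Suc_right[of i j] that Suc unfolding w_def z_def
        by (simp del: of_nat_Suc) (simp add: algebra_simps)
      then show ?thesis by (simp add: w_def)
    qed
    also have "\<dots> = (\<Sum>i\<le>j. z i)"
      unfolding Suc by (simp add: z_def Suc)
    finally show ?thesis .
  qed (simp add: w_def z_def)
  also have "(\<Sum>i\<le>j. u i) + (\<Sum>i\<le>j. v i) = ?R"
  proof -
    have "?R = al (Suc j) + (\<Sum>i\<le>j. hcoef (Suc j) (Suc i) * P ^ Suc i * al (j - i))"
      by (subst sum.atMost_Suc_shift) (simp add: hcoef_0)
    also have "\<dots> = al (Suc j) + (\<Sum>i\<le>j. u (Suc i) + v i)"
    proof -
      have "hcoef (Suc j) (Suc i) * P ^ Suc i * al (j - i) = u (Suc i) + v i" if "i \<le> j" for i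
        unfolding hcoef_Suc_Suc[OF that] u_def v_def by (simp add: algebra_simps)
      then show ?thesis by simp
    qed
    also have "\<dots> = (u 0 + (\<Sum>i\<le>j. u (Suc i))) + (\<Sum>i\<le>j. v i)"
      by (simp add: sum.distrib u_def hcoef_0)
    also have "u 0 + (\<Sum>i\<le>j. u (Suc i)) = (\<Sum>i\<le>Suc j. u i)"
      by (rule sum.atMost_Suc_shift[symmetric])
    also have "\<dots> = (\<Sum>i\<le>j. u i)"
      by (simp add: u_def hcoef_def)
    finally show ?thesis by simp
  qed
  finally show ?thesis by simp
qed

lemma theta_eq_alpha:
  assumes "0 < q" "q < 1"
  shows "theta j q = theta 0 q * (\<Sum>i\<le>j. hcoef j i * ldtheta q ^ i * alpha (j - i) q)"
  using assms
proof (induction j arbitrary: q)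
  case 0
  then show ?case by (simp add: hcoef_0 alpha_def)
next
  case (Suc j)
  note q = Suc.prems
  have q': "\<bar>q\<bar> < 1" "q \<noteq> 0" using q by auto
  define x P s where "x = theta 0 q" and "P = ldtheta q" and "s = lam q * (1 - lam q) * theta 0 q ^ 8 / 8"
  have x: "x > 0" using theta_pos[OF q] by (simp add: x_def)
  have T: "theta (Suc 0) q = P * x"
    using x by (simp add: x_def P_def ldtheta_def)
  define A where "A = (\<lambda>i. P ^ i * alpha (j - i) q)"
  define A' where "A' = (\<lambda>i. real i * P ^ (i - 1) * (2 * P\<^sup>2 + s) * alpha (j - i) q
     + P ^ i * (alpha (Suc (j - i)) q + 4 * real (j - i) * P * alpha (j - i) q
         - real (j - i) * (2 * real (j - i) - 1) * s * alpha (j - i - 1) q))"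
  have DA: "((\<lambda>q. hcoef j i * ldtheta q ^ i * alpha (j - i) q) has_real_derivative hcoef j i * (A' i / q)) (at q)" for i
  proof -
    have D1: "((\<lambda>q. ldtheta q ^ i) has_real_derivative real i * ((2 * P\<^sup>2 + s) / q * P ^ (i - Suc 0))) (at q)"
      using DERIV_power[OF ldtheta_has_derivative[OF q], of i] ldtheta2_lam[OF q]
      by (simp add: P_def s_def)
    have "((\<lambda>q. ldtheta q ^ i * alpha (j - i) q) has_real_derivative A' i / q) (at q)"
      by (rule DERIV_cong[OF DERIV_mult[OF D1 alpha_has_derivative[OF q, folded P_def s_def]]])
         (use q' in \<open>simp add: A'_def P_def[symmetric] field_simps\<close>)
    then show ?thesis
      using DERIV_cmult by (fastforce simp: mult.assoc)
  qed
  have D1: "((\<lambda>q. \<Sum>i\<le>j. hcoef j i * ldtheta q ^ i * alpha (j - i) q) has_real_derivative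
      (\<Sum>i\<le>j. hcoef j i * (A' i / q))) (at q)"
    by (rule DERIV_sum) (rule DA)
  have D2: "((\<lambda>q. theta 0 q * (\<Sum>i\<le>j. hcoef j i * ldtheta q ^ i * alpha (j - i) q)) has_real_derivative
      P * x / q * (\<Sum>i\<le>j. hcoef j i * ldtheta q ^ i * alpha (j - i) q) + (\<Sum>i\<le>j. hcoef j i * (A' i / q)) * x) (at q)"
    using DERIV_mult[OF theta_has_derivative[OF q', of 0] D1] unfolding T x_def[symmetric] .
  have "theta (Suc j) q / q = P * x / q * (\<Sum>i\<le>j. hcoef j i * ldtheta q ^ i * alpha (j - i) q) + (\<Sum>i\<le>j. hcoef j i * (A' i / q)) * x"
    by (rule DERIV_unique_on[OF theta_has_derivative[OF q'] D2, of "{0<..<1}"]) (use q Suc.IH in auto)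
  also have "\<dots> = x * (\<Sum>i\<le>j. hcoef j i * (P * P ^ i * alpha (j - i) q + A' i)) / q"
    unfolding P_def[symmetric]
    by (simp add: sum_distrib_left sum_distrib_right sum_divide_distrib sum.distrib[symmetric] add_divide_distrib algebra_simps)
  also have "(\<Sum>i\<le>j. hcoef j i * (P * P ^ i * alpha (j - i) q + A' i))
      = (\<Sum>i\<le>Suc j. hcoef (Suc j) i * P ^ i * alpha (Suc j - i) q)"
    using heat_step[of j P "\<lambda>j. alpha j q" s] unfolding A'_def by (simp add: add.assoc)
  finally show ?case using q' by (simp add: x_def P_def)
qed

section \<open>The Hecke theta series expressed by the theta constant and the modulus\<close>

definition thetaform :: "nat \<Rightarrow> real \<Rightarrow> real" where
  "thetaform p q = (\<Sum>j\<le>2 * p. (-1) ^ j * real (4 * p choose (2 * j)) * theta j q * theta (2 * p - j) q)"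

text \<open>In generating functions with denominators \<open>fact (2 * j)\<close> the powers of
  \<open>ldtheta\<close> sum to \<open>fps_exp (P / 2)\<close>, and in the alternating series to its
  inverse. Hence \<open>F' * F\<close> is a constant multiple of \<open>A' * A\<close>, and the
  binomial sum over \<open>theta\<close> becomes the same sum over \<open>alpha\<close>.\<close>

lemma thetaform_eq:
  assumes q: "0 < q" "q < 1"
  shows "thetaform p q = theta 0 q ^ (8 * p + 2) * poly (Bpoly p) (lam q) / 16 ^ p"
proof -
  define P where "P = ldtheta q"
  define A where "A = Abs_fps (\<lambda>j. alpha j q / fact (2 * j))"
  define A' where "A' = Abs_fps (\<lambda>j. (-1) ^ j * (alpha j q / fact (2 * j)))"
  define F where "F = Abs_fps (\<lambda>j. theta j q / fact (2 * j))"
  define F' where "F' = Abs_fps (\<lambda>j. (-1) ^ j * (theta j q / fact (2 * j)))"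
  have c: "theta j q / fact (2 * j) = theta 0 q * (\<Sum>i=0..j. (P / 2) ^ i / fact i * (alpha (j - i) q / fact (2 * (j - i))))" for j
    unfolding theta_eq_alpha[OF q, of j] P_def[symmetric] atMost_atLeast0
    unfolding times_divide_eq_right[symmetric] sum_divide_distrib
    by (intro arg_cong[where f = "\<lambda>x. theta 0 q * x"] sum.cong refl)
       (simp add: hcoef_def power_divide diff_mult_distrib2)
  have F: "F = fps_const (theta 0 q) * (fps_exp (P / 2) * A)"
    by (rule fps_ext) (simp only: F_def A_def fps_mult_nth[of "fps_exp _"] fps_nth_Abs_fps c fps_mult_left_const_nth fps_exp_nth of_nat_fact)
  have F': "F' = fps_const (theta 0 q) * (fps_exp (- (P / 2)) * A')"
  proof (rule fps_ext)
    fix n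
    have "(-1) ^ n * (theta 0 q * (\<Sum>i=0..n. (P / 2) ^ i / fact i * (alpha (n - i) q / fact (2 * (n - i)))))
      = theta 0 q * (\<Sum>i=0..n. (- (P / 2)) ^ i / fact i * ((-1) ^ (n - i) * (alpha (n - i) q / fact (2 * (n - i)))))"
    proof -
      have "(-1) ^ n * ((P / 2) ^ i / fact i * (alpha (n - i) q / fact (2 * (n - i))))
        = (- (P / 2)) ^ i / fact i * ((-1) ^ (n - i) * (alpha (n - i) q / fact (2 * (n - i))))" if "i \<le> n" for i
      proof -
        have "(-1) ^ n = (-1 :: real) ^ i * (-1) ^ (n - i)" using that by (simp add: power_add[symmetric])
        moreover have "(- (P / 2)) ^ i = (-1) ^ i * (P / 2) ^ i" by (rule power_minus)
        ultimately show ?thesis by simp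
      qed
      then have "(\<Sum>i=0..n. (-1) ^ n * ((P / 2) ^ i / fact i * (alpha (n - i) q / fact (2 * (n - i)))))
        = (\<Sum>i=0..n. (- (P / 2)) ^ i / fact i * ((-1) ^ (n - i) * (alpha (n - i) q / fact (2 * (n - i)))))"
        by (intro sum.cong) auto
      then show ?thesis by (simp only: sum_distrib_left[symmetric] mult.left_commute)
    qed
    then show "fps_nth F' n = fps_nth (fps_const (theta 0 q) * (fps_exp (- (P / 2)) * A')) n"
      by (simp only: F'_def A'_def fps_mult_nth[of "fps_exp _"] fps_nth_Abs_fps c fps_mult_left_const_nth fps_exp_nth of_nat_fact)
  qed
  have "F' * F = fps_const ((theta 0 q)\<^sup>2) * (fps_exp (- (P / 2)) * fps_exp (P / 2)) * (A' * A)"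
    unfolding F F' by (simp add: power2_eq_square fps_const_mult[symmetric] ac_simps del: fps_const_mult)
  also have "fps_exp (- (P / 2)) * fps_exp (P / 2) = 1"
    by (simp add: fps_exp_add_mult[symmetric])
  finally have prod: "F' * F = fps_const ((theta 0 q)\<^sup>2) * (A' * A)" by simp
  have coef: "fps_nth (Abs_fps (\<lambda>j. (-1) ^ j * (a j / fact (2 * j))) * Abs_fps (\<lambda>j. a j / fact (2 * j))) (2 * p)
      = (\<Sum>j\<le>2 * p. (-1) ^ j * real (4 * p choose (2 * j)) * a j * a (2 * p - j)) / fact (4 * p)" for a :: "nat \<Rightarrow> real"
  proof -
    have "(-1) ^ j * (a j / fact (2 * j)) * (a (2 * p - j) / fact (2 * (2 * p - j)))
        = (-1) ^ j * real (4 * p choose (2 * j)) * a j * a (2 * p - j) / fact (4 * p)" if "j \<le> 2 * p" for j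
    proof -
      have "real (4 * p choose (2 * j)) = fact (4 * p) / (fact (2 * j) * fact (2 * (2 * p - j)))"
        using binomial_fact[of "2 * j" "4 * p", where 'a = real] that by (simp add: diff_mult_distrib2)
      then show ?thesis by simp
    qed
    then show ?thesis
      by (simp add: fps_mult_nth atMost_atLeast0 sum_divide_distrib)
  qed
  have "thetaform p q / fact (4 * p) = fps_nth (F' * F) (2 * p)"
    unfolding F'_def F_def coef thetaform_def ..
  also have "\<dots> = (theta 0 q)\<^sup>2 * fps_nth (A' * A) (2 * p)"
    unfolding prod by simp
  also have "\<dots> = (theta 0 q)\<^sup>2 * (\<Sum>j\<le>2 * p. (-1) ^ j * real (4 * p choose (2 * j)) * alpha j q * alpha (2 * p - j) q) / fact (4 * p)"
    unfolding A'_def A_def coef by simp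
  finally have "thetaform p q = (theta 0 q)\<^sup>2 * (\<Sum>j\<le>2 * p. (-1) ^ j * real (4 * p choose (2 * j)) * alpha j q * alpha (2 * p - j) q)"
    by simp
  also have "(\<Sum>j\<le>2 * p. (-1) ^ j * real (4 * p choose (2 * j)) * alpha j q * alpha (2 * p - j) q)
      = (\<Sum>j\<le>2 * p. (-1) ^ j * real (4 * p choose (2 * j)) * (poly (beta j) (lam q) * poly (beta (2 * p - j)) (lam q)) * (theta 0 q ^ (8 * p) / 16 ^ p))"
  proof (intro sum.cong refl)
    fix j assume "j \<in> {..2 * p}"
    then have e: "4 * j + 4 * (2 * p - j) = 8 * p" "j + (2 * p - j) = 2 * p" by auto
    have "theta 0 q ^ (4 * j) * theta 0 q ^ (4 * (2 * p - j)) = theta 0 q ^ (8 * p)"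
      "(4::real) ^ j * 4 ^ (2 * p - j) = 16 ^ p"
      unfolding power_add[symmetric] e by (simp_all add: power_mult)
    then have "alpha j q * alpha (2 * p - j) q = poly (beta j) (lam q) * poly (beta (2 * p - j)) (lam q) * (theta 0 q ^ (8 * p) / 16 ^ p)"
      unfolding alpha_def by (simp add: divide_simps)
    then show "(-1) ^ j * real (4 * p choose (2 * j)) * alpha j q * alpha (2 * p - j) q
      = (-1) ^ j * real (4 * p choose (2 * j)) * (poly (beta j) (lam q) * poly (beta (2 * p - j)) (lam q)) * (theta 0 q ^ (8 * p) / 16 ^ p)"
      by (simp only: mult.assoc)
  qed
  also have "\<dots> = poly (Bpoly p) (lam q) * (theta 0 q ^ (8 * p) / 16 ^ p)"
    by (simp only: sum_distrib_right[symmetric] Bpoly_def poly_sum poly_smult poly_mult)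
  finally show ?thesis by (simp add: power_add power2_eq_square)
qed

section \<open>Complete elliptic integrals\<close>

definition ellK_integrand :: "real \<Rightarrow> real \<Rightarrow> real" where
  "ellK_integrand k x = 1 / sqrt ((1 - x\<^sup>2) * (1 - k\<^sup>2 * x\<^sup>2))"

text \<open>The integrands in question blow up at end points. Continuity is therefore used for the
  indefinite integral \<open>F\<close>, and the fundamental theorem in the form that asks for
  derivatives in the open interval only.\<close>

lemma has_integral_substitution_unit_interval:
  fixes f :: "real \<Rightarrow> real"
  assumes f: "f integrable_on {0..1}" and cont: "\<And>x. 0 < x \<Longrightarrow> x < 1 \<Longrightarrow> isCont f x"
    and phi: "continuous_on {0..1} \<phi>" "\<phi> 0 = 0" "\<phi> 1 = 1"
    and range: "\<And>s. 0 < s \<Longrightarrow> s < 1 \<Longrightarrow> 0 < \<phi> s \<and> \<phi> s < 1"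
    and deriv: "\<And>s. 0 < s \<Longrightarrow> s < 1 \<Longrightarrow> (\<phi> has_real_derivative \<phi>' s) (at s)"
    and g: "\<And>s. 0 < s \<Longrightarrow> s < 1 \<Longrightarrow> g s = f (\<phi> s) * \<phi>' s"
  shows "(g has_integral integral {0..1} f) {0..1}"
proof -
  define F where "F = (\<lambda>x. integral {0..x} f)"
  have contF: "continuous_on {0..1} F"
    unfolding F_def by (rule indefinite_integral_continuous_1[OF f])
  have DF: "(F has_real_derivative f x) (at x)" if x: "0 < x" "x < 1" for x
  proof -
    have "((\<lambda>u. integral {0..u} f) has_vector_derivative f x) (at x within ({0..1} - {}))"
      by (rule integral_has_vector_derivative_continuous_at[OF f])
         (use x cont in \<open>auto intro: continuous_at_imp_continuous_at_within\<close>)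
    then show ?thesis
      using x by (simp add: F_def has_real_derivative_iff_has_vector_derivative at_within_Icc_at)
  qed
  have "\<phi> ` {0..1} \<subseteq> {0..1}"
  proof
    fix y assume "y \<in> \<phi> ` {0..1}"
    then obtain s where s: "0 \<le> s" "s \<le> 1" "y = \<phi> s" by auto
    then show "y \<in> {0..1}"
      using range[of s] phi by (cases "s = 0"; cases "s = 1") auto
  qed
  then have "continuous_on {0..1} (\<lambda>s. F (\<phi> s))"
    using continuous_on_compose2[OF contF phi(1)] by blast
  moreover have "((\<lambda>s. F (\<phi> s)) has_vector_derivative g s) (at s)" if "s \<in> {0<..<1}" for s
    using DERIV_chain2[OF DF deriv, of s] range[of s] g[of s] that
    by (simp add: has_real_derivative_iff_has_vector_derivative)
  ultimately have "(g has_integral F (\<phi> 1) - F (\<phi> 0)) {0..1}"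
    by (intro fundamental_theorem_of_calculus_interior) auto
  then show ?thesis by (simp add: phi F_def)
qed

lemma modulus_bound:
  fixes k x :: real
  assumes "0 \<le> k" "k < 1" "0 \<le> x" "x \<le> 1"
  shows "1 - k\<^sup>2 \<le> 1 - k\<^sup>2 * x\<^sup>2" "0 < 1 - k\<^sup>2 * x\<^sup>2" "0 \<le> 1 - x\<^sup>2" "1 - x\<^sup>2 \<le> 1 - k\<^sup>2 * x\<^sup>2"
proof -
  have x: "x\<^sup>2 \<le> 1" "0 \<le> x\<^sup>2"
    using power_le_one[OF assms(3,4)] by simp_all
  have k: "k\<^sup>2 < 1" "0 \<le> k\<^sup>2"
    using assms(1,2) by (simp_all add: power_less_one_iff)
  show "1 - k\<^sup>2 \<le> 1 - k\<^sup>2 * x\<^sup>2"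
    using mult_left_mono[OF x(1) k(2)] by simp
  then show "0 < 1 - k\<^sup>2 * x\<^sup>2" using k by linarith
  show "0 \<le> 1 - x\<^sup>2" using x by simp
  show "1 - x\<^sup>2 \<le> 1 - k\<^sup>2 * x\<^sup>2"
    using mult_right_mono[of "k\<^sup>2" 1 "x\<^sup>2"] k x by simp
qed

lemma square_less_1: "0 < x \<Longrightarrow> x < 1 \<Longrightarrow> x\<^sup>2 < (1::real)"
  by (simp add: power_less_one_iff)

lemma has_integral_arcsin: "((\<lambda>x. 1 / sqrt (1 - x\<^sup>2)) has_integral pi / 2) {0..1}"
proof -
  have "((\<lambda>x. 1 / sqrt (1 - x\<^sup>2)) has_integral arcsin 1 - arcsin 0) {0..1}"
  proof (rule fundamental_theorem_of_calculus_interior)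
    show "(arcsin has_vector_derivative 1 / sqrt (1 - x\<^sup>2)) (at x)" if "x \<in> {0<..<1}" for x
      using DERIV_arcsin[of x] that
      by (simp add: has_real_derivative_iff_has_vector_derivative inverse_eq_divide)
  qed (auto intro!: continuous_intros)
  then show ?thesis by simp
qed

lemma ellK_integrand_0: "ellK_integrand 0 x = 1 / sqrt (1 - x\<^sup>2)"
  by (simp add: ellK_integrand_def)

lemma ellK_integrand_nonneg:
  assumes "0 \<le> k" "k < 1" "0 \<le> x" "x \<le> 1"
  shows "0 \<le> ellK_integrand k x"
  using modulus_bound[OF assms] by (simp add: ellK_integrand_def)

lemma ellK_integrand_upper:
  assumes "0 \<le> k" "k < 1" "0 \<le> x" "x \<le> 1"
  shows "ellK_integrand k x \<le> 1 / sqrt (1 - k\<^sup>2) * (1 / sqrt (1 - x\<^sup>2))"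
proof (cases "x = 1")
  case False
  then have x: "x\<^sup>2 < 1" using assms by (simp add: power_less_one_iff)
  have "(1 - k\<^sup>2) * (1 - x\<^sup>2) \<le> (1 - x\<^sup>2) * (1 - k\<^sup>2 * x\<^sup>2)"
    using mult_right_mono[OF modulus_bound(1,3)[OF assms]] by (simp add: mult.commute)
  moreover have "0 < (1 - k\<^sup>2) * (1 - x\<^sup>2)"
    using x assms by (simp add: power_less_one_iff)
  ultimately show ?thesis
    unfolding ellK_integrand_def
    by (simp add: real_sqrt_mult[symmetric] frac_le)
qed (simp add: ellK_integrand_def)

lemma ellK_integrable:
  assumes "0 \<le> k" "k < 1"
  shows "ellK_integrand k integrable_on {0..1}"
proof (rule measurable_bounded_by_integrable_imp_integrable)
  show "ellK_integrand k \<in> borel_measurable (lebesgue_on {0..1})"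
    unfolding ellK_integrand_def
    by (intro measurable_restrict_space1 measurable_completion) measurable
  show "(\<lambda>x. 1 / sqrt (1 - k\<^sup>2) * (1 / sqrt (1 - x\<^sup>2))) integrable_on {0..1}"
    using has_integral_mult_right[OF has_integral_arcsin] by blast
  show "norm (ellK_integrand k x) \<le> 1 / sqrt (1 - k\<^sup>2) * (1 / sqrt (1 - x\<^sup>2))" if "x \<in> {0..1}" for x
    using ellK_integrand_upper[OF assms, of x] ellK_integrand_nonneg[OF assms, of x] that by auto
qed simp

lemma ellK_eq: "ellK k = integral {0..1} (ellK_integrand k)"
  by (simp add: ellK_def ellK_integrand_def[abs_def])

lemma ellK_has_integral:
  assumes "0 \<le> k" "k < 1"
  shows "(ellK_integrand k has_integral ellK k) {0..1}"
  unfolding ellK_eq using ellK_integrable[OF assms] by (rule integrable_integral)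

lemma ellK_integrand_isCont:
  assumes "0 \<le> k" "k < 1" "0 < x" "x < 1"
  shows "isCont (ellK_integrand k) x"
proof -
  have "(1 - x\<^sup>2) * (1 - k\<^sup>2 * x\<^sup>2) \<noteq> 0"
    using modulus_bound[of k x] square_less_1[of x] assms by auto
  then show ?thesis
    unfolding ellK_integrand_def by (intro continuous_intros) auto
qed

lemma integral_unit_interval_pos:
  fixes f :: "real \<Rightarrow> real"
  assumes f: "f integrable_on {0..1}" and nonneg: "\<And>x. x \<in> {0..1} \<Longrightarrow> 0 \<le> f x"
    and cont: "\<And>x. 0 < x \<Longrightarrow> x < 1 \<Longrightarrow> isCont f x" and pos: "\<And>x. 0 < x \<Longrightarrow> x < 1 \<Longrightarrow> 0 < f x"
  shows "0 < integral {0..1} f"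
proof -
  let ?I = "{1/4..3/4::real}"
  have c: "continuous_on ?I f"
    by (rule continuous_at_imp_continuous_on) (use cont in auto)
  obtain m where m: "m \<in> ?I" "\<And>x. x \<in> ?I \<Longrightarrow> f m \<le> f x"
    using continuous_attains_inf[OF _ _ c] by auto
  have fm: "0 < f m" using pos m(1) by auto
  have fI: "f integrable_on ?I" by (rule integrable_continuous_interval[OF c])
  have "0 < f m * (1/2)" using fm by simp
  also have "\<dots> = integral ?I (\<lambda>_. f m)" by simp
  also have "\<dots> \<le> integral ?I f"
    by (rule integral_le) (use m(2) fI in auto)
  also have "\<dots> \<le> integral {0..1} f"
    by (rule integral_subset_le) (use f fI nonneg in auto)
  finally show ?thesis .
qed

lemma ellK_integrand_pos:
  assumes "0 \<le> k" "k < 1" "0 < x" "x < 1"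
  shows "0 < ellK_integrand k x"
  using modulus_bound[of k x] square_less_1[of x] assms by (simp add: ellK_integrand_def)

lemma ellK_pos: "0 \<le> k \<Longrightarrow> k < 1 \<Longrightarrow> 0 < ellK k"
  unfolding ellK_eq
  by (rule integral_unit_interval_pos)
     (auto intro: ellK_integrable ellK_integrand_nonneg ellK_integrand_isCont ellK_integrand_pos)

lemma ellK_integrand_less:
  assumes "0 \<le> k" "k < l" "l < 1" "0 < x" "x < 1"
  shows "ellK_integrand k x < ellK_integrand l x"
proof -
  have x: "0 < 1 - x\<^sup>2" "0 < x\<^sup>2" using square_less_1[of x] assms by auto
  have "k\<^sup>2 < l\<^sup>2" using assms by (simp add: power_strict_mono)
  then have "1 - l\<^sup>2 * x\<^sup>2 < 1 - k\<^sup>2 * x\<^sup>2" using x by simp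
  then have "(1 - x\<^sup>2) * (1 - l\<^sup>2 * x\<^sup>2) < (1 - x\<^sup>2) * (1 - k\<^sup>2 * x\<^sup>2)"
    using x by simp
  moreover have "0 < (1 - x\<^sup>2) * (1 - l\<^sup>2 * x\<^sup>2)"
    using x modulus_bound[of l x] assms by simp
  ultimately show ?thesis
    unfolding ellK_integrand_def by (intro divide_strict_left_mono) (auto intro!: mult_pos_pos)
qed

lemma ellK_strict_mono:
  assumes "0 \<le> k" "k < l" "l < 1"
  shows "ellK k < ellK l"
proof -
  have i: "ellK_integrand l integrable_on {0..1}" "ellK_integrand k integrable_on {0..1}"
    using assms by (auto intro!: ellK_integrable)
  have "0 < integral {0..1} (\<lambda>x. ellK_integrand l x - ellK_integrand k x)"
  proof (rule integral_unit_interval_pos)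
    show "(\<lambda>x. ellK_integrand l x - ellK_integrand k x) integrable_on {0..1}"
      using i by (rule integrable_diff)
    show "0 \<le> ellK_integrand l x - ellK_integrand k x" if "x \<in> {0..1}" for x
      using ellK_integrand_less[OF assms, of x] that
      by (cases "x = 0"; cases "x = 1") (auto simp: ellK_integrand_def)
    show "isCont (\<lambda>x. ellK_integrand l x - ellK_integrand k x) x" if "0 < x" "x < 1" for x
      using assms that by (intro continuous_diff ellK_integrand_isCont) auto
    show "0 < ellK_integrand l x - ellK_integrand k x" if "0 < x" "x < 1" for x
      using ellK_integrand_less[OF assms that] by simp
  qed
  also have "\<dots> = ellK l - ellK k"
    unfolding ellK_eq by (rule integral_diff[OF i])
  finally show ?thesis by simp
qed

lemma ellK_0: "ellK 0 = pi / 2"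
  using has_integral_arcsin unfolding ellK_eq ellK_integrand_0[abs_def] by (rule integral_unique)

lemma ellK_upper:
  assumes "0 \<le> k" "k < 1"
  shows "ellK k \<le> 1 / sqrt (1 - k\<^sup>2) * (pi / 2)"
  by (rule has_integral_le[OF ellK_has_integral[OF assms] has_integral_mult_right[OF has_integral_arcsin]])
     (use ellK_integrand_upper[OF assms] in auto)

lemma ellK_lower: "0 \<le> k \<Longrightarrow> k < 1 \<Longrightarrow> pi / 2 \<le> ellK k"
  using ellK_strict_mono[of 0 k] by (cases "k = 0") (auto simp: ellK_0)

text \<open>Gauss's substitution \<open>\<phi>\<close> makes \<open>1 - l^2 \<phi>^2\<close> a
  perfect square, whose root cancels against the numerator of \<open>\<phi>'\<close>; the factor
  \<open>1 - \<phi>^2\<close> supplies the radicand for the modulus \<open>k\<close>.\<close>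

lemma ellK_Landen:
  assumes k: "0 \<le> k" "k < 1"
  shows "ellK (2 * sqrt k / (1 + k)) = (1 + k) * ellK k"
proof -
  define l where "l = 2 * sqrt k / (1 + k)"
  have l2: "l\<^sup>2 = 4 * k / (1 + k)\<^sup>2" using k by (simp add: l_def power_divide power_mult_distrib)
  have "4 * k < (1 + k)\<^sup>2" using k zero_less_power2[of "1 - k"] by (simp add: power2_eq_square algebra_simps)
  then have "l\<^sup>2 < 1\<^sup>2" using k by (simp add: l2)
  then have l: "0 \<le> l" "l < 1" using k power_less_imp_less_base[of l 2 1] by (auto simp: l_def)
  define \<phi> where "\<phi> = (\<lambda>s. (1 + k) * s / (1 + k * s\<^sup>2))"
  define \<phi>' where "\<phi>' = (\<lambda>s. (1 + k) * (1 - k * s\<^sup>2) / (1 + k * s\<^sup>2)\<^sup>2)"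
  have den: "0 < 1 + k * s\<^sup>2" for s :: real using k by (simp add: add_pos_nonneg)
  have 1: "1 - (\<phi> s)\<^sup>2 = (1 - s\<^sup>2) * (1 - k\<^sup>2 * s\<^sup>2) / (1 + k * s\<^sup>2)\<^sup>2" for s
  proof -
    have "1 - (\<phi> s)\<^sup>2 = ((1 + k * s\<^sup>2)\<^sup>2 - ((1 + k) * s)\<^sup>2) / (1 + k * s\<^sup>2)\<^sup>2"
      using den[of s] by (simp add: \<phi>_def power_divide diff_divide_distrib)
    also have "(1 + k * s\<^sup>2)\<^sup>2 - ((1 + k) * s)\<^sup>2 = (1 - s\<^sup>2) * (1 - k\<^sup>2 * s\<^sup>2)"
      by (simp add: power2_eq_square algebra_simps)
    finally show ?thesis .
  qed
  have 2: "1 - l\<^sup>2 * (\<phi> s)\<^sup>2 = (1 - k * s\<^sup>2)\<^sup>2 / (1 + k * s\<^sup>2)\<^sup>2" for s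
  proof -
    have "l\<^sup>2 * (\<phi> s)\<^sup>2 = 4 * k * s\<^sup>2 / (1 + k * s\<^sup>2)\<^sup>2"
      using k unfolding l2 \<phi>_def by (simp add: power_divide power_mult_distrib)
    then have "1 - l\<^sup>2 * (\<phi> s)\<^sup>2 = ((1 + k * s\<^sup>2)\<^sup>2 - 4 * k * s\<^sup>2) / (1 + k * s\<^sup>2)\<^sup>2"
      using den[of s] by (simp add: diff_divide_distrib)
    also have "(1 + k * s\<^sup>2)\<^sup>2 - 4 * k * s\<^sup>2 = (1 - k * s\<^sup>2)\<^sup>2"
      by (simp add: power2_eq_square algebra_simps)
    finally show ?thesis .
  qed
  have "((\<lambda>s. (1 + k) * ellK_integrand k s) has_integral integral {0..1} (ellK_integrand l)) {0..1}"
  proof (rule has_integral_substitution_unit_interval[where \<phi> = \<phi> and \<phi>' = \<phi>'])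
    show "ellK_integrand l integrable_on {0..1}" by (rule ellK_integrable[OF l])
    show "isCont (ellK_integrand l) x" if "0 < x" "x < 1" for x
      by (rule ellK_integrand_isCont[OF l that])
    show "continuous_on {0..1} \<phi>"
      unfolding \<phi>_def using den by (intro continuous_intros ballI less_imp_neq[symmetric])
    show "\<phi> 0 = 0" "\<phi> 1 = 1" using k by (auto simp: \<phi>_def)
    show "0 < \<phi> s \<and> \<phi> s < 1" if s: "0 < s" "s < 1" for s
    proof -
      have "0 < 1 - (\<phi> s)\<^sup>2"
        unfolding 1 using den[of s] s modulus_bound(2)[OF k, of s] square_less_1[OF s] by simp
      then have "(\<phi> s)\<^sup>2 < 1\<^sup>2" by simp
      moreover have "0 < \<phi> s" using k s den[of s] by (simp add: \<phi>_def)
      ultimately show ?thesis using power_less_imp_less_base[of "\<phi> s" 2 1] by simp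
    qed
    show "(\<phi> has_real_derivative \<phi>' s) (at s)" for s
      unfolding \<phi>_def \<phi>'_def
      by (rule derivative_eq_intros refl)+
         (use den[of s] in \<open>auto simp: power2_eq_square algebra_simps\<close>)
    show "(1 + k) * ellK_integrand k s = ellK_integrand l (\<phi> s) * \<phi>' s" if s: "0 < s" "s < 1" for s
    proof -
      have ks: "0 < 1 - k * s\<^sup>2"
        using modulus_bound(2)[of "sqrt k" s] k s by simp
      have "sqrt ((1 - (\<phi> s)\<^sup>2) * (1 - l\<^sup>2 * (\<phi> s)\<^sup>2))
          = sqrt ((1 - s\<^sup>2) * (1 - k\<^sup>2 * s\<^sup>2)) * (1 - k * s\<^sup>2) / (1 + k * s\<^sup>2)\<^sup>2"
        unfolding 1 2 using den[of s] ks by (simp add: real_sqrt_mult real_sqrt_divide power2_eq_square)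
      moreover have "(1 + k) * (1 / Q) = 1 / (Q * a / d) * ((1 + k) * a / d)" if "a \<noteq> 0" "d \<noteq> 0" for Q a d :: real
        using that by simp
      moreover have "(1 + k * s\<^sup>2)\<^sup>2 \<noteq> 0" "1 - k * s\<^sup>2 \<noteq> 0" using den[of s] ks by auto
      ultimately show ?thesis
        unfolding ellK_integrand_def \<phi>'_def by metis
    qed
  qed
  moreover have "((\<lambda>s. (1 + k) * ellK_integrand k s) has_integral (1 + k) * ellK k) {0..1}"
    by (rule has_integral_mult_right[OF ellK_has_integral[OF k]])
  ultimately show ?thesis
    using has_integral_unique unfolding ellK_eq[symmetric] l_def by blast
qed

text \<open>With an additional factor \<open>x\<close> the integrand has the elementary primitive
  \<open>A\<close>. What is lost is \<open>(1 - x)\<close> times the integrand, and since the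
  integrand is at most \<open>1 / (1 - x^2)\<close>, the loss is at most \<open>1 / (1 + x)\<close>
  pointwise.\<close>

lemma ellK_complement_bounds:
  assumes k: "0 < k" "k < 1"
  defines "c \<equiv> sqrt (1 - k\<^sup>2)"
  shows "arsinh (c / k) / c \<le> ellK c" "ellK c \<le> arsinh (c / k) / c + 1"
proof -
  have k2: "0 < 1 - k\<^sup>2" "1 - k\<^sup>2 < 1" using square_less_1[OF k] k by auto
  have c2: "c\<^sup>2 = 1 - k\<^sup>2" using k2 by (simp add: c_def)
  have c: "0 < c" "c < 1" using k2 by (auto simp: c_def)
  define f where "f = (\<lambda>x. x * ellK_integrand c x)"
  define A where "A = (\<lambda>x. - (arsinh (c / k * sqrt (1 - x\<^sup>2)) / c))"
  have "(f has_integral A 1 - A 0) {0..1}"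
  proof (rule fundamental_theorem_of_calculus_interior)
    show "continuous_on {0..1} A"
      unfolding A_def using c by (intro continuous_intros) auto
    fix x :: real assume "x \<in> {0<..<1}"
    then have x: "0 < x" "x < 1" by auto
    have x2: "0 < 1 - x\<^sup>2" using square_less_1[OF x] by simp
    have m: "0 < 1 - c\<^sup>2 * x\<^sup>2" using modulus_bound(2)[of c x] c x by simp
    have "(c / k * sqrt (1 - x\<^sup>2))\<^sup>2 + 1 = (1 - c\<^sup>2 * x\<^sup>2) / k\<^sup>2"
      using x2 k by (simp add: power_mult_distrib power_divide c2 field_simps)
    then have s: "sqrt ((c / k * sqrt (1 - x\<^sup>2))\<^sup>2 + 1) = sqrt (1 - c\<^sup>2 * x\<^sup>2) / k"
      using k by (simp add: real_sqrt_divide)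
    have D1: "((\<lambda>x. c / k * sqrt (1 - x\<^sup>2)) has_real_derivative - (c / k * x / sqrt (1 - x\<^sup>2))) (at x)"
    proof -
      have "((\<lambda>x. sqrt (1 - x\<^sup>2)) has_real_derivative inverse (sqrt (1 - x\<^sup>2)) / 2 * (- (2 * x))) (at x)"
        by (rule DERIV_chain2[OF DERIV_real_sqrt]) (use x2 in \<open>auto intro!: derivative_eq_intros\<close>)
      from DERIV_cmult[OF this, of "c / k"] show ?thesis
        by (simp add: field_simps)
    qed
    have "(A has_real_derivative - (1 / sqrt ((c / k * sqrt (1 - x\<^sup>2))\<^sup>2 + 1) * - (c / k * x / sqrt (1 - x\<^sup>2)) / c)) (at x)"
      unfolding A_def
      by (intro DERIV_minus DERIV_cdivide DERIV_chain2[OF arsinh_real_has_field_derivative D1])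
    also have "- (1 / sqrt ((c / k * sqrt (1 - x\<^sup>2))\<^sup>2 + 1) * - (c / k * x / sqrt (1 - x\<^sup>2)) / c) = f x"
      unfolding s f_def ellK_integrand_def real_sqrt_mult using c k by simp
    finally show "(A has_vector_derivative f x) (at x)"
      by (simp add: has_real_derivative_iff_has_vector_derivative)
  qed simp
  then have I: "(f has_integral arsinh (c / k) / c) {0..1}"
    by (simp add: A_def)
  have f: "f x \<le> ellK_integrand c x" "ellK_integrand c x \<le> f x + 1" if x: "x \<in> {0..1}" for x
  proof -
    have "0 \<le> ellK_integrand c x" using x c by (intro ellK_integrand_nonneg) auto
    then show "f x \<le> ellK_integrand c x"
      unfolding f_def using x mult_right_mono[of x 1 "ellK_integrand c x"] by simp
    show "ellK_integrand c x \<le> f x + 1"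
    \<comment> \<open>At \<open>x = 1\<close> the integrand is \<open>1 / 0 = 0\<close>.\<close>
    proof (cases "x = 1")
      case False
      then have x': "0 \<le> x" "x < 1" using x by auto
      have d: "0 < 1 - x\<^sup>2" using x' by (simp add: power_less_one_iff)
      have "(1 - x\<^sup>2)\<^sup>2 \<le> (1 - x\<^sup>2) * (1 - c\<^sup>2 * x\<^sup>2)"
        unfolding power2_eq_square[of "1 - x\<^sup>2"]
        using modulus_bound(4)[of c x] c x' d by (intro mult_left_mono) auto
      then have "1 - x\<^sup>2 \<le> sqrt ((1 - x\<^sup>2) * (1 - c\<^sup>2 * x\<^sup>2))"
        by (rule real_le_rsqrt)
      then have "ellK_integrand c x \<le> 1 / (1 - x\<^sup>2)"
        unfolding ellK_integrand_def by (intro frac_le) (use d in auto)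
      then have "(1 - x) * ellK_integrand c x \<le> (1 - x) * (1 / (1 - x\<^sup>2))"
        using x' by (intro mult_left_mono) auto
      also have "\<dots> = 1 / (1 + x)"
      proof -
        have "1 - x\<^sup>2 = (1 - x) * (1 + x)" by (simp add: power2_eq_square algebra_simps)
        then show ?thesis using x' by simp
      qed
      also have "\<dots> \<le> 1" using x' by simp
      finally show ?thesis by (simp add: f_def algebra_simps)
    qed (simp add: f_def ellK_integrand_def)
  qed
  have K: "(ellK_integrand c has_integral ellK c) {0..1}" using c by (intro ellK_has_integral) auto
  show "arsinh (c / k) / c \<le> ellK c"
    by (rule has_integral_le[OF I K f(1)])
  have "((\<lambda>x. f x + 1) has_integral arsinh (c / k) / c + 1) {0..1}"
    using has_integral_add[OF I has_integral_const_real[of 1 0 1]] by simp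
  then show "ellK c \<le> arsinh (c / k) / c + 1"
    by (rule has_integral_le[OF K _ f(2)])
qed

lemma ellK_complement_asymp:
  "((\<lambda>k. ellK (sqrt (1 - k\<^sup>2)) / ln (1 / k)) \<longlongrightarrow> 1) (at_right 0)"
proof (rule tendsto_sandwich)
  let ?lo = "\<lambda>k::real. arsinh (sqrt (1 - k\<^sup>2) / k) / sqrt (1 - k\<^sup>2) / ln (1 / k)"
  let ?hi = "\<lambda>k::real. (arsinh (sqrt (1 - k\<^sup>2) / k) / sqrt (1 - k\<^sup>2) + 1) / ln (1 / k)"
  have ev: "\<forall>\<^sub>F k in at_right (0::real). 0 < k \<and> k < 1"
    using eventually_at_right_real[of 0 1] by (auto elim: eventually_mono)
  show "\<forall>\<^sub>F k in at_right 0. ?lo k \<le> ellK (sqrt (1 - k\<^sup>2)) / ln (1 / k)"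
    using ev by eventually_elim (intro divide_right_mono ellK_complement_bounds(1); simp)
  show "\<forall>\<^sub>F k in at_right 0. ellK (sqrt (1 - k\<^sup>2)) / ln (1 / k) \<le> ?hi k"
    using ev by eventually_elim (intro divide_right_mono ellK_complement_bounds(2); simp)
  show "(?lo \<longlongrightarrow> 1) (at_right 0)"
    unfolding arsinh_real_def by real_asymp
  show "(?hi \<longlongrightarrow> 1) (at_right 0)"
    unfolding arsinh_real_def by real_asymp
qed

text \<open>With \<open>r = sqrt t\<close> the substitution \<open>x^2 = 2 r / (1 + r)\<close> gives
  \<open>1 - x^2 = (1 - r) / (1 + r)\<close> and \<open>1 - x^2 / 2 = 1 / (1 + r)\<close>, which
  turns the integral into \<open>Beta (1/4) (1/2)\<close>. Legendre's duplication formula removes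
  \<open>Gamma (3/4)\<close>.\<close>

lemma ellK_lemniscatic: "ellK (sqrt (1 / 2)) = Gamma (1 / 4) ^ 2 / (4 * sqrt pi)"
proof -
  define \<phi> where "\<phi> = (\<lambda>t. sqrt (2 * sqrt t / (1 + sqrt t)))"
  define \<phi>' where "\<phi>' = (\<lambda>t. 1 / (2 * \<phi> t * sqrt t * (1 + sqrt t)\<^sup>2))"
  define m where "m = sqrt (1 / 2 :: real)"
  have m: "0 \<le> m" "m < 1" "m\<^sup>2 = 1 / 2" by (auto simp: m_def)
  have "((\<lambda>t. sqrt 2 / 4 * (t powr (1 / 4 - 1) * (1 - t) powr (1 / 2 - 1))) has_integral
      integral {0..1} (ellK_integrand m)) {0..1}"
  proof (rule has_integral_substitution_unit_interval[where \<phi> = \<phi> and \<phi>' = \<phi>'])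
    show "ellK_integrand m integrable_on {0..1}" by (rule ellK_integrable[OF m(1,2)])
    show "isCont (ellK_integrand m) x" if "0 < x" "x < 1" for x
      by (rule ellK_integrand_isCont[OF m(1,2) that])
    have nz: "1 + sqrt t \<noteq> 0" if "t \<in> {0..1}" for t :: real
      using that real_sqrt_ge_zero[of t] by (simp add: add_nonneg_eq_0_iff)
    show "continuous_on {0..1} \<phi>"
      unfolding \<phi>_def by (intro continuous_intros ballI nz) auto
    show "\<phi> 0 = 0" "\<phi> 1 = 1" by (auto simp: \<phi>_def)
    fix t :: real assume t: "0 < t" "t < 1"
    define r where "r = sqrt t"
    have r: "0 < r" "r < 1" "r\<^sup>2 = t" using t by (auto simp: r_def)
    have p2: "(\<phi> t)\<^sup>2 = 2 * r / (1 + r)" using r by (simp add: \<phi>_def r_def[symmetric])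
    have p0: "0 < \<phi> t" using r by (simp add: \<phi>_def r_def[symmetric])
    have "2 * r / (1 + r) < 1" using r by (simp add: divide_less_eq)
    then have "(\<phi> t)\<^sup>2 < 1\<^sup>2" unfolding p2 by simp
    then show "0 < \<phi> t \<and> \<phi> t < 1" using p0 power_less_imp_less_base[of "\<phi> t" 2 1] by simp
    have D: "((\<lambda>t. 2 * sqrt t / (1 + sqrt t)) has_real_derivative 1 / (r * (1 + r)\<^sup>2)) (at t)"
    proof -
      have S: "(sqrt has_real_derivative 1 / (2 * r)) (at t)"
        by (rule DERIV_cong[OF DERIV_real_sqrt[OF t(1)]]) (simp add: r_def inverse_eq_divide)
      have "((\<lambda>t. 2 * sqrt t / (1 + sqrt t)) has_real_derivative
          (2 * (1 / (2 * r)) * (1 + sqrt t) - 2 * sqrt t * (0 + 1 / (2 * r))) / ((1 + sqrt t) * (1 + sqrt t))) (at t)"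
        by (intro DERIV_divide DERIV_cmult DERIV_add DERIV_const S) (use nz[of t] t in auto)
      also have "(2 * (1 / (2 * r)) * (1 + sqrt t) - 2 * sqrt t * (0 + 1 / (2 * r))) / ((1 + sqrt t) * (1 + sqrt t))
          = 1 / (r * (1 + r)\<^sup>2)"
        unfolding r_def[symmetric] using r by (simp add: field_simps power2_eq_square)
      finally show ?thesis .
    qed
    have "(\<phi> has_real_derivative (inverse (sqrt (2 * sqrt t / (1 + sqrt t))) / 2 * (1 / (r * (1 + r)\<^sup>2)))) (at t)"
      unfolding \<phi>_def by (rule DERIV_chain2[OF DERIV_real_sqrt D]) (use r in \<open>simp add: r_def[symmetric]\<close>)
    then show "(\<phi> has_real_derivative \<phi>' t) (at t)"
      unfolding \<phi>'_def by (simp add: \<phi>_def r_def[symmetric] field_simps)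
    have a: "1 - (\<phi> t)\<^sup>2 = (1 - r) / (1 + r)" "1 - m\<^sup>2 * (\<phi> t)\<^sup>2 = 1 / (1 + r)"
      unfolding p2 m using r by (auto simp: field_simps)
    have e: "ellK_integrand m (\<phi> t) = (1 + r) / sqrt (1 - r)"
      unfolding ellK_integrand_def a using r by (simp add: real_sqrt_divide real_sqrt_mult)
    have pt: "\<phi> t = sqrt 2 * sqrt r / sqrt (1 + r)"
      by (simp add: \<phi>_def r_def[symmetric] real_sqrt_divide real_sqrt_mult)
    have "ellK_integrand m (\<phi> t) * \<phi>' t = 1 / (2 * \<phi> t * r * (1 + r) * sqrt (1 - r))"
      unfolding e \<phi>'_def r_def[symmetric] using r by (simp add: power2_eq_square)
    also have "1 / (2 * \<phi> t * r * (1 + r) * sqrt (1 - r))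
        = sqrt 2 / 4 * (1 / (r * sqrt r) * (1 / (sqrt (1 - r) * sqrt (1 + r))))"
    proof -
      have "1 / (2 * (e * w / u) * r * (u * u) * v) = e / (2 * (e * e)) * (1 / (r * w) * (1 / (v * u)))"
        if "e \<noteq> 0" "w \<noteq> 0" "u \<noteq> 0" "v \<noteq> 0" for e w u v :: real
        using that r by (simp add: field_simps)
      from this[of "sqrt 2" "sqrt r" "sqrt (1 + r)" "sqrt (1 - r)"] r show ?thesis by (simp add: pt)
    qed
    also have "1 / (sqrt (1 - r) * sqrt (1 + r)) = (1 - t) powr (1 / 2 - 1)"
    proof -
      have "sqrt (1 - r) * sqrt (1 + r) = sqrt (1 - t)"
        unfolding r(3)[symmetric] real_sqrt_mult[symmetric] by (simp add: algebra_simps power2_eq_square)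
      also have "\<dots> = (1 - t) powr (1 / 2)" using t by (simp add: powr_half_sqrt)
      finally show ?thesis by (simp add: powr_minus_divide[symmetric])
    qed
    also have "1 / (r * sqrt r) = t powr (1 / 4 - 1)"
    proof -
      have "r = t powr (1 / 2)" using t by (simp add: r_def powr_half_sqrt)
      moreover have "sqrt r = t powr (1 / 4)"
        using t by (simp add: r_def powr_half_sqrt[symmetric] powr_powr)
      ultimately have "r * sqrt r = t powr (3 / 4)"
        by (simp add: powr_add[symmetric])
      then show ?thesis by (simp add: powr_minus_divide[symmetric])
    qed
    finally show "sqrt 2 / 4 * (t powr (1 / 4 - 1) * (1 - t) powr (1 / 2 - 1)) = ellK_integrand m (\<phi> t) * \<phi>' t" ..
  qed
  moreover have "((\<lambda>t. sqrt 2 / 4 * (t powr (1 / 4 - 1) * (1 - t) powr (1 / 2 - 1))) has_integral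
      sqrt 2 / 4 * Beta (1 / 4) (1 / 2)) {0..1}"
    by (intro has_integral_mult_right has_integral_Beta_real) auto
  ultimately have "ellK m = sqrt 2 / 4 * Beta (1 / 4) (1 / 2)"
    using has_integral_unique unfolding ellK_eq by blast
  also have "Beta (1 / 4) (1 / 2) = Gamma (1 / 4 :: real) * sqrt pi / Gamma (3 / 4)"
    by (simp add: Beta_def Gamma_one_half_real)
  also have "Gamma (3 / 4 :: real) = sqrt 2 * pi / Gamma (1 / 4)"
  proof -
    have "0 < Gamma (1 / 4 :: real)" by (rule Gamma_real_pos) simp
    then have n: "Gamma (1 / 4 :: real) \<noteq> 0" by (metis less_irrefl)
    have "(1 / 4 :: complex) \<notin> \<int>\<^sub>\<le>\<^sub>0" "(1 / 4 + 1 / 2 :: complex) \<notin> \<int>\<^sub>\<le>\<^sub>0"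
      using of_real_in_nonpos_Ints_iff[of "1 / 4", where 'a = complex]
        of_real_in_nonpos_Ints_iff[of "3 / 4", where 'a = complex]
        nonpos_Ints_nonpos[of "1 / 4 :: real"] nonpos_Ints_nonpos[of "3 / 4 :: real"]
      by auto
    from Gamma_legendre_duplication[OF this]
    have "of_real (Gamma (1 / 4)) * of_real (Gamma (3 / 4))
        = (of_real (exp (1 / 2 * ln 2) * sqrt pi * Gamma (1 / 2)) :: complex)"
      by (simp flip: Gamma_complex_of_real exp_of_real)
    then have "Gamma (1 / 4) * Gamma (3 / 4) = exp (1 / 2 * ln 2) * sqrt pi * Gamma (1 / 2 :: real)"
      unfolding of_real_mult[symmetric] of_real_eq_iff .
    also have "exp (1 / 2 * ln 2) = sqrt (2 :: real)"
      by (simp add: powr_half_sqrt[symmetric] powr_def)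
    also have "sqrt 2 * sqrt pi * Gamma (1 / 2) = sqrt 2 * pi"
      by (simp add: Gamma_one_half_real)
    finally show ?thesis using n by (simp add: field_simps)
  qed
  finally have "ellK m = Gamma (1 / 4) ^ 2 * (sqrt pi / (4 * pi))"
    by (simp add: power2_eq_square field_simps)
  also have "sqrt pi / (4 * pi) = 1 / (4 * sqrt pi)"
    by (simp add: field_simps)
  finally show ?thesis by (simp add: m_def)
qed

section \<open>Elliptic integrals in terms of theta constants\<close>

definition modulus :: "real \<Rightarrow> real" where
  "modulus q = sqrt (lam q)"

lemma modulus_bounds: "0 < q \<Longrightarrow> q < 1 \<Longrightarrow> 0 < modulus q \<and> modulus q < 1"
  using lam_bounds[of q] by (simp add: modulus_def)

lemma modulus_square: "0 < q \<Longrightarrow> q < 1 \<Longrightarrow> (modulus q)\<^sup>2 = lam q"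
  using lam_bounds[of q] by (simp add: modulus_def)

lemma comodulus_eq:
  assumes "0 < q" "q < 1"
  shows "sqrt (1 - (modulus q)\<^sup>2) = (theta 0 (-q))\<^sup>2 / (theta 0 q)\<^sup>2"
proof -
  have "1 - (modulus q)\<^sup>2 = ((theta 0 (-q))\<^sup>2 / (theta 0 q)\<^sup>2)\<^sup>2"
    unfolding modulus_square[OF assms] lam_def by (simp add: power_divide power_mult[symmetric])
  then show ?thesis by simp
qed

lemma theta_square_duplication:
  assumes "0 < q" "q < 1"
  shows "(theta 0 (q\<^sup>2))\<^sup>2 = ((theta 0 q)\<^sup>2 + (theta 0 (-q))\<^sup>2) / 2"
    and "(theta 0 (-(q\<^sup>2)))\<^sup>2 = theta 0 q * theta 0 (-q)"
  using theta_duplication_sum[of q] theta_duplication_prod[of q] assms by auto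

text \<open>Squaring the nome subjects the squared theta constants to one step of the
  arithmetic-geometric mean. On their ratio \<open>c\<close>, the complementary modulus, this is the
  map \<open>2 * sqrt c / (1 + c)\<close> of \<open>ellK_Landen\<close>.\<close>

lemma ellK_comodulus_square:
  assumes q: "0 < q" "q < 1"
  shows "ellK (sqrt (1 - (modulus (q\<^sup>2))\<^sup>2)) / (theta 0 (q\<^sup>2))\<^sup>2 = 2 * (ellK (sqrt (1 - (modulus q)\<^sup>2)) / (theta 0 q)\<^sup>2)"
proof -
  define x y where "x = theta 0 q" and "y = theta 0 (-q)"
  have pos: "0 < y" "y < x" using theta_minus_pos[OF q] theta_minus_less[OF q] by (auto simp: x_def y_def)
  define c where "c = y\<^sup>2 / x\<^sup>2"
  have c: "0 \<le> c" "c < 1" using pos by (auto simp: c_def power_strict_mono)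
  have "sqrt (1 - (modulus (q\<^sup>2))\<^sup>2) = (x * y) / ((x\<^sup>2 + y\<^sup>2) / 2)"
    using comodulus_eq[of "q\<^sup>2"] square_bounds[OF q] theta_square_duplication[OF q] by (simp add: x_def y_def)
  also have "\<dots> = 2 * sqrt c / (1 + c)"
  proof -
    have "sqrt c = y / x" using pos by (simp add: c_def real_sqrt_divide)
    moreover have "1 + c = (x\<^sup>2 + y\<^sup>2) / x\<^sup>2" using pos by (simp add: c_def add_divide_distrib)
    ultimately show ?thesis using pos by (simp add: power2_eq_square)
  qed
  finally have 1: "ellK (sqrt (1 - (modulus (q\<^sup>2))\<^sup>2)) = (1 + c) * ellK c"
    using ellK_Landen[OF c] by simp
  have 2: "sqrt (1 - (modulus q)\<^sup>2) = c"
    using comodulus_eq[OF q] by (simp add: c_def x_def y_def)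
  have 3: "(theta 0 (q\<^sup>2))\<^sup>2 = (1 + c) * x\<^sup>2 / 2"
  proof -
    have "(1 + c) * x\<^sup>2 = x\<^sup>2 + y\<^sup>2" using pos by (simp add: c_def distrib_right)
    then show ?thesis using theta_square_duplication(1)[OF q] by (simp add: x_def y_def)
  qed
  have "1 + c \<noteq> 0" using c by simp
  then show ?thesis unfolding 1 2 3 x_def[symmetric] by simp
qed

text \<open>The same transformation in the opposite direction: here the modulus of \<open>q\<close>
  is the Landen transform of the modulus of \<open>q^2\<close>.\<close>

lemma ellK_modulus_square:
  assumes q: "0 < q" "q < 1"
  shows "ellK (modulus (q\<^sup>2)) / (theta 0 (q\<^sup>2))\<^sup>2 = ellK (modulus q) / (theta 0 q)\<^sup>2"
proof -
  define a b where "a = (theta 0 q)\<^sup>2" and "b = (theta 0 (-q))\<^sup>2"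
  have pos: "0 < b" "b < a"
    unfolding a_def b_def using theta_minus_pos[OF q] theta_minus_less[OF q] by (auto intro: power_strict_mono)
  define k where "k = modulus (q\<^sup>2)"
  have k: "0 \<le> k" "k < 1" using modulus_bounds[of "q\<^sup>2"] square_bounds[OF q] by (auto simp: k_def)
  have z: "(theta 0 (q\<^sup>2))\<^sup>2 = (a + b) / 2"
    using theta_square_duplication(1)[OF q] by (simp add: a_def b_def)
  have "k = (a - b) / (a + b)"
  proof -
    have "((theta 0 (-(q\<^sup>2)))\<^sup>2)\<^sup>2 = a * b"
      unfolding theta_square_duplication(2)[OF q] a_def b_def by (simp add: power_mult_distrib)
    then have "lam (q\<^sup>2) = 1 - a * b / ((a + b) / 2)\<^sup>2"
      using z by (simp add: lam_def power_divide power_mult[symmetric] flip: z)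
    also have "\<dots> = ((a - b) / (a + b))\<^sup>2"
    proof -
      have "(((a + b) / 2)\<^sup>2 - a * b) / ((a + b) / 2)\<^sup>2 = ((a - b) / 2)\<^sup>2 / ((a + b) / 2)\<^sup>2"
        by (simp add: power2_eq_square field_simps)
      also have "\<dots> = ((a - b) / (a + b))\<^sup>2" by (simp add: power_divide)
      finally show ?thesis using pos by (simp add: diff_divide_distrib)
    qed
    finally show ?thesis using pos by (simp add: k_def modulus_def)
  qed
  then have k1: "1 + k = 2 * a / (a + b)"
    using pos by (simp add: field_simps)
  have "modulus q = 2 * sqrt k / (1 + k)"
  proof (rule power2_eq_imp_eq)
    have "(2 * sqrt k / (1 + k))\<^sup>2 = 4 * k / (1 + k)\<^sup>2" using k by (simp add: power_divide power_mult_distrib)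
    also have "\<dots> = (a\<^sup>2 - b\<^sup>2) / a\<^sup>2"
    proof -
      have "4 * ((a - b) / s) / (2 * a / s)\<^sup>2 = (a - b) * s / a\<^sup>2" if "s \<noteq> 0" for s
        using pos that by (simp add: field_simps power2_eq_square)
      from this[of "a + b"] show ?thesis
        unfolding k1 unfolding \<open>k = (a - b) / (a + b)\<close> using pos by (simp add: power2_eq_square algebra_simps)
    qed
    also have "\<dots> = lam q"
      using pos theta_pos[OF q] by (simp add: lam_def a_def b_def power_divide power_mult[symmetric] diff_divide_distrib)
    finally show "(modulus q)\<^sup>2 = (2 * sqrt k / (1 + k))\<^sup>2"
      using modulus_square[OF q] by simp
  qed (use k modulus_bounds[OF q] in auto)
  then have "ellK (modulus q) = 2 * a / (a + b) * ellK k"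
    using ellK_Landen[OF k] k1 by simp
  then show ?thesis
    unfolding k_def[symmetric] z a_def[symmetric] using pos by (simp add: field_simps)
qed

lemma lam_quotient_tendsto: "((\<lambda>q. lam q / q) \<longlongrightarrow> 16) (at_right 0)"
proof -
  have "((\<lambda>q. thetaX q / q / theta 0 q ^ 4) \<longlongrightarrow> 16 / 1 ^ 4) (at_right 0)"
    using thetaX_quotient_tendsto theta_tendsto_0[of 0]
    by (intro tendsto_intros) (auto intro: filterlim_mono[OF _ order_refl at_le])
  moreover have "\<forall>\<^sub>F q in at_right 0. thetaX q / q / theta 0 q ^ 4 = lam q / q"
    using eventually_at_right_real[OF zero_less_one]
  proof eventually_elim
    case (elim q)
    then show ?case using thetaX_lam[of q] theta_pos[of q] by simp
  qed
  ultimately have "((\<lambda>q. lam q / q) \<longlongrightarrow> 16 / 1 ^ 4) (at_right 0)"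
    by (rule Lim_transform_eventually)
  then show ?thesis by simp
qed

lemma modulus_tendsto_0: "(modulus \<longlongrightarrow> 0) (at_right 0)"
proof -
  have "((\<lambda>q::real. q) \<longlongrightarrow> 0) (at_right 0)" by (rule tendsto_ident_at)
  from tendsto_mult[OF lam_quotient_tendsto this]
  have "((\<lambda>q. lam q / q * q) \<longlongrightarrow> 0) (at_right 0)" by simp
  moreover have "\<forall>\<^sub>F q in at_right 0. lam q / q * q = lam q"
    using eventually_at_right_less[of 0] by eventually_elim simp
  ultimately have "(lam \<longlongrightarrow> 0) (at_right 0)" by (rule Lim_transform_eventually)
  then show ?thesis
    unfolding modulus_def using tendsto_real_sqrt by fastforce
qed

lemma filterlim_power_power_2_at_right_0:
  assumes "0 < q" "q < (1::real)"
  shows "filterlim (\<lambda>n. q ^ (2 ^ n)) (at_right 0) sequentially"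
  using power_power_2_tendsto_0[of q] assms
  by (intro filterlim_at_withinI) auto

text \<open>Both \<open>y q\<close> and \<open>ln (1 / q)\<close> double when \<open>q\<close> is
  squared, so their quotient equals its limit at 0. The limit is 1/2: since \<open>lam q\<close>
  behaves like \<open>16 q\<close> and the modulus is its square root,
  \<open>ln (1 / modulus q)\<close> is asymptotically half of \<open>ln (1 / q)\<close>, and the
  complementary integral is asymptotic to the former.\<close>

lemma ellK_comodulus:
  assumes q: "0 < q" "q < 1"
  shows "ellK (sqrt (1 - (modulus q)\<^sup>2)) = (theta 0 q)\<^sup>2 * ln (1 / q) / 2"
proof -
  define y where "y = (\<lambda>q. ellK (sqrt (1 - (modulus q)\<^sup>2)) / (theta 0 q)\<^sup>2)"
  have iter: "y (q ^ (2 ^ n)) = 2 ^ n * y q" for n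
  proof (induction n)
    case (Suc n)
    then show ?case
      using ellK_comodulus_square[of "q ^ (2 ^ n)"] power_power_2_bounds[OF q, of n]
      by (simp add: y_def power_power_2_Suc del: power_Suc) simp
  qed simp
  have ev: "\<forall>\<^sub>F q in at_right (0::real). 0 < q \<and> q < 1"
    using eventually_at_right_real[OF zero_less_one] by (rule eventually_mono) simp
  have m: "filterlim modulus (at_right 0) (at_right 0)"
    using modulus_tendsto_0
    by (intro filterlim_at_withinI) (auto intro: eventually_mono[OF ev] simp: modulus_bounds less_imp_neq[symmetric])
  have 1: "((\<lambda>q. ellK (sqrt (1 - (modulus q)\<^sup>2)) / ln (1 / modulus q)) \<longlongrightarrow> 1) (at_right 0)"
    by (rule filterlim_compose[OF ellK_complement_asymp m])
  have ln0: "filterlim (\<lambda>q::real. ln (1 / q)) at_top (at_right 0)" by real_asymp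
  have "((\<lambda>q. ln (lam q / q) / ln (1 / q)) \<longlongrightarrow> 0) (at_right 0)"
    by (rule real_tendsto_divide_at_top[OF tendsto_ln[OF lam_quotient_tendsto] ln0]) simp
  then have "((\<lambda>q. (1 - ln (lam q / q) / ln (1 / q)) / 2) \<longlongrightarrow> (1 - 0) / 2) (at_right 0)"
    by (intro tendsto_intros) auto
  moreover have "\<forall>\<^sub>F q in at_right 0. (1 - ln (lam q / q) / ln (1 / q)) / 2 = ln (1 / modulus q) / ln (1 / q)"
    using ev
  proof eventually_elim
    case (elim q)
    have l: "0 < lam q" using lam_bounds elim by blast
    have "ln q < 0" using elim by simp
    then show ?case
      using elim l by (simp add: modulus_def ln_div ln_sqrt field_simps)
  qed
  ultimately have "((\<lambda>q. ln (1 / modulus q) / ln (1 / q)) \<longlongrightarrow> (1 - 0) / 2) (at_right 0)"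
    by (rule Lim_transform_eventually)
  then have 2: "((\<lambda>q. ln (1 / modulus q) / ln (1 / q)) \<longlongrightarrow> 1 / 2) (at_right 0)"
    by simp
  have 3: "((\<lambda>q. (theta 0 q)\<^sup>2) \<longlongrightarrow> 1) (at_right 0)"
    using tendsto_power[OF theta_tendsto_0[of 0], of 2]
    by (auto intro: filterlim_mono[OF _ order_refl at_le])
  have "((\<lambda>q. ellK (sqrt (1 - (modulus q)\<^sup>2)) / ln (1 / modulus q) * (ln (1 / modulus q) / ln (1 / q)) / (theta 0 q)\<^sup>2)
      \<longlongrightarrow> 1 * (1 / 2) / 1) (at_right 0)"
    by (intro tendsto_divide tendsto_mult 1 2 3) simp
  moreover have "\<forall>\<^sub>F q in at_right 0. ellK (sqrt (1 - (modulus q)\<^sup>2)) / ln (1 / modulus q) * (ln (1 / modulus q) / ln (1 / q)) / (theta 0 q)\<^sup>2 = y q / ln (1 / q)"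
    using ev
  proof eventually_elim
    case (elim q)
    have "ln (modulus q) \<noteq> 0"
      using modulus_bounds[of q] elim by (simp add: less_imp_neq)
    then show ?case
      using modulus_bounds[of q] elim by (simp add: y_def ln_div)
  qed
  ultimately have "((\<lambda>q. y q / ln (1 / q)) \<longlongrightarrow> 1 * (1 / 2) / 1) (at_right 0)"
    by (rule Lim_transform_eventually)
  then have "(\<lambda>n. y (q ^ (2 ^ n)) / ln (1 / q ^ (2 ^ n))) \<longlonglongrightarrow> 1 * (1 / 2) / 1"
    by (rule filterlim_compose[OF _ filterlim_power_power_2_at_right_0[OF q]])
  moreover have "y (q ^ (2 ^ n)) / ln (1 / q ^ (2 ^ n)) = y q / ln (1 / q)" for n
    unfolding iter using q by (simp add: ln_div ln_realpow)
  ultimately have "y q / ln (1 / q) = 1 / 2"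
    by (simp add: LIMSEQ_const_iff)
  moreover have "ln (1 / q) > 0" using q by (simp add: ln_div)
  ultimately show ?thesis
    using theta_pos[OF q] by (simp add: y_def field_simps)
qed

lemma ellK_modulus:
  assumes q: "0 < q" "q < 1"
  shows "ellK (modulus q) = pi / 2 * (theta 0 q)\<^sup>2"
proof -
  define y where "y = (\<lambda>q. ellK (modulus q) / (theta 0 q)\<^sup>2)"
  have iter: "y (q ^ (2 ^ n)) = y q" for n
  proof (induction n)
    case (Suc n)
    then show ?case
      using ellK_modulus_square[of "q ^ (2 ^ n)"] power_power_2_bounds[OF q, of n]
      by (simp add: y_def power_power_2_Suc del: power_Suc)
  qed simp
  have ev: "\<forall>\<^sub>F q in at_right (0::real). 0 < q \<and> q < 1"
    using eventually_at_right_real[OF zero_less_one] by (rule eventually_mono) simp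
  have "((\<lambda>q. ellK (modulus q)) \<longlongrightarrow> pi / 2) (at_right 0)"
  proof (rule tendsto_sandwich)
    show "\<forall>\<^sub>F q in at_right 0. pi / 2 \<le> ellK (modulus q)"
      using ev by eventually_elim (use modulus_bounds ellK_lower in \<open>auto simp: less_imp_le\<close>)
    show "\<forall>\<^sub>F q in at_right 0. ellK (modulus q) \<le> 1 / sqrt (1 - (modulus q)\<^sup>2) * (pi / 2)"
      using ev by eventually_elim (use modulus_bounds in \<open>intro ellK_upper, auto simp: less_imp_le\<close>)
    have "((\<lambda>q. 1 / sqrt (1 - (modulus q)\<^sup>2) * (pi / 2)) \<longlongrightarrow> 1 / sqrt (1 - 0\<^sup>2) * (pi / 2)) (at_right 0)"
      by (intro tendsto_intros modulus_tendsto_0) simp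
    then show "((\<lambda>q. 1 / sqrt (1 - (modulus q)\<^sup>2) * (pi / 2)) \<longlongrightarrow> pi / 2) (at_right 0)" by simp
  qed simp
  moreover have "((\<lambda>q. (theta 0 q)\<^sup>2) \<longlongrightarrow> 1) (at_right 0)"
    using tendsto_power[OF theta_tendsto_0[of 0], of 2]
    by (auto intro: filterlim_mono[OF _ order_refl at_le])
  ultimately have "(y \<longlongrightarrow> pi / 2 / 1) (at_right 0)"
    unfolding y_def by (intro tendsto_divide) auto
  then have "(\<lambda>n. y (q ^ (2 ^ n))) \<longlonglongrightarrow> pi / 2 / 1"
    by (rule filterlim_compose[OF _ filterlim_power_power_2_at_right_0[OF q]])
  then have "y q = pi / 2" unfolding iter by (simp add: LIMSEQ_const_iff)
  then show ?thesis using theta_pos[OF q] by (simp add: y_def field_simps)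
qed

section \<open>The nome as inverse of the modulus\<close>

lemma ellK'_modulus:
  "0 < q \<Longrightarrow> q < 1 \<Longrightarrow> ellK' (modulus q) = (theta 0 q)\<^sup>2 * ln (1 / q) / 2"
  unfolding ellK'_def by (rule ellK_comodulus)

lemma ellK'_pos:
  assumes "0 < k" "k < 1"
  shows "0 < ellK' k"
  unfolding ellK'_def by (rule ellK_pos) (use square_less_1[OF assms] assms in auto)

lemma ellK'_strict_antimono:
  assumes "0 < k" "k < l" "l < 1"
  shows "ellK' l < ellK' k"
  unfolding ellK'_def
proof (rule ellK_strict_mono)
  have "k\<^sup>2 < l\<^sup>2" "0 < k\<^sup>2" "l\<^sup>2 < 1"
    using assms by (auto simp: power_strict_mono power_less_one_iff)
  then show "0 \<le> sqrt (1 - l\<^sup>2)" "sqrt (1 - l\<^sup>2) < sqrt (1 - k\<^sup>2)" "sqrt (1 - k\<^sup>2) < 1"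
    by auto
qed

lemma nome_modulus:
  assumes q: "0 < q" "q < 1"
  shows "exp (- (pi * ellK' (modulus q) / ellK (modulus q))) = q"
proof -
  have "pi * ellK' (modulus q) / ellK (modulus q) = - ln q"
    unfolding ellK'_modulus[OF q] ellK_modulus[OF q] using theta_pos[OF q] q by (simp add: ln_div)
  then show ?thesis using q by simp
qed

text \<open>The modulus \<open>l\<close> belonging to \<open>q\<close> has, by
  \<open>nome_modulus\<close>, the same quotient \<open>ellK' / ellK\<close> as \<open>k\<close>.
  That quotient is strictly decreasing, so \<open>l = k\<close>: injectivity of the quotient yields
  surjectivity of \<open>modulus\<close>.\<close>

lemma modulus_nome:
  assumes k: "0 < k" "k < 1"
  defines "q \<equiv> exp (- (pi * ellK' k / ellK k))"
  shows "0 < q" "q < 1" "modulus q = k"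
proof -
  have pos: "0 < ellK k" "0 < ellK' k" using ellK_pos[of k] ellK'_pos[OF k] k by auto
  show q: "0 < q" "q < 1" unfolding q_def using pos by auto
  define l where "l = modulus q"
  have l: "0 < l" "l < 1" using modulus_bounds[OF q] by (auto simp: l_def)
  have posl: "0 < ellK l" "0 < ellK' l" using ellK_pos[of l] ellK'_pos[OF l] l by auto
  have "ellK' l / ellK l = ellK' k / ellK k"
  proof -
    have "exp (- (pi * ellK' l / ellK l)) = exp (- (pi * ellK' k / ellK k))"
      using nome_modulus[OF q] unfolding l_def[symmetric] by (simp only: q_def)
    then have "pi * (ellK' l / ellK l) = pi * (ellK' k / ellK k)" by simp
    then show ?thesis by (simp only: mult_cancel_left pi_neq_zero simp_thms)
  qed
  then have eq: "ellK' l * ellK k = ellK' k * ellK l"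
    using pos posl by (simp add: field_simps)
  have less: "ellK' b * ellK a < ellK' a * ellK b" if "0 < a" "a < b" "b < 1" for a b
  proof -
    have "ellK' b * ellK a < ellK' a * ellK a"
      using ellK'_strict_antimono[OF that] ellK_pos[of a] that by simp
    also have "\<dots> < ellK' a * ellK b"
      using ellK_strict_mono[of a b] ellK'_pos[of a] that by simp
    finally show ?thesis .
  qed
  have "\<not> l < k" using less[of l k] l k eq by (auto simp: mult.commute)
  moreover have "\<not> k < l" using less[of k l] l k eq by (auto simp: mult.commute)
  ultimately show "modulus q = k" by (simp add: l_def)
qed

lemma bij_betw_modulus: "bij_betw modulus {0<..<1} {0<..<1}"
  by (rule bij_betwI[where g = "\<lambda>k. exp (- (pi * ellK' k / ellK k))"])
     (use modulus_bounds nome_modulus modulus_nome in auto)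

lemma modulus_has_derivative:
  assumes q: "0 < q" "q < 1"
  shows "(modulus has_real_derivative modulus q * (1 - (modulus q)\<^sup>2) * theta 0 q ^ 4 / (2 * q)) (at q)"
proof -
  have l: "0 < lam q" using lam_bounds[OF q] by simp
  have "(modulus has_real_derivative inverse (sqrt (lam q)) / 2 * (lam q * (1 - lam q) * theta 0 q ^ 4 / q)) (at q)"
    unfolding modulus_def[abs_def] by (rule DERIV_chain2[OF DERIV_real_sqrt[OF l] lam_has_derivative[OF q]])
  also have "inverse (sqrt (lam q)) / 2 * (lam q * (1 - lam q) * theta 0 q ^ 4 / q)
      = modulus q * (1 - (modulus q)\<^sup>2) * theta 0 q ^ 4 / (2 * q)"
  proof -
    have "inverse (sqrt (lam q)) * lam q = modulus q"
      using l by (simp add: modulus_def real_div_sqrt flip: divide_inverse_commute)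
    moreover have "inverse (sqrt (lam q)) / 2 * (lam q * (1 - lam q) * theta 0 q ^ 4 / q)
        = (inverse (sqrt (lam q)) * lam q) * (1 - lam q) * theta 0 q ^ 4 / (2 * q)" by simp
    ultimately show ?thesis
      unfolding modulus_square[OF q] by simp
  qed
  finally show ?thesis .
qed

text \<open>The modulus \<open>sqrt (1 / 2)\<close> is its own complement, so both integrals agree
  and the nome is \<open>exp (- pi)\<close>.\<close>

lemma modulus_lemniscatic: "modulus (exp (- pi)) = sqrt (1 / 2)" and lam_lemniscatic: "lam (exp (- pi)) = 1 / 2"
proof -
  have "sqrt (1 - 1 / 2) = sqrt (1 / 2 :: real)" by simp
  then have "ellK' (sqrt (1 / 2)) = ellK (sqrt (1 / 2))" by (simp add: ellK'_def)
  then show *: "modulus (exp (- pi)) = sqrt (1 / 2)"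
    using modulus_nome(3)[of "sqrt (1 / 2)"] ellK_pos[of "sqrt (1 / 2)"] by simp
  have "lam (exp (-pi)) = (modulus (exp (-pi)))\<^sup>2" by (rule modulus_square[symmetric]) auto
  then show "lam (exp (- pi)) = 1 / 2" unfolding * by simp
qed

lemma theta_lemniscatic: "pi ^ (4 * p) * theta 0 (exp (- pi)) ^ (8 * p) * 16 ^ p = Gamma (1 / 4) ^ (8 * p) / pi ^ (2 * p)"
proof -
  define x where "x = theta 0 (exp (- pi))"
  have "pi / 2 * x\<^sup>2 = Gamma (1 / 4) ^ 2 / (4 * sqrt pi)"
    using ellK_modulus[of "exp (- pi)"] ellK_lemniscatic unfolding modulus_lemniscatic x_def by simp
  then have "2 * pi * x\<^sup>2 = Gamma (1 / 4) ^ 2 / sqrt pi" by (simp add: field_simps)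
  then have "(2 * pi * x\<^sup>2) ^ (4 * p) = (Gamma (1 / 4) ^ 2 / sqrt pi) ^ (4 * p)" by simp
  moreover have "(2 * pi * x\<^sup>2) ^ (4 * p) = pi ^ (4 * p) * x ^ (8 * p) * 16 ^ p"
    by (simp add: power_mult_distrib power_mult[symmetric]) (simp add: power_mult)
  moreover have "sqrt pi ^ (4 * p) = pi ^ (2 * p)"
  proof -
    have "sqrt pi ^ (4 * p) = ((sqrt pi)\<^sup>2) ^ (2 * p)" unfolding power_mult[symmetric] by simp
    then show ?thesis by simp
  qed
  ultimately show ?thesis by (simp add: x_def power_divide power_mult[symmetric])
qed

section \<open>Sums over the Gaussian integers\<close>

definition gauss :: "int \<times> int \<Rightarrow> complex" where
  "gauss w = Complex (of_int (fst w)) (of_int (snd w))"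

lemma gauss_eq_0_iff: "gauss w = 0 \<longleftrightarrow> w = (0, 0)"
  by (cases w) (auto simp: gauss_def complex_eq_iff)

lemma norm_gauss_square: "(cmod (gauss (m, n)))\<^sup>2 = of_int (m\<^sup>2 + n\<^sup>2)"
  by (simp add: gauss_def cmod_power2)

lemma norm_gauss_ge_1:
  assumes "gauss w \<noteq> 0"
  shows "1 \<le> cmod (gauss w)"
proof -
  obtain m n where w: "w = (m, n)" by (cases w)
  have "m \<noteq> 0 \<or> n \<noteq> 0" using assms unfolding gauss_eq_0_iff w by auto
  then have "m\<^sup>2 + n\<^sup>2 \<ge> 1"
    by (smt (verit) sum_power2_gt_zero_iff)
  then have "1 \<le> real_of_int (m\<^sup>2 + n\<^sup>2)"
    by (simp only: of_int_1_le_iff)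
  then have "1\<^sup>2 \<le> (cmod (gauss w))\<^sup>2"
    unfolding w norm_gauss_square by simp
  then show ?thesis by (rule power2_le_imp_le) simp
qed

lemma summable_on_intI:
  fixes f :: "int \<Rightarrow> real"
  assumes "(\<lambda>n. f (int n)) summable_on UNIV" "(\<lambda>n. f (- int n)) summable_on UNIV"
  shows "f summable_on UNIV"
proof -
  have 1: "f summable_on range int"
    by (subst summable_on_reindex) (use assms(1) in \<open>auto simp: o_def\<close>)
  have 2: "f summable_on range (\<lambda>n. - int n)"
    by (subst summable_on_reindex) (use assms(2) in \<open>auto simp: o_def inj_on_def\<close>)
  have "(UNIV :: int set) = range int \<union> (range (\<lambda>n. - int n) - range int)"
  proof -
    have "m \<in> range int \<or> m \<in> range (\<lambda>n. - int n)" for m :: int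
    proof (cases "m \<ge> 0")
      case True
      then have "m = int (nat m)" by simp
      then show ?thesis by blast
    next
      case False
      then have "m = - int (nat (- m))" by simp
      then show ?thesis by blast
    qed
    then show ?thesis by blast
  qed
  moreover have "f summable_on (range int \<union> (range (\<lambda>n. - int n) - range int))"
    by (intro summable_on_Un_disjoint 1 summable_on_subset_banach[OF 2]) auto
  ultimately show ?thesis by simp
qed

lemma summable_on_inverse_square_int: "(\<lambda>m::int. 1 / (1 + (real_of_int m)\<^sup>2)) summable_on UNIV"
proof -
  have "summable (\<lambda>n::nat. 1 / (1 + (real n)\<^sup>2))"
  proof (rule summable_comparison_test_ev)
    show "summable (\<lambda>n::nat. 1 / (real n)\<^sup>2)"
      using inverse_power_summable[of 2, where 'a = real] by (simp add: inverse_eq_divide)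
    show "\<forall>\<^sub>F n in sequentially. norm (1 / (1 + (real n)\<^sup>2)) \<le> 1 / (real n)\<^sup>2"
      using eventually_gt_at_top[of 0] by eventually_elim (auto intro!: frac_le)
  qed
  then have "(\<lambda>n::nat. 1 / (1 + (real n)\<^sup>2)) summable_on UNIV"
    by (subst summable_on_UNIV_nonneg_real_iff) auto
  then show ?thesis by (intro summable_on_intI) auto
qed

text \<open>Comparison with a product of two one-dimensional sums:
  \<open>(1 + m^2) (1 + n^2)\<close> is at most \<open>(1 + m^2 + n^2)^2\<close>, hence at most
  \<open>4 |w|^4\<close>, because \<open>|w|\<close> is at least 1 away from the origin.\<close>

lemma summable_gauss_power:
  assumes "4 \<le> k"
  shows "(\<lambda>w. norm (1 / gauss w ^ k)) summable_on UNIV"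
proof (rule Infinite_Sum.abs_summable_on_comparison_test')
  let ?h = "\<lambda>m::int. 1 / (1 + (real_of_int m)\<^sup>2)"
  have "(\<lambda>(m, n). ?h m * ?h n) summable_on UNIV \<times> UNIV"
    using has_sum_prod_real[OF has_sum_infsum has_sum_infsum] summable_on_inverse_square_int
      has_sum_imp_summable by blast
  from summable_on_cmult_right[OF this, of 4]
  show "(\<lambda>(m, n). 4 * (?h m * ?h n)) summable_on UNIV"
    by (simp add: case_prod_unfold)
  fix w :: "int \<times> int"
  obtain m n where w: "w = (m, n)" by (cases w)
  show "norm (1 / gauss w ^ k) \<le> (case w of (m, n) \<Rightarrow> 4 * (?h m * ?h n))"
  proof (cases "gauss w = 0")
    case True
    then show ?thesis using assms by (simp add: power_0_left w)
  next
    case False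
    define r where "r = cmod (gauss w)"
    have r: "1 \<le> r" using norm_gauss_ge_1[OF False] by (simp add: r_def)
    define x y where "x = (real_of_int m)\<^sup>2" and "y = (real_of_int n)\<^sup>2"
    have xy: "0 \<le> x" "0 \<le> y" "r\<^sup>2 = x + y"
      using norm_gauss_square[of m n] by (auto simp: x_def y_def r_def w)
    have "1 \<le> r\<^sup>2" using r by simp
    have "(1 + x) * (1 + y) \<le> (1 + (x + y))\<^sup>2"
      using xy by (simp add: power2_eq_square algebra_simps)
    also have "\<dots> \<le> (2 * r\<^sup>2)\<^sup>2"
      using xy \<open>1 \<le> r\<^sup>2\<close> by (intro power_mono) auto
    also have "\<dots> = 4 * r ^ 4" by (simp add: power_mult_distrib power_mult[symmetric])
    also have "\<dots> \<le> 4 * r ^ k" using power_increasing[OF assms r] by simp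
    finally have *: "(1 + x) * (1 + y) \<le> 4 * r ^ k" .
    have "norm (1 / gauss w ^ k) = 4 / (4 * r ^ k)"
      by (simp add: norm_divide norm_power r_def)
    also have "\<dots> \<le> 4 / ((1 + x) * (1 + y))"
      using * xy r by (intro divide_left_mono) (auto intro!: mult_pos_pos add_pos_nonneg)
    finally show ?thesis by (simp add: w x_def y_def)
  qed
qed

text \<open>The Eisenstein sum of weight \<open>4 * p\<close> for the Gaussian integers. For
  positive \<open>p\<close> the origin contributes \<open>1 / 0 = 0\<close>.\<close>

definition gaussE :: "nat \<Rightarrow> complex" where
  "gaussE p = (\<Sum>\<^sub>\<infinity>w. 1 / gauss w ^ (4 * p))"

lemma gaussE_has_sum: "1 \<le> p \<Longrightarrow> ((\<lambda>w. 1 / gauss w ^ (4 * p)) has_sum gaussE p) UNIV"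
  unfolding gaussE_def by (rule has_sum_infsum[OF abs_summable_summable[OF summable_gauss_power]]) simp

section \<open>Lattice expansion and Mellin transform of the Hecke theta series\<close>

lemma Re_power_even:
  "Re (Complex x y ^ (2 * N)) = (\<Sum>j\<le>N. (-1) ^ j * real (2 * N choose (2 * j)) * y ^ (2 * j) * x ^ (2 * (N - j)))"
proof -
  have "Complex x y ^ (2 * N) = (\<i> * of_real y + of_real x) ^ (2 * N)"
    by (simp add: Complex_eq add.commute)
  also have "\<dots> = (\<Sum>k\<le>2 * N. of_nat (2 * N choose k) * (\<i> * of_real y) ^ k * of_real x ^ (2 * N - k))"
    by (rule binomial_ring)
  finally have "Re (Complex x y ^ (2 * N)) = (\<Sum>k\<le>2 * N. Re (\<i> ^ k) * (real (2 * N choose k) * y ^ k * x ^ (2 * N - k)))"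
  proof -
    have *: "Re (of_nat c * (\<i> * of_real y) ^ k * of_real x ^ l) = Re (\<i> ^ k) * (real c * y ^ k * x ^ l)" for c k l
    proof -
      have "of_nat c * (\<i> * of_real y) ^ k * of_real x ^ l = \<i> ^ k * of_real (real c * y ^ k * x ^ l)"
        by (simp add: power_mult_distrib)
      moreover have "Re (z * of_real r) = Re z * r" for z r by simp
      ultimately show ?thesis by (simp only:)
    qed
    assume "Complex x y ^ (2 * N) = (\<Sum>k\<le>2 * N. of_nat (2 * N choose k) * (\<i> * of_real y) ^ k * of_real x ^ (2 * N - k))"
    then show ?thesis by (simp only: Re_sum *)
  qed
  also have "\<dots> = (\<Sum>k\<in>(\<lambda>j. 2 * j) ` {..N}. Re (\<i> ^ k) * (real (2 * N choose k) * y ^ k * x ^ (2 * N - k)))"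
  proof (rule sum.mono_neutral_right)
    show "\<forall>k\<in>{..2 * N} - (\<lambda>j. 2 * j) ` {..N}. Re (\<i> ^ k) * (real (2 * N choose k) * y ^ k * x ^ (2 * N - k)) = 0"
    proof
      fix k assume k: "k \<in> {..2 * N} - (\<lambda>j. 2 * j) ` {..N}"
      have "odd k"
      proof
        assume "even k"
        then obtain j where "k = 2 * j" by (auto elim: evenE)
        then show False using k by auto
      qed
      then obtain j where "k = 2 * j + 1" by (auto elim: oddE)
      then have "\<i> ^ k = \<i> * of_real ((-1) ^ j)" by (simp add: power_mult)
      then have "Re (\<i> ^ k) = 0" by simp
      then show "Re (\<i> ^ k) * (real (2 * N choose k) * y ^ k * x ^ (2 * N - k)) = 0" by simp
    qed
  qed auto
  also have "\<dots> = (\<Sum>j\<le>N. Re (\<i> ^ (2 * j)) * (real (2 * N choose (2 * j)) * y ^ (2 * j) * x ^ (2 * N - 2 * j)))"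
    by (subst sum.reindex) (auto simp: inj_on_def)
  also have "\<dots> = (\<Sum>j\<le>N. (-1) ^ j * real (2 * N choose (2 * j)) * y ^ (2 * j) * x ^ (2 * (N - j)))"
  proof (intro sum.cong refl)
    fix j
    have "\<i> ^ (2 * j) = of_real ((-1) ^ j)" by (simp add: power_mult)
    then have "Re (\<i> ^ (2 * j)) = (-1) ^ j" by (simp only: Re_complex_of_real)
    then show "Re (\<i> ^ (2 * j)) * (real (2 * N choose (2 * j)) * y ^ (2 * j) * x ^ (2 * N - 2 * j))
      = (-1) ^ j * real (2 * N choose (2 * j)) * y ^ (2 * j) * x ^ (2 * (N - j))"
      by (simp add: diff_mult_distrib2)
  qed
  finally show ?thesis .
qed

lemma has_sum_finite_sum:
  fixes f :: "'i \<Rightarrow> 'a \<Rightarrow> real"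
  assumes "finite I" "\<And>i. i \<in> I \<Longrightarrow> (f i has_sum s i) A"
  shows "((\<lambda>x. \<Sum>i\<in>I. f i x) has_sum (\<Sum>i\<in>I. s i)) A"
  using assms by (induction I rule: finite_induct) (auto intro: has_sum_add)

lemma thetaform_has_sum:
  assumes "\<bar>q\<bar> < 1"
  shows "((\<lambda>w. Re (gauss w ^ (4 * p)) * q ^ nat ((fst w)\<^sup>2 + (snd w)\<^sup>2)) has_sum thetaform p q) UNIV"
proof -
  let ?f = "\<lambda>j (w :: int \<times> int). (-1) ^ j * real (4 * p choose (2 * j)) *
     (case w of (n, m) \<Rightarrow> (real_of_int n ^ (2 * j) * q ^ nat (n\<^sup>2)) * (real_of_int m ^ (2 * (2 * p - j)) * q ^ nat (m\<^sup>2)))"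
  have "(?f j has_sum (-1) ^ j * real (4 * p choose (2 * j)) * (theta j q * theta (2 * p - j) q)) UNIV" for j
    using has_sum_cmult_right[OF has_sum_prod_real[OF theta_has_sum[OF assms, of j] theta_has_sum[OF assms, of "2 * p - j"]],
        of "(-1) ^ j * real (4 * p choose (2 * j))"]
    by simp
  then have "((\<lambda>w. \<Sum>j\<le>2 * p. ?f j w) has_sum (\<Sum>j\<le>2 * p. (-1) ^ j * real (4 * p choose (2 * j)) * (theta j q * theta (2 * p - j) q))) UNIV"
    by (intro has_sum_finite_sum) auto
  then have 1: "((\<lambda>w. \<Sum>j\<le>2 * p. ?f j w) has_sum thetaform p q) UNIV"
    by (simp only: thetaform_def mult.assoc)
  \<comment> \<open>\<open>Re_power_even\<close> attaches the exponent \<open>2 * j\<close> to the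
    imaginary part, \<open>?f\<close> to the first coordinate; the coordinates are exchanged to
    reconcile them.\<close>
  have bij: "bij_betw (\<lambda>w :: int \<times> int. (snd w, fst w)) UNIV UNIV"
    by (rule bij_betwI[where g = "\<lambda>w. (snd w, fst w)"]) auto
  have "((\<lambda>w. \<Sum>j\<le>2 * p. ?f j (snd w, fst w)) has_sum thetaform p q) UNIV"
    using has_sum_reindex_bij_betw[OF bij, of "\<lambda>w. \<Sum>j\<le>2 * p. ?f j w" "thetaform p q"] 1 by blast
  moreover have "(\<Sum>j\<le>2 * p. ?f j (snd w, fst w)) = Re (gauss w ^ (4 * p)) * q ^ nat ((fst w)\<^sup>2 + (snd w)\<^sup>2)" for w
  proof -
    have e: "nat ((fst w)\<^sup>2 + (snd w)\<^sup>2) = nat ((snd w)\<^sup>2) + nat ((fst w)\<^sup>2)"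
      by (simp add: nat_add_distrib)
    have "Re (gauss w ^ (4 * p)) = (\<Sum>j\<le>2 * p. (-1) ^ j * real (4 * p choose (2 * j)) * real_of_int (snd w) ^ (2 * j) * real_of_int (fst w) ^ (2 * (2 * p - j)))"
      using Re_power_even[of "real_of_int (fst w)" "real_of_int (snd w)" "2 * p"] by (simp add: gauss_def)
    then show ?thesis
      unfolding e power_add by (simp only: sum_distrib_right prod.case) (simp add: mult_ac)
  qed
  ultimately show ?thesis by simp
qed

lemma has_integral_power_exp:
  fixes a :: real
  assumes "0 < a"
  shows "(\<lambda>x. x ^ n * exp (- (a * x))) absolutely_integrable_on {0<..}"
    and "integral {0<..} (\<lambda>x. x ^ n * exp (- (a * x))) = fact n / a ^ Suc n"
proof -
  have "((\<lambda>t::real. t powr (real (Suc n) - 1) / exp t) has_integral fact n) {0..}"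
    using Gamma_integral_real[of "real (Suc n)"] Gamma_fact[of n, where 'a = real] by (simp add: add.commute)
  then have "((\<lambda>t::real. if t \<in> {0<..} then t ^ n * exp (- t) else 0) has_integral fact n) {0..}"
    by (rule has_integral_spike[of "{0}", rotated 2]) (auto simp: powr_realpow exp_minus field_simps)
  then have "((\<lambda>t::real. t ^ n * exp (- t)) has_integral fact n) {0<..}"
    by (subst (asm) has_integral_restrict) auto
  then have 1: "(\<lambda>t::real. t ^ n * exp (- t)) absolutely_integrable_on {0<..}"
    and 2: "integral {0<..} (\<lambda>t::real. t ^ n * exp (- t)) = fact n"
    by (auto intro!: nonnegative_absolutely_integrable_1)
  have "(\<lambda>x. a * x) ` {0<..} = {0<..}"
  proof -
    have "y \<in> (\<lambda>x. a * x) ` {0<..}" if "y > 0" for y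
      using assms that by (intro image_eqI[of _ _ "y / a"]) auto
    then show ?thesis using assms by auto
  qed
  then have "(\<lambda>x. \<bar>a\<bar> * ((a * x) ^ n * exp (- (a * x)))) absolutely_integrable_on {0<..} \<and>
      integral {0<..} (\<lambda>x. \<bar>a\<bar> * ((a * x) ^ n * exp (- (a * x)))) = fact n"
    using has_absolute_integral_change_of_variables_1'[of "{0<..}" "\<lambda>x. a * x" "\<lambda>_. a" "\<lambda>t. t ^ n * exp (- t)" "fact n"] 1 2 assms
    by (auto intro!: derivative_eq_intros simp: inj_on_def)
  moreover have e: "(\<lambda>x. \<bar>a\<bar> * ((a * x) ^ n * exp (- (a * x)))) = (\<lambda>x. a ^ Suc n * (x ^ n * exp (- (a * x))))"
    using assms by (auto simp: power_mult_distrib fun_eq_iff)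
  ultimately have *: "(\<lambda>x. a ^ Suc n * (x ^ n * exp (- (a * x)))) absolutely_integrable_on {0<..}"
    "integral {0<..} (\<lambda>x. a ^ Suc n * (x ^ n * exp (- (a * x)))) = fact n"
    unfolding e by auto
  have "(\<lambda>x. 1 / a ^ Suc n * (a ^ Suc n * (x ^ n * exp (- (a * x))))) absolutely_integrable_on {0<..}"
    by (rule set_integrable_mult_right) (use * in simp)
  then show "(\<lambda>x. x ^ n * exp (- (a * x))) absolutely_integrable_on {0<..}"
    using assms by simp
  show "integral {0<..} (\<lambda>x. x ^ n * exp (- (a * x))) = fact n / a ^ Suc n"
    using *(2) assms by (simp del: power_Suc) (simp add: field_simps del: power_Suc)
qed

lemma Re_inverse_power:
  assumes "z \<noteq> 0"
  shows "Re (1 / z ^ k) = Re (z ^ k) / (cmod z)\<^sup>2 ^ k"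
proof -
  have "Re (1 / z ^ k) = Re (z ^ k) / (cmod (z ^ k))\<^sup>2"
    using Re_divide[of 1 "z ^ k"] cmod_power2[of "z ^ k"] by simp
  then show ?thesis by (simp add: norm_power power_mult[symmetric] mult.commute)
qed

text \<open>Termwise, \<open>w\<close> contributes \<open>Re (w ^ (4 * p))\<close> times
  \<open>fact (4 * p - 1) / (pi * |w|^2) ^ (4 * p)\<close>, a multiple of
  \<open>Re (1 / w ^ (4 * p))\<close>. Each term has constant sign in \<open>x\<close>, so the
  integral of its norm is the modulus of its integral, and absolute convergence of the lattice sum
  justifies the exchange.\<close>

lemma thetaform_integral:
  assumes p: "1 \<le> p"
  shows "(\<lambda>x. thetaform p (exp (- (pi * x))) * x ^ (4 * p - 1)) absolutely_integrable_on {0<..}"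
    and "integral {0<..} (\<lambda>x. thetaform p (exp (- (pi * x))) * x ^ (4 * p - 1)) = fact (4 * p - 1) / pi ^ (4 * p) * Re (gaussE p)"
proof -
  define e :: "nat \<Rightarrow> int \<times> int" where "e = from_nat_into UNIV"
  have e: "bij_betw e UNIV UNIV"
    unfolding e_def by (rule bij_betw_from_nat_into) (auto simp: infinite_UNIV_char_0 finite_prod)
  define c where "c = (\<lambda>i. Re (gauss (e i) ^ (4 * p)))"
  define N where "N = (\<lambda>i. (cmod (gauss (e i)))\<^sup>2)"
  define f where "f = (\<lambda>i x. c i * (x ^ (4 * p - 1) * exp (- (pi * N i * x))))"
  let ?M = "lebesgue_on {0<..} :: real measure"
  have N: "real (nat ((fst (e i))\<^sup>2 + (snd (e i))\<^sup>2)) = N i" for i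
    using norm_gauss_square[of "fst (e i)" "snd (e i)"] by (simp add: N_def)
  \<comment> \<open>The term of the origin does not decay in \<open>x\<close>; it drops out because
    \<open>p\<close> is positive.\<close>
  have c0: "c i = 0" if "N i = 0" for i
    using that p by (simp add: N_def c_def power_0_left)
  have Npos: "0 < N i" if "N i \<noteq> 0" for i using that by (simp add: N_def)
  have I: "integral {0<..} (\<lambda>x. x ^ (4 * p - 1) * exp (- (pi * N i * x))) = fact (4 * p - 1) / (pi * N i) ^ (4 * p)"
    and A: "(\<lambda>x. x ^ (4 * p - 1) * exp (- (pi * N i * x))) absolutely_integrable_on {0<..}" if "N i \<noteq> 0" for i
    using has_integral_power_exp[of "pi * N i" "4 * p - 1"] Npos[OF that] p by auto
  have fint: "f i absolutely_integrable_on {0<..}" for i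
  proof (cases "N i = 0")
    case False
    show ?thesis unfolding f_def by (rule set_integrable_mult_right) (use A[OF False] in simp)
  qed (simp add: f_def c0)
  have fI: "integrable ?M (f i)" for i
    using fint[of i] by (simp add: integrable_restrict_space set_integrable_def)
  have fval: "integral\<^sup>L ?M (f i) = fact (4 * p - 1) / pi ^ (4 * p) * Re (1 / gauss (e i) ^ (4 * p))" for i
  proof (cases "N i = 0")
    case True
    then have "gauss (e i) = 0" by (simp add: N_def)
    then show ?thesis using c0[OF True] p by (simp add: f_def power_0_left)
  next
    case False
    then have g: "gauss (e i) \<noteq> 0" by (simp add: N_def)
    have "integral\<^sup>L ?M (f i) = integral {0<..} (f i)"
      by (rule lebesgue_integral_eq_integral[OF fI]) simp
    also have "\<dots> = c i * (fact (4 * p - 1) / (pi * N i) ^ (4 * p))"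
      unfolding f_def using I[OF False] by simp
    also have "\<dots> = fact (4 * p - 1) / pi ^ (4 * p) * Re (1 / gauss (e i) ^ (4 * p))"
      unfolding Re_inverse_power[OF g] by (simp add: c_def N_def power_mult_distrib)
    finally show ?thesis .
  qed
  have fnorm: "integral\<^sup>L ?M (\<lambda>x. norm (f i x)) = fact (4 * p - 1) / pi ^ (4 * p) * \<bar>Re (1 / gauss (e i) ^ (4 * p))\<bar>" for i
  proof -
    have "integral\<^sup>L ?M (\<lambda>x. norm (f i x)) = integral\<^sup>L ?M (\<lambda>x. sgn (c i) * f i x)"
    proof (rule Bochner_Integration.integral_cong)
      fix x assume "x \<in> space ?M"
      then have "0 \<le> x ^ (4 * p - 1) * exp (- (pi * N i * x))" by simp
      then have "norm (f i x) = \<bar>c i\<bar> * (x ^ (4 * p - 1) * exp (- (pi * N i * x)))"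
        unfolding f_def real_norm_def abs_mult[of "c i"] by simp
      also have "\<dots> = sgn (c i) * f i x"
        unfolding f_def abs_sgn[of "c i"] by (simp only: mult.assoc mult.commute mult.left_commute)
      finally show "norm (f i x) = sgn (c i) * f i x" .
    qed simp
    also have "\<dots> = sgn (c i) * (fact (4 * p - 1) / pi ^ (4 * p) * Re (1 / gauss (e i) ^ (4 * p)))"
      by (simp add: fval)
    also have "sgn (c i) = sgn (Re (1 / gauss (e i) ^ (4 * p)))"
    proof (cases "N i = 0")
      case True
      then have "gauss (e i) = 0" by (simp add: N_def)
      then show ?thesis using c0[OF True] p by (simp add: power_0_left)
    next
      case False
      then have g: "gauss (e i) \<noteq> 0" by (simp add: N_def)
      show ?thesis unfolding Re_inverse_power[OF g] c_def using g by (simp add: sgn_divide)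
    qed
    finally show ?thesis by (simp add: abs_sgn[of "Re (1 / gauss (e i) ^ (4 * p))"])
  qed
  have S: "((\<lambda>w. Re (1 / gauss w ^ (4 * p))) has_sum Re (gaussE p)) UNIV"
    by (rule has_sum_Re[OF gaussE_has_sum[OF p]])
  then have "(\<lambda>w. Re (1 / gauss w ^ (4 * p))) summable_on UNIV"
    by (rule has_sum_imp_summable)
  then have "(\<lambda>w. \<bar>Re (1 / gauss w ^ (4 * p))\<bar>) summable_on UNIV"
    by (subst (asm) summable_on_iff_abs_summable_on_real) simp
  then have "(\<lambda>i. \<bar>Re (1 / gauss (e i) ^ (4 * p))\<bar>) summable_on UNIV"
    by (subst summable_on_reindex_bij_betw[OF e])
  then have "summable (\<lambda>i. \<bar>Re (1 / gauss (e i) ^ (4 * p))\<bar>)"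
    by (rule summable_on_imp_summable)
  then have sn: "summable (\<lambda>i. integral\<^sup>L ?M (\<lambda>x. norm (f i x)))"
    unfolding fnorm by (rule summable_mult)
  have pt: "((\<lambda>i. f i x) has_sum thetaform p (exp (- (pi * x))) * x ^ (4 * p - 1)) UNIV" if x: "0 < x" for x
  proof -
    have "\<bar>exp (- (pi * x))\<bar> < 1" using x by simp
    from has_sum_cmult_left[OF thetaform_has_sum[OF this, of p], of "x ^ (4 * p - 1)"]
    have "((\<lambda>i. Re (gauss (e i) ^ (4 * p)) * exp (- (pi * x)) ^ nat ((fst (e i))\<^sup>2 + (snd (e i))\<^sup>2) * x ^ (4 * p - 1))
        has_sum thetaform p (exp (- (pi * x))) * x ^ (4 * p - 1)) UNIV"
      by (subst has_sum_reindex_bij_betw[OF e])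
    moreover have "Re (gauss (e i) ^ (4 * p)) * exp (- (pi * x)) ^ nat ((fst (e i))\<^sup>2 + (snd (e i))\<^sup>2) * x ^ (4 * p - 1) = f i x" for i
      unfolding f_def c_def exp_of_nat_mult[symmetric] N by (simp add: mult.commute mult.left_commute)
    ultimately show ?thesis by simp
  qed
  have ptn: "summable (\<lambda>i. norm (f i x))" if x: "0 < x" for x
  proof -
    have "(\<lambda>i. norm (f i x)) summable_on UNIV"
      using has_sum_imp_summable[OF pt[OF x]] by (subst (asm) summable_on_iff_abs_summable_on_real)
    then show ?thesis by (rule summable_on_imp_summable)
  qed
  have AE: "AE x in ?M. summable (\<lambda>i. norm (f i x))"
    using ptn by (intro AE_I2) simp
  have int: "integrable ?M (\<lambda>x. \<Sum>i. f i x)"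
    by (rule integrable_suminf[OF fI AE sn])
  have sums: "(\<lambda>i. integral\<^sup>L ?M (f i)) sums integral\<^sup>L ?M (\<lambda>x. \<Sum>i. f i x)"
    by (rule sums_integral[OF fI AE sn])
  have eq: "(\<Sum>i. f i x) = thetaform p (exp (- (pi * x))) * x ^ (4 * p - 1)" if "x \<in> {0<..}" for x
    using has_sum_imp_sums[OF pt[of x]] that by (simp add: sums_iff)
  have int': "integrable ?M (\<lambda>x. thetaform p (exp (- (pi * x))) * x ^ (4 * p - 1))"
    by (rule Bochner_Integration.integrable_cong[THEN iffD1, OF refl _ int]) (use eq in simp)
  then show "(\<lambda>x. thetaform p (exp (- (pi * x))) * x ^ (4 * p - 1)) absolutely_integrable_on {0<..}"
    by (simp add: integrable_restrict_space set_integrable_def)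
  have "integral {0<..} (\<lambda>x. thetaform p (exp (- (pi * x))) * x ^ (4 * p - 1))
      = integral\<^sup>L ?M (\<lambda>x. thetaform p (exp (- (pi * x))) * x ^ (4 * p - 1))"
    by (rule lebesgue_integral_eq_integral[OF int', symmetric]) simp
  also have "\<dots> = integral\<^sup>L ?M (\<lambda>x. \<Sum>i. f i x)"
    by (rule Bochner_Integration.integral_cong) (use eq in auto)
  also have "\<dots> = fact (4 * p - 1) / pi ^ (4 * p) * Re (gaussE p)"
  proof (rule sums_unique2[OF sums])
    have "((\<lambda>i. Re (1 / gauss (e i) ^ (4 * p))) has_sum Re (gaussE p)) UNIV"
      using S by (subst has_sum_reindex_bij_betw[OF e])
    then show "(\<lambda>i. integral\<^sup>L ?M (f i)) sums (fact (4 * p - 1) / pi ^ (4 * p) * Re (gaussE p))"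
      unfolding fval by (intro sums_mult has_sum_imp_sums)
  qed
  finally show "integral {0<..} (\<lambda>x. thetaform p (exp (- (pi * x))) * x ^ (4 * p - 1)) = fact (4 * p - 1) / pi ^ (4 * p) * Re (gaussE p)" .
qed

section \<open>Odd Gaussian integers and Newton identities\<close>

text \<open>The first index determines the imaginary part and numbers the rows, the second runs
  along a row; the products and sums below are iterated in this order.\<close>

definition oddw :: "nat \<times> nat \<Rightarrow> complex" where
  "oddw x = Complex (2 * real (snd x) + 1) (2 * real (fst x) + 1)"

text \<open>Twice the real part joins \<open>w\<close> with its conjugate. The result is the
  \<open>p\<close>-th power sum of the numbers \<open>1 / w ^ 4\<close>, with \<open>w\<close>
  running over the Gaussian integers with odd coordinates, up to sign.\<close>

definition oddS :: "nat \<Rightarrow> real" where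
  "oddS p = (\<Sum>\<^sub>\<infinity>x. 2 * Re (1 / oddw x ^ (4 * p)))"

lemma odd_int_cases:
  fixes m :: int
  assumes "odd m"
  obtains s n where "m = (if s then 1 else -1) * (2 * int n + 1)"
proof (cases "m > 0")
  case True
  from assms obtain j where "m = 2 * j + 1" by (auto elim: oddE)
  then have "m = (if True then 1 else -1) * (2 * int (nat j) + 1)" using True by simp
  then show ?thesis using that by blast
next
  case False
  from assms obtain j where "m = 2 * j + 1" by (auto elim: oddE)
  then have "m = (if False then 1 else -1) * (2 * int (nat (- j - 1)) + 1)" using False by simp
  then show ?thesis using that by blast
qed

text \<open>A point of the first quadrant represents \<open>w\<close>, \<open>- w\<close> and their
  conjugates; as the exponent is even, the four terms add up to 4 times a real part, so the whole
  sum is real.\<close>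

lemma has_sum_odd_lattice:
  assumes p: "1 \<le> p"
  shows "((\<lambda>w. 1 / gauss w ^ (4 * p)) has_sum of_real (2 * oddS p)) {(m, n). odd m \<and> odd n}"
    and "((\<lambda>x. 2 * Re (1 / oddw x ^ (4 * p))) has_sum oddS p) UNIV"
proof -
  let ?O = "{(m::int, n::int). odd m \<and> odd n}"
  let ?g = "\<lambda>w. 1 / gauss w ^ (4 * p)"
  define \<phi> :: "(nat \<times> nat) \<times> (bool \<times> bool) \<Rightarrow> int \<times> int" where
    "\<phi> = (\<lambda>((n, m), (s, t)). ((if s then 1 else -1) * (2 * int m + 1), (if t then 1 else -1) * (2 * int n + 1)))"
  have bij: "bij_betw \<phi> (UNIV \<times> UNIV) ?O"
  proof (rule bij_betw_imageI)
    show "inj_on \<phi> (UNIV \<times> UNIV)"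
      by (auto simp: inj_on_def \<phi>_def split: if_splits; linarith)
    show "\<phi> ` (UNIV \<times> UNIV) = ?O"
    proof (intro equalityI subsetI)
      fix w assume "w \<in> ?O"
      then obtain a b where w: "w = (a, b)" "odd a" "odd b" by auto
      obtain s m where a: "a = (if s then 1 else -1) * (2 * int m + 1)" using odd_int_cases[OF w(2)] .
      obtain t n where b: "b = (if t then 1 else -1) * (2 * int n + 1)" using odd_int_cases[OF w(3)] .
      have "w = \<phi> ((n, m), (s, t))" unfolding w(1) a b \<phi>_def by simp
      then show "w \<in> \<phi> ` (UNIV \<times> UNIV)" by blast
    qed (auto simp: \<phi>_def split: if_splits)
  qed
  have "(\<lambda>w. norm (?g w)) summable_on UNIV"
    using summable_gauss_power[of "4 * p"] p by simp
  then have "?g summable_on ?O"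
    by (rule summable_on_subset_banach[OF abs_summable_summable]) simp
  then obtain T where T: "(?g has_sum T) ?O" unfolding summable_on_def by blast
  then have T': "((\<lambda>x. ?g (\<phi> x)) has_sum T) (UNIV \<times> UNIV)"
    by (subst has_sum_reindex_bij_betw[OF bij])
  have "((\<lambda>x. of_real (4 * Re (1 / oddw x ^ (4 * p))) :: complex) has_sum T) UNIV"
  proof (rule has_sum_SigmaD[OF T'])
    fix x :: "nat \<times> nat"
    obtain n m where x: "x = (n, m)" by (cases x)
    let ?w = "oddw x"
    have g: "gauss (\<phi> (x, (True, True))) = ?w" "gauss (\<phi> (x, (False, False))) = - ?w"
      "gauss (\<phi> (x, (True, False))) = cnj ?w" "gauss (\<phi> (x, (False, True))) = - cnj ?w"
      by (auto simp: \<phi>_def gauss_def oddw_def x complex_eq_iff)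
    have U: "(UNIV :: (bool \<times> bool) set) = {(True, True), (False, False), (True, False), (False, True)}"
      by (auto simp: UNIV_bool)
    have ev: "(- z) ^ (4 * p) = z ^ (4 * p)" for z :: complex by (simp add: power_mult)
    have "(\<Sum>y\<in>UNIV. ?g (\<phi> (x, y))) = 2 * (1 / ?w ^ (4 * p) + cnj (1 / ?w ^ (4 * p)))"
      unfolding U by (simp add: g ev)
    also have "\<dots> = of_real (4 * Re (1 / ?w ^ (4 * p)))"
      by (simp only: complex_add_cnj) simp
    finally show "((\<lambda>y. ?g (\<phi> (x, y))) has_sum of_real (4 * Re (1 / oddw x ^ (4 * p)))) UNIV"
      by (intro has_sum_finiteI) auto
  qed
  note R = has_sum_Re[OF this] and I = has_sum_Im[OF this]
  have "((\<lambda>x. 1 / 2 * (4 * Re (1 / oddw x ^ (4 * p)))) has_sum 1 / 2 * Re T) UNIV"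
    using has_sum_cmult_right[OF R, of "1 / 2"] by simp
  then have S: "((\<lambda>x. 2 * Re (1 / oddw x ^ (4 * p))) has_sum Re T / 2) UNIV"
    by simp
  then have E: "oddS p = Re T / 2" unfolding oddS_def by (rule infsumI)
  then show "((\<lambda>x. 2 * Re (1 / oddw x ^ (4 * p))) has_sum oddS p) UNIV" using S by (simp only:)
  have "Im T = 0"
    by (rule has_sum_unique[OF I has_sum_0]) simp
  then have "T = of_real (2 * oddS p)" using E by (simp add: complex_eq_iff)
  then show "(?g has_sum of_real (2 * oddS p)) ?O" using T by simp
qed

text \<open>Pairs of even sum form the ideal of \<open>1 + i\<close>, pairs of even coordinates the
  ideal of 2. Both are scaled copies of the lattice, with \<open>(1 + i)^4 = -4\<close> and
  \<open>2^4 = 16\<close>; the odd pairs are what the larger ideal has beyond the smaller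
  one.\<close>

lemma oddS_gaussE:
  assumes p: "1 \<le> p"
  shows "2 * oddS p = ((-4) ^ p - 1) / 16 ^ p * Re (gaussE p)"
proof -
  let ?g = "\<lambda>w. 1 / gauss w ^ (4 * p)"
  let ?E = "{(m::int, n::int). even (m + n)}"
  let ?O = "{(m::int, n::int). odd m \<and> odd n}"
  let ?D = "{(m::int, n::int). even m \<and> even n}"
  note G = gaussE_has_sum[OF p]
  have bE: "bij_betw (\<lambda>(a, b). (a - b, a + b)) UNIV ?E"
  proof (rule bij_betwI[where g = "\<lambda>(m, n). ((m + n) div 2, (n - m) div 2)"])
    have "(m + n) div 2 - (n - m) div 2 = m" "(m + n) div 2 + (n - m) div 2 = n"
      if "even (m + n)" for m n :: int
      using that by presburger+
    then show "(case (case x of (m, n) \<Rightarrow> ((m + n) div 2, (n - m) div 2)) of (a, b) \<Rightarrow> (a - b, a + b)) = x"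
      if "x \<in> ?E" for x :: "int \<times> int"
      using that by (auto simp del: even_add)
  qed auto
  have bD: "bij_betw (\<lambda>(a, b). (2 * a, 2 * b)) UNIV ?D"
    by (rule bij_betwI[where g = "\<lambda>(m, n). (m div 2, n div 2)"]) auto
  have "((\<lambda>w. 1 / (-4) ^ p * ?g w) has_sum 1 / (-4) ^ p * gaussE p) UNIV"
    by (rule has_sum_cmult_right[OF G])
  moreover have "1 / (-4) ^ p * ?g w = ?g (case w of (a, b) \<Rightarrow> (a - b, a + b))" for w
  proof -
    obtain a b where w: "w = (a, b)" by (cases w)
    have "gauss (a - b, a + b) = Complex 1 1 * gauss (a, b)"
      by (simp add: gauss_def complex_eq_iff)
    moreover have "Complex 1 1 ^ 4 = -4"
      by (simp add: power4_eq_xxxx complex_eq_iff)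
    ultimately have "gauss (a - b, a + b) ^ (4 * p) = (-4) ^ p * gauss (a, b) ^ (4 * p)"
      unfolding power_mult by (simp only: power_mult_distrib)
    then show ?thesis by (simp add: w)
  qed
  ultimately have hE: "(?g has_sum 1 / (-4) ^ p * gaussE p) ?E"
    by (subst has_sum_reindex_bij_betw[OF bE, symmetric]) simp
  have "((\<lambda>w. 1 / 16 ^ p * ?g w) has_sum 1 / 16 ^ p * gaussE p) UNIV"
    by (rule has_sum_cmult_right[OF G])
  moreover have "1 / 16 ^ p * ?g w = ?g (case w of (a, b) \<Rightarrow> (2 * a, 2 * b))" for w
  proof -
    obtain a b where w: "w = (a, b)" by (cases w)
    have "gauss (2 * a, 2 * b) = 2 * gauss (a, b)"
      by (simp add: gauss_def complex_eq_iff)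
    then show ?thesis by (simp add: w power_mult_distrib power_mult)
  qed
  ultimately have hD: "(?g has_sum 1 / 16 ^ p * gaussE p) ?D"
    by (subst has_sum_reindex_bij_betw[OF bD, symmetric]) simp
  have "?E = ?O \<union> ?D" by auto
  moreover have "(?g has_sum of_real (2 * oddS p) + 1 / 16 ^ p * gaussE p) (?O \<union> ?D)"
    by (rule has_sum_Un_disjoint[OF has_sum_odd_lattice(1)[OF p] hD]) auto
  ultimately have "1 / (-4) ^ p * gaussE p = of_real (2 * oddS p) + 1 / 16 ^ p * gaussE p"
    using hE has_sum_unique by metis
  moreover have "1 / (-4 :: complex) ^ p = of_real (1 / (-4) ^ p)" "1 / (16 :: complex) ^ p = of_real (1 / 16 ^ p)"
    by simp_all
  ultimately have "Re (of_real (1 / (-4) ^ p) * gaussE p) = Re (of_real (2 * oddS p) + of_real (1 / 16 ^ p) * gaussE p)"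
    by metis
  then have "1 / (-4) ^ p * Re (gaussE p) = 2 * oddS p + 1 / 16 ^ p * Re (gaussE p)"
    by (simp only: plus_complex.sel times_complex.sel Re_complex_of_real Im_complex_of_real mult_zero_left diff_zero)
  moreover have "1 / (-4 :: real) ^ p = (-4) ^ p / 16 ^ p"
  proof -
    have "(-4 :: real) ^ p * (-4) ^ p = 16 ^ p" unfolding power_mult_distrib[symmetric] by simp
    then show ?thesis by (simp add: divide_simps)
  qed
  ultimately show ?thesis by (simp add: field_simps)
qed

section \<open>Nonvanishing of the odd lattice sums\<close>

lemma odd_square_sum: obtains c where "((\<lambda>n. 1 / (2 * real n + 1)\<^sup>2) has_sum c) UNIV" "c \<le> 5 / 4"
proof -
  let ?f = "\<lambda>n. 1 / (2 * real n + 1)\<^sup>2"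
  \<comment> \<open>Telescoping leaves at most 1/4 beyond the first term. The resulting 5/4 (the
    exact sum is \<open>pi^2 / 8\<close>) is tight enough for \<open>c * c < 2\<close>, on which the
    estimates rest.\<close>
  have bound: "?f (Suc n) \<le> 1 / 4 * (1 / (real n + 1) - 1 / (real (Suc n) + 1))" for n
  proof -
    have "1 / 4 * (1 / (real n + 1) - 1 / (real (Suc n) + 1)) = 1 / (4 * ((real n + 1) * (real n + 2)))"
      by (simp add: field_simps)
    moreover have "?f (Suc n) \<le> 1 / (4 * ((real n + 1) * (real n + 2)))"
      by (intro divide_left_mono) (auto simp: power2_eq_square algebra_simps intro!: mult_pos_pos add_pos_nonneg)
    ultimately show ?thesis by simp
  qed
  have "(\<lambda>n. 1 / (real n + 1)) \<longlonglongrightarrow> 0" by real_asymp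
  from telescope_sums'[OF this] have "(\<lambda>n. 1 / (real n + 1) - 1 / (real (Suc n) + 1)) sums 1" by simp
  from sums_mult[OF this, of "1 / 4"]
  have t: "(\<lambda>n. 1 / 4 * (1 / (real n + 1) - 1 / (real (Suc n) + 1))) sums (1 / 4)" by simp
  have s: "summable (\<lambda>n. ?f (Suc n))"
    by (rule summable_comparison_test[OF _ sums_summable[OF t]]) (use bound in auto)
  have "suminf (\<lambda>n. ?f (Suc n)) \<le> 1 / 4"
    using suminf_le[OF bound s sums_summable[OF t]] sums_unique[OF t] by simp
  moreover have s': "summable ?f" using s by (subst (asm) summable_Suc_iff)
  moreover have "suminf ?f = 1 + suminf (\<lambda>n. ?f (Suc n))"
    using suminf_split_head[OF s'] by simp
  ultimately have "suminf ?f \<le> 5 / 4" by simp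
  moreover have "(?f has_sum suminf ?f) UNIV"
    by (rule norm_summable_imp_has_sum) (use s' in auto)
  ultimately show ?thesis using that by blast
qed

lemma norm_oddw_square: "(cmod (oddw (n, m)))\<^sup>2 = (2 * real m + 1)\<^sup>2 + (2 * real n + 1)\<^sup>2"
  by (simp add: oddw_def cmod_power2)

text \<open>Inequality between arithmetic and geometric mean, with equality at
  \<open>(0, 0)\<close>; removing that point from the product series therefore removes exactly
  1.\<close>

lemma norm_oddw_bound: "4 / cmod (oddw (n, m)) ^ 4 \<le> 1 / (2 * real n + 1)\<^sup>2 * (1 / (2 * real m + 1)\<^sup>2)"
  and norm_oddw_ge: "2 \<le> (cmod (oddw (n, m)))\<^sup>2"
proof -
  define x y where "x = (2 * real n + 1)\<^sup>2" and "y = (2 * real m + 1)\<^sup>2"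
  have pos: "1 \<le> x" "1 \<le> y" by (auto simp: x_def y_def)
  have e: "cmod (oddw (n, m)) ^ 4 = (y + x)\<^sup>2"
    unfolding x_def y_def norm_oddw_square[symmetric] by (simp add: power_mult[symmetric])
  have "4 * (x * y) \<le> (y + x)\<^sup>2"
    using zero_le_power2[of "x - y"] by (simp add: power2_eq_square algebra_simps)
  moreover have "0 < x * y" using pos by simp
  ultimately have "4 / (y + x)\<^sup>2 \<le> 4 / (4 * (x * y))"
    by (intro frac_le) auto
  then show "4 / cmod (oddw (n, m)) ^ 4 \<le> 1 / (2 * real n + 1)\<^sup>2 * (1 / (2 * real m + 1)\<^sup>2)"
    unfolding e by (simp add: x_def y_def)
  show "2 \<le> (cmod (oddw (n, m)))\<^sup>2" unfolding norm_oddw_square x_def[symmetric] y_def[symmetric] using pos by linarith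
qed

text \<open>Scaled by \<open>(-4)^p\<close>, the term of \<open>1 + i\<close> is exactly 2. All
  others together are at most \<open>2 * (c * c - 1)\<close>, which is at most 9/8 for every
  \<open>p\<close>, so they cannot cancel it.\<close>

lemma oddS_nonzero:
  assumes p: "1 \<le> p"
  shows "oddS p \<noteq> 0"
proof
  assume 0: "oddS p = 0"
  obtain c where c: "((\<lambda>n. 1 / (2 * real n + 1)\<^sup>2) has_sum c) UNIV" "c \<le> 5 / 4" by (rule odd_square_sum)
  have c0: "0 \<le> c" by (rule has_sum_nonneg[OF c(1)]) simp
  let ?b = "\<lambda>(n, m). 1 / (2 * real n + 1)\<^sup>2 * (1 / (2 * real m + 1)\<^sup>2)"
  let ?t = "\<lambda>x. (-4) ^ p * (2 * Re (1 / oddw x ^ (4 * p)))"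
  let ?R = "UNIV - {(0::nat, 0::nat)}"
  have b: "(?b has_sum c * c) UNIV"
    using has_sum_prod_real[OF c(1) c(1)] by simp
  have b': "(?b has_sum c * c - 1) ?R"
    using has_sum_Diff[OF b, of "{(0, 0)}" 1] has_sum_finite[of "{(0, 0)}" ?b] by simp
  have z: "(?t has_sum (-4) ^ p * 0) UNIV"
    using has_sum_cmult_right[OF has_sum_odd_lattice(2)[OF p], of "(-4) ^ p"] 0 by simp
  have t0: "?t (0, 0) = 2"
  proof -
    have "oddw (0, 0) ^ 4 = -4" by (simp add: oddw_def power4_eq_xxxx complex_eq_iff)
    then have "1 / oddw (0, 0) ^ (4 * p) = of_real (1 / (-4) ^ p)" by (simp add: power_mult)
    then show ?thesis by (simp only: Re_complex_of_real) simp
  qed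
  have "(?t has_sum (-4) ^ p * 0 - sum ?t {(0, 0)}) ?R"
    by (rule has_sum_Diff[OF z has_sum_finite]) auto
  moreover have "(-4) ^ p * 0 - sum ?t {(0, 0)} = - 2" using t0 by simp
  ultimately have t': "(?t has_sum - 2) ?R" by (simp only:)
  have "- (2 * (c * c - 1)) \<le> - 2"
  proof (rule has_sum_mono)
    show "((\<lambda>x. - (2 * ?b x)) has_sum - (2 * (c * c - 1))) ?R"
      unfolding has_sum_uminus minus_minus by (rule has_sum_cmult_right[OF b'])
    show "(?t has_sum - 2) ?R" by (rule t')
    fix x assume "x \<in> ?R"
    obtain n m where x: "x = (n, m)" by (cases x)
    have r: "2 \<le> (cmod (oddw x))\<^sup>2" unfolding x by (rule norm_oddw_ge)
    then have "2 * 2 \<le> (cmod (oddw x))\<^sup>2 * (cmod (oddw x))\<^sup>2" by (intro mult_mono) auto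
    then have r4: "4 \<le> cmod (oddw x) ^ 4" by (simp add: power2_eq_square power4_eq_xxxx)
    have "\<bar>?t x\<bar> = 4 ^ p * (2 * \<bar>Re (1 / oddw x ^ (4 * p))\<bar>)" by (simp add: abs_mult power_abs)
    also have "\<dots> \<le> 4 ^ p * (2 * cmod (1 / oddw x ^ (4 * p)))"
      by (intro mult_left_mono abs_Re_le_cmod) auto
    also have "\<dots> = 2 * (4 / cmod (oddw x) ^ 4) ^ p"
      by (simp add: norm_divide norm_power power_divide power_mult)
    also have "\<dots> \<le> 2 * (4 / cmod (oddw x) ^ 4) ^ 1"
      using r4 p by (intro mult_left_mono power_decreasing) (auto simp: divide_le_eq_1)
    also have "\<dots> \<le> 2 * ?b x"
      using norm_oddw_bound[of n m] by (simp add: x)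
    finally show "- (2 * ?b x) \<le> ?t x" by linarith
  qed
  moreover have "c * c \<le> 5 / 4 * (5 / 4)" using c0 c(2) by (intro mult_mono) auto
  ultimately show False by simp
qed

text \<open>For power sums \<open>s j\<close> of numbers \<open>a\<close>, these are the
  coefficients of the product of all \<open>1 - a X\<close>. Defining them for arbitrary
  \<open>s\<close> allows limits to be taken in the power sums, coefficient by coefficient.\<close>

fun newtonE :: "(nat \<Rightarrow> complex) \<Rightarrow> nat \<Rightarrow> complex" where
  "newtonE s n = (if n = 0 then 1 else - (\<Sum>j<n. s (Suc j) * newtonE s (n - Suc j)) / of_nat n)"

declare newtonE.simps [simp del]

lemma newtonE_0: "newtonE s 0 = 1"
  by (simp add: newtonE.simps)

lemma newtonE_Suc: "n \<noteq> 0 \<Longrightarrow> of_nat n * newtonE s n = - (\<Sum>j<n. s (Suc j) * newtonE s (n - Suc j))"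
  by (subst newtonE.simps) simp

lemma newtonE_unique:
  assumes "c 0 = 1" "\<And>n. n \<noteq> 0 \<Longrightarrow> of_nat n * c n = - (\<Sum>j<n. s (Suc j) * c (n - Suc j))"
  shows "c n = newtonE s n"
proof (induction n rule: less_induct)
  case (less n)
  show ?case
  proof (cases "n = 0")
    case False
    have "of_nat n * c n = - (\<Sum>j<n. s (Suc j) * newtonE s (n - Suc j))"
      using assms(2)[OF False] less by simp
    also have "\<dots> = of_nat n * newtonE s n" using newtonE_Suc[OF False] by simp
    finally show ?thesis using False by simp
  qed (simp add: assms newtonE_0)
qed

text \<open>Each of the \<open>n\<close> summands is at most \<open>B ^ n\<close>, and the division
  by \<open>n\<close> restores the bound.\<close>

lemma newtonE_bound:
  assumes "\<And>j. norm (s (Suc j)) \<le> B ^ Suc j" "0 \<le> B"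
  shows "norm (newtonE s n) \<le> B ^ n"
proof (induction n rule: less_induct)
  case (less n)
  show ?case
  proof (cases "n = 0")
    case False
    have "real n * norm (newtonE s n) = norm (\<Sum>j<n. s (Suc j) * newtonE s (n - Suc j))"
      using arg_cong[OF newtonE_Suc[OF False, of s], of norm] by (simp add: norm_mult)
    also have "\<dots> \<le> (\<Sum>j<n. norm (s (Suc j)) * norm (newtonE s (n - Suc j)))"
      by (rule order_trans[OF norm_sum]) (simp add: norm_mult)
    also have "\<dots> \<le> (\<Sum>j<n. B ^ Suc j * B ^ (n - Suc j))"
      using assms less by (intro sum_mono mult_mono) auto
    also have "\<dots> = (\<Sum>j<n. B ^ n)"
    proof (intro sum.cong refl)
      fix j assume "j \<in> {..<n}"
      then show "B ^ Suc j * B ^ (n - Suc j) = B ^ n"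
        by (subst power_add[symmetric]) simp
    qed
    finally have "real n * norm (newtonE s n) \<le> real n * B ^ n" by simp
    then show ?thesis using False by simp
  qed (simp add: newtonE_0)
qed

lemma newtonE_tendsto:
  assumes "\<And>j. (\<lambda>N. s N (Suc j)) \<longlonglongrightarrow> s' (Suc j)"
  shows "(\<lambda>N. newtonE (s N) n) \<longlonglongrightarrow> newtonE s' n"
proof (induction n rule: less_induct)
  case (less n)
  show ?case
  proof (cases "n = 0")
    case False
    have e: "newtonE s n = - (\<Sum>j<n. s (Suc j) * newtonE s (n - Suc j)) / of_nat n" for s
      using False by (subst newtonE.simps) simp
    show ?thesis
      unfolding e[of "s _"] e[of s']
      by (intro tendsto_divide tendsto_minus tendsto_sum tendsto_mult assms less tendsto_const)
         (use False in auto)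
  qed (simp add: newtonE_0)
qed

text \<open>Tannery's theorem with the geometric majorant from \<open>newtonE_bound\<close>, which
  is uniform in \<open>N\<close>.\<close>

lemma newton_series_tendsto:
  assumes lim: "\<And>j. (\<lambda>N. s N (Suc j)) \<longlonglongrightarrow> s' (Suc j)"
    and bound: "\<And>N j. norm (s N (Suc j)) \<le> B ^ Suc j" and B: "0 \<le> B" and Z: "norm Z * B < 1"
  shows "(\<lambda>N. \<Sum>n. newtonE (s N) n * Z ^ n) \<longlonglongrightarrow> (\<Sum>n. newtonE s' n * Z ^ n)"
proof -
  have "eventually (\<lambda>N. summable (\<lambda>n. norm (newtonE (s N) n * Z ^ n))) sequentially \<and>
      summable (\<lambda>n. norm (newtonE s' n * Z ^ n)) \<and>
      ((\<lambda>N. \<Sum>n. newtonE (s N) n * Z ^ n) \<longlongrightarrow> (\<Sum>n. newtonE s' n * Z ^ n)) sequentially"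
  proof (rule tannerys_theorem)
    show "(\<lambda>N. newtonE (s N) n * Z ^ n) \<longlonglongrightarrow> newtonE s' n * Z ^ n" for n
      by (intro tendsto_mult newtonE_tendsto lim tendsto_const)
    show "summable (\<lambda>n. (norm Z * B) ^ n)" using Z B by (intro summable_geometric) auto
    have "norm (newtonE (s N) n * Z ^ n) \<le> (norm Z * B) ^ n" for N n
      using mult_right_mono[OF newtonE_bound[of "s N" B n, OF bound B], of "norm Z ^ n"]
      by (simp add: norm_mult norm_power power_mult_distrib mult.commute)
    then show "\<forall>\<^sub>F (n, N) in at_top \<times>\<^sub>F sequentially. norm (newtonE (s N) n * Z ^ n) \<le> (norm Z * B) ^ n"
      by (intro always_eventually) auto
  qed simp
  then show ?thesis by blast
qed

text \<open>Newton's identities, in the form \<open>X F' = - F * (\<Sum>j\<ge>1. s j X^j)\<close> for \<open>F = \<Prod>(1 - a X)\<close>.\<close>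

lemma newton_finite:
  fixes a :: "'i \<Rightarrow> complex"
  assumes "finite I"
  shows "(\<lambda>n. newtonE (\<lambda>j. \<Sum>i\<in>I. a i ^ j) n * Z ^ n) sums (\<Prod>i\<in>I. 1 - a i * Z)"
proof -
  define P where "P = (\<lambda>I. \<Prod>i\<in>I. [:1, - a i:])"
  define L where "L = (\<lambda>I. Abs_fps (\<lambda>j. if j = 0 then 0 else \<Sum>i\<in>I. a i ^ j))"
  have geo: "(1 - fps_const b * fps_X) * Abs_fps (\<lambda>j. if j = 0 then 0 else b ^ j) = fps_const b * fps_X" for b :: complex
  proof (rule fps_ext)
    fix n
    show "fps_nth ((1 - fps_const b * fps_X) * Abs_fps (\<lambda>j. if j = 0 then 0 else b ^ j)) n = fps_nth (fps_const b * fps_X) n"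
      by (cases n) (auto simp: left_diff_distrib mult.assoc fps_X_def[symmetric] split: if_splits)
  qed
  have D: "fps_X * fps_deriv (fps_of_poly (P I)) = - (fps_of_poly (P I) * L I)"
    using assms
  proof (induction I rule: finite_induct)
    case empty
    have "L {} = 0" by (rule fps_ext) (simp add: L_def)
    then show ?case by (simp add: P_def)
  next
    case (insert i I)
    have PI: "fps_of_poly (P (insert i I)) = (1 - fps_const (a i) * fps_X) * fps_of_poly (P I)"
      using insert by (simp add: P_def fps_of_poly_mult fps_of_poly_pCons)
    have LI: "L (insert i I) = L I + Abs_fps (\<lambda>j. if j = 0 then 0 else a i ^ j)"
      using insert by (intro fps_ext) (simp add: L_def)
    define F where "F = fps_of_poly (P I)"
    define u where "u = 1 - fps_const (a i) * fps_X"
    define v where "v = Abs_fps (\<lambda>j. if j = 0 then 0 else a i ^ j)"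
    have "fps_deriv u = - fps_const (a i)" unfolding u_def by simp
    then have "fps_X * fps_deriv (u * F) = u * (fps_X * fps_deriv F) - (fps_const (a i) * fps_X) * F"
      by (simp add: algebra_simps del: fps_const_neg)
    also have "\<dots> = - (u * F * L I) - (u * v) * F"
      using insert.IH geo[of "a i"] by (simp add: F_def u_def v_def mult.assoc)
    also have "\<dots> = - (u * F * (L I + v))" by (simp add: algebra_simps)
    finally show ?case unfolding PI LI F_def u_def v_def .
  qed
  have c: "coeff (P I) n = newtonE (\<lambda>j. \<Sum>i\<in>I. a i ^ j) n" for n
  proof (rule newtonE_unique)
    have "poly (P I) 0 = 1" by (simp add: P_def poly_prod)
    then show "coeff (P I) 0 = 1" by (simp add: poly_0_coeff_0)
    fix n :: nat assume "n \<noteq> 0"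
    then obtain m where n: "n = Suc m" by (cases n) auto
    have "of_nat n * coeff (P I) n = fps_nth (fps_X * fps_deriv (fps_of_poly (P I))) n"
      by (simp add: n)
    also have "\<dots> = - (\<Sum>j=0..n. fps_nth (L I) j * coeff (P I) (n - j))"
      unfolding D by (subst mult.commute) (simp add: fps_mult_nth)
    also have "(\<Sum>j=0..n. fps_nth (L I) j * coeff (P I) (n - j)) = (\<Sum>j<n. (\<Sum>i\<in>I. a i ^ Suc j) * coeff (P I) (n - Suc j))"
      unfolding n by (subst sum.atLeast0_atMost_Suc_shift) (simp add: L_def atLeast0AtMost lessThan_Suc_atMost)
    finally show "of_nat n * coeff (P I) n = - (\<Sum>j<n. (\<Sum>i\<in>I. a i ^ Suc j) * coeff (P I) (n - Suc j))" .
  qed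
  have "(\<lambda>n. coeff (P I) n * Z ^ n) sums (\<Sum>n\<le>degree (P I). coeff (P I) n * Z ^ n)"
    by (rule sums_finite) (auto simp: coeff_eq_0)
  also have "(\<Sum>n\<le>degree (P I). coeff (P I) n * Z ^ n) = poly (P I) Z"
    by (simp add: poly_altdef)
  also have "poly (P I) Z = (\<Prod>i\<in>I. 1 - a i * Z)"
    by (simp add: P_def poly_prod mult.commute)
  finally show ?thesis unfolding c .
qed

section \<open>The Jacobi triple product\<close>

definition qpoch :: "real \<Rightarrow> nat \<Rightarrow> real" where
  "qpoch q n = (\<Prod>i<n. 1 - (q\<^sup>2) ^ Suc i)"

text \<open>Extending \<open>1 / qpoch q n\<close> by zero to negative \<open>n\<close> keeps its recurrence valid for all integers.\<close>

definition invpoch :: "real \<Rightarrow> int \<Rightarrow> real" where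
  "invpoch q k = (if k < 0 then 0 else 1 / qpoch q (nat k))"

lemma qpoch_factor_bounds:
  fixes q :: real
  assumes "0 < q" "q < 1"
  shows "0 < 1 - (q\<^sup>2) ^ Suc i" "1 - (q\<^sup>2) ^ Suc i \<le> 1"
proof -
  have "(q\<^sup>2) ^ Suc i < 1" using square_bounds[OF assms] by (subst power_less_one_iff) auto
  then show "0 < 1 - (q\<^sup>2) ^ Suc i" by linarith
  show "1 - (q\<^sup>2) ^ Suc i \<le> 1" by simp
qed

lemma qpoch_pos: "0 < q \<Longrightarrow> q < 1 \<Longrightarrow> 0 < qpoch q n"
  unfolding qpoch_def using qpoch_factor_bounds by (intro prod_pos) blast

lemma invpoch_rec:
  assumes q: "0 < q" "q < 1"
  shows "invpoch q (k - 1) = (1 - (q\<^sup>2) powi k) * invpoch q k"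
proof (cases "k \<le> 0")
  case True
  then show ?thesis by (cases "k = 0") (auto simp: invpoch_def)
next
  case False
  then obtain n where k: "k = int (Suc n)" by (metis not_le zero_less_imp_eq_int gr0_implies_Suc of_nat_0_less_iff)
  have "1 - (q\<^sup>2) ^ Suc n \<noteq> 0" using qpoch_factor_bounds[OF q, of n] by simp
  then show ?thesis
    unfolding k by (simp add: invpoch_def qpoch_def power_int_def nat_add_distrib del: power_Suc)
qed

lemma qpoch_tendsto:
  assumes q: "0 < q" "q < 1"
  obtains L where "0 < L" "qpoch q \<longlonglongrightarrow> L" "\<And>n. L \<le> qpoch q n"
proof -
  let ?f = "\<lambda>i. 1 - (q\<^sup>2) ^ Suc i"
  have "summable (\<lambda>i. norm (?f i - 1))"
    using square_bounds[OF q] by (simp add: summable_mult norm_mult norm_power)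
  then have "abs_convergent_prod ?f"
    by (rule summable_imp_abs_convergent_prod)
  then have c: "convergent_prod ?f"
    by (rule abs_convergent_prod_imp_convergent_prod)
  have nz: "?f i \<noteq> 0" for i using qpoch_factor_bounds[OF q, of i] by simp
  have lim: "qpoch q \<longlonglongrightarrow> prodinf ?f"
    unfolding qpoch_def[abs_def]
    using convergent_prod_LIMSEQ[OF c] LIMSEQ_lessThan_iff_atMost by blast
  have "decseq (qpoch q)"
  proof (rule decseq_SucI)
    show "qpoch q (Suc n) \<le> qpoch q n" for n
      using qpoch_pos[OF q, of n] qpoch_factor_bounds[OF q, of n]
        mult_left_mono[of "?f n" 1 "qpoch q n"]
      by (simp add: qpoch_def del: power_Suc)
  qed
  then have ge: "prodinf ?f \<le> qpoch q n" for n
    by (rule decseq_ge[OF _ lim])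
  have "prodinf ?f \<noteq> 0" by (rule prodinf_nonzero[OF c nz])
  moreover have "0 \<le> prodinf ?f"
    by (rule LIMSEQ_le_const[OF lim]) (use qpoch_pos[OF q] in \<open>auto intro: less_imp_le\<close>)
  ultimately show ?thesis using that[of "prodinf ?f"] lim ge by simp
qed

text \<open>For \<open>|k| \<le> N\<close> this is \<open>q^(k^2)\<close> times the Gaussian
  binomial coefficient of \<open>2 N\<close> over \<open>N + k\<close> to the base
  \<open>q^2\<close>.\<close>

definition tpcoef :: "real \<Rightarrow> nat \<Rightarrow> int \<Rightarrow> real" where
  "tpcoef q N k = qpoch q (2 * N) * q powi (k * k) * invpoch q (int N - k) * invpoch q (int N + k)"

text \<open>This is the effect on coefficients of the new factor
  \<open>1 + q^(4 N + 2) + q^(2 N + 1) (W + 1 / W)\<close>. Once everything is expressed by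
  \<open>A\<close> and \<open>B\<close>, it becomes the rational identity \<open>id\<close> in
  \<open>q\<close>, \<open>a = q^N\<close> and \<open>b = q^k\<close>.\<close>

lemma tpcoef_Suc:
  assumes q: "0 < q" "q < 1"
  shows "tpcoef q (Suc N) k = (1 + q ^ (4 * N + 2)) * tpcoef q N k + q ^ (2 * N + 1) * (tpcoef q N (k - 1) + tpcoef q N (k + 1))"
proof -
  define a b where "a = q ^ N" and "b = q powi k"
  \<comment> \<open>These are the values at the largest arguments that occur. The recurrence yields
    the smaller ones by multiplication, so factors that may vanish are never divided by.\<close>
  define A B where "A = invpoch q (int N + 1 - k)" and "B = invpoch q (int N + 1 + k)"
  have nz: "q \<noteq> 0" "b \<noteq> 0" using q by (auto simp: b_def)
  have sq: "(q\<^sup>2) powi m = (q powi m)\<^sup>2" for m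
    by (simp add: power_int_power' power_int_power mult.commute)
  have r1: "invpoch q (int N - k) = (1 - (a * q / b)\<^sup>2) * A"
    using invpoch_rec[OF q, of "int N + 1 - k"] nz
    by (simp add: A_def sq power_int_add power_int_diff a_def b_def)
  have r2: "invpoch q (int N + k) = (1 - (a * q * b)\<^sup>2) * B"
    using invpoch_rec[OF q, of "int N + 1 + k"] nz
    by (simp add: B_def sq power_int_add a_def b_def)
  have r3: "invpoch q (int N + (k - 1)) = (1 - (a * b)\<^sup>2) * ((1 - (a * q * b)\<^sup>2) * B)"
    using invpoch_rec[OF q, of "int N + k"] nz
    by (simp add: r2 sq power_int_add a_def b_def add_diff_eq)
  have r4: "invpoch q (int N - (k + 1)) = (1 - (a / b)\<^sup>2) * ((1 - (a * q / b)\<^sup>2) * A)"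
    using invpoch_rec[OF q, of "int N - k"] nz
    by (simp add: r1 sq power_int_diff a_def b_def diff_diff_eq)
  have r5: "invpoch q (int N - (k - 1)) = A" "invpoch q (int N + (k + 1)) = B"
    by (auto simp: A_def B_def algebra_simps)
  have p1: "q powi ((k - 1) * (k - 1)) = q powi (k * k) * q / b\<^sup>2"
  proof -
    have e: "(k - 1) * (k - 1) = k * k + 1 - (k + k)" by (simp add: algebra_simps)
    have "q powi (k * k + 1 - (k + k)) = q powi (k * k) * q powi 1 / (q powi k * q powi k)"
      using nz(1) by (simp only: power_int_diff power_int_add simp_thms)
    then show ?thesis unfolding e by (simp add: b_def power2_eq_square)
  qed
  have p2: "q powi ((k + 1) * (k + 1)) = q powi (k * k) * q * b\<^sup>2"
  proof -
    have e: "(k + 1) * (k + 1) = k * k + 1 + (k + k)" by (simp add: algebra_simps)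
    have "q powi (k * k + 1 + (k + k)) = q powi (k * k) * q powi 1 * (q powi k * q powi k)"
      using nz(1) by (simp only: power_int_add simp_thms)
    then show ?thesis unfolding e by (simp add: b_def power2_eq_square)
  qed
  have Q: "qpoch q (2 * Suc N) = qpoch q (2 * N) * ((1 - a ^ 4 * q\<^sup>2) * (1 - a ^ 4 * q ^ 4))"
  proof -
    have "(q\<^sup>2) ^ Suc (2 * N) = a ^ 4 * q\<^sup>2" "(q\<^sup>2) ^ Suc (Suc (2 * N)) = a ^ 4 * q ^ 4"
      unfolding a_def power_mult[symmetric] power_add[symmetric] by (rule arg_cong[where f = "\<lambda>n. q ^ n"], simp)+
    then show ?thesis by (simp add: qpoch_def del: power_Suc)
  qed
  have e: "q ^ (4 * N + 2) = a ^ 4 * q\<^sup>2" "q ^ (2 * N + 1) = a\<^sup>2 * q"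
    unfolding a_def power_mult[symmetric] by (simp_all add: power_add mult.commute power2_eq_square)
  have id: "(1 - a ^ 4 * q\<^sup>2) * (1 - a ^ 4 * q ^ 4)
     = (1 + a ^ 4 * q\<^sup>2) * ((1 - (a * q / b)\<^sup>2) * (1 - (a * q * b)\<^sup>2))
      + a\<^sup>2 * q * (q / b\<^sup>2 * ((1 - (a * b)\<^sup>2) * (1 - (a * q * b)\<^sup>2)) + q * b\<^sup>2 * ((1 - (a / b)\<^sup>2) * (1 - (a * q / b)\<^sup>2)))"
    using nz by (simp add: field_simps) algebra
  have "tpcoef q (Suc N) k = (qpoch q (2 * N) * q powi (k * k) * A * B) * ((1 - a ^ 4 * q\<^sup>2) * (1 - a ^ 4 * q ^ 4))"
    unfolding tpcoef_def Q by (simp add: A_def B_def algebra_simps)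
  also have "\<dots> = (1 + q ^ (4 * N + 2)) * tpcoef q N k + q ^ (2 * N + 1) * (tpcoef q N (k - 1) + tpcoef q N (k + 1))"
    unfolding tpcoef_def r1 r2 r3 r4 r5 p1 p2 e id by (simp add: algebra_simps add_divide_distrib)
  finally show ?thesis .
qed

definition tpprod :: "real \<Rightarrow> nat \<Rightarrow> complex \<Rightarrow> complex" where
  "tpprod q N W = (\<Prod>j<N. (1 + of_real q ^ (2 * j + 1) * W) * (1 + of_real q ^ (2 * j + 1) / W))"

lemma triple_product_finite:
  assumes q: "0 < q" "q < 1" and W: "W \<noteq> 0"
  shows "((\<lambda>k. of_real (tpcoef q N k) * W powi k) has_sum tpprod q N W) UNIV"
proof (induction N)
  case 0
  have "of_real (tpcoef q 0 k) * W powi k = 0" if "k \<noteq> 0" for k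
    using that by (cases "k < 0") (auto simp: tpcoef_def invpoch_def)
  then have "((\<lambda>k. of_real (tpcoef q 0 k) * W powi k) has_sum tpprod q 0 W) UNIV
      \<longleftrightarrow> ((\<lambda>k. of_real (tpcoef q 0 k) * W powi k) has_sum tpprod q 0 W) {0}"
    by (intro has_sum_cong_neutral) auto
  moreover have "((\<lambda>k. of_real (tpcoef q 0 k) * W powi k) has_sum tpprod q 0 W) {0}"
    by (intro has_sum_finiteI) (auto simp: tpcoef_def invpoch_def qpoch_def tpprod_def)
  ultimately show ?case by blast
next
  case (Suc N)
  let ?f = "\<lambda>N k. of_real (tpcoef q N k) * W powi k"
  have b1: "bij_betw (\<lambda>k::int. k - 1) UNIV UNIV" "bij_betw (\<lambda>k::int. k + 1) UNIV UNIV"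
    by (rule bij_betwI[where g = "\<lambda>k. k + 1"], auto) (rule bij_betwI[where g = "\<lambda>k. k - 1"], auto)
  have s1: "((\<lambda>k. ?f N (k - 1)) has_sum tpprod q N W) UNIV"
    using has_sum_reindex_bij_betw[OF b1(1), of "?f N"] Suc by blast
  have s2: "((\<lambda>k. ?f N (k + 1)) has_sum tpprod q N W) UNIV"
    using has_sum_reindex_bij_betw[OF b1(2), of "?f N"] Suc by blast
  have "((\<lambda>k. of_real (1 + q ^ (4 * N + 2)) * ?f N k + (of_real (q ^ (2 * N + 1)) * W * ?f N (k - 1) + of_real (q ^ (2 * N + 1)) / W * ?f N (k + 1)))
      has_sum of_real (1 + q ^ (4 * N + 2)) * tpprod q N W + (of_real (q ^ (2 * N + 1)) * W * tpprod q N W + of_real (q ^ (2 * N + 1)) / W * tpprod q N W)) UNIV"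
    by (intro has_sum_add has_sum_cmult_right Suc s1 s2)
  moreover have "of_real (1 + q ^ (4 * N + 2)) * ?f N k + (of_real (q ^ (2 * N + 1)) * W * ?f N (k - 1) + of_real (q ^ (2 * N + 1)) / W * ?f N (k + 1)) = ?f (Suc N) k" for k
  proof -
    have e: "W powi (k - 1) = W powi k / W" "W powi (k + 1) = W powi k * W"
      using W by (auto simp: power_int_diff power_int_add)
    show ?thesis
      unfolding tpcoef_Suc[OF q] e using W by (simp add: algebra_simps)
  qed
  moreover have "of_real (1 + q ^ (4 * N + 2)) * tpprod q N W + (of_real (q ^ (2 * N + 1)) * W * tpprod q N W + of_real (q ^ (2 * N + 1)) / W * tpprod q N W)
      = tpprod q (Suc N) W"
  proof -
    define x :: complex where "x = of_real q ^ (2 * N + 1)"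
    have e: "(of_real (q ^ (4 * N + 2)) :: complex) = x * x" "(of_real (q ^ (2 * N + 1)) :: complex) = x"
      unfolding x_def power_add[symmetric] by simp_all
    have "tpprod q (Suc N) W = tpprod q N W * ((1 + x * W) * (1 + x / W))"
      by (simp add: tpprod_def x_def)
    also have "(1 + x * W) * (1 + x / W) = 1 + x * x + (x * W + x / W)"
      using W by (simp add: field_simps)
    finally show ?thesis unfolding of_real_add of_real_1 e by (simp add: algebra_simps)
  qed
  ultimately show ?case by simp
qed

definition thetaW :: "real \<Rightarrow> complex \<Rightarrow> complex" where
  "thetaW q W = (\<Sum>\<^sub>\<infinity>k. of_real (q powi (k * k)) * W powi k)"

lemma summable_on_gaussian:
  fixes q r :: real
  assumes q: "0 < q" "q < 1" and r: "0 < r"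
  shows "(\<lambda>k::int. q powi (k * k) * r powi k) summable_on UNIV"
proof (rule summable_on_intI)
  have *: "(\<lambda>n::nat. q ^ (n * n) * r ^ n) summable_on UNIV" if r: "0 < r" for r
  proof -
    have "summable (\<lambda>n::nat. q ^ (n * n) * r ^ n)"
    proof (rule summable_comparison_test_ev)
      show "summable (\<lambda>n. (1 / 2 :: real) ^ n)" by (intro summable_geometric) auto
      have "(\<lambda>n. q ^ n * r) \<longlonglongrightarrow> 0 * r"
        using q by (intro tendsto_mult LIMSEQ_power_zero tendsto_const) auto
      then have "\<forall>\<^sub>F n in sequentially. q ^ n * r < 1 / 2"
        by (intro order_tendstoD(2)) auto
      then show "\<forall>\<^sub>F n in sequentially. norm (q ^ (n * n) * r ^ n) \<le> (1 / 2) ^ n"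
      proof eventually_elim
        case (elim n)
        have "norm (q ^ (n * n) * r ^ n) = (q ^ n * r) ^ n"
          using q r by (simp add: power_mult power_mult_distrib)
        also have "\<dots> \<le> (1 / 2) ^ n" using elim q r by (intro power_mono) auto
        finally show ?case .
      qed
    qed
    then show ?thesis using q r by (subst summable_on_UNIV_nonneg_real_iff) auto
  qed
  show "(\<lambda>n. q powi (int n * int n) * r powi int n) summable_on UNIV"
    using *[OF r] by (simp add: of_nat_mult[symmetric] del: of_nat_mult)
  have "(\<lambda>n::nat. q ^ (n * n) * (1 / r) ^ n) summable_on UNIV" using * r by simp
  then show "(\<lambda>n. q powi (- int n * - int n) * r powi - int n) summable_on UNIV"
    by (simp add: of_nat_mult[symmetric] power_int_minus power_divide inverse_eq_divide del: of_nat_mult)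
qed

lemma norm_thetaW_term:
  fixes q :: real and W :: complex
  assumes "0 < q"
  shows "norm (of_real (q powi (k * k)) * W powi k) = q powi (k * k) * norm W powi k"
  using assms by (simp add: norm_mult norm_power_int)

lemma thetaW_has_sum:
  assumes q: "0 < q" "q < 1" and W: "W \<noteq> 0"
  shows "((\<lambda>k. of_real (q powi (k * k)) * W powi k) has_sum thetaW q W) UNIV"
  unfolding thetaW_def
proof (rule has_sum_infsum, rule abs_summable_summable)
  show "(\<lambda>k. norm (of_real (q powi (k * k)) * W powi k)) summable_on UNIV"
    unfolding norm_thetaW_term[OF q(1)] using summable_on_gaussian[OF q, of "norm W"] W by simp
qed

text \<open>The bound \<open>1 / L\<close> for \<open>invpoch\<close> provides the majorant for
  Tannery's theorem. The constant stays anonymous because it cancels in the quotient by the value at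
  \<open>W = 1\<close>.\<close>

lemma triple_product:
  assumes q: "0 < q" "q < 1"
  obtains C where "C \<noteq> 0" "\<And>W. W \<noteq> 0 \<Longrightarrow> (\<lambda>N. tpprod q N W) \<longlonglongrightarrow> C * thetaW q W"
proof -
  obtain L where L: "0 < L" "qpoch q \<longlonglongrightarrow> L" "\<And>n. L \<le> qpoch q n"
    using qpoch_tendsto[OF q] by blast
  have iv: "0 \<le> invpoch q k" "invpoch q k \<le> 1 / L" for k
    using L(1) L(3)[of "nat k"] qpoch_pos[OF q, of "nat k"] by (auto simp: invpoch_def frac_le less_imp_le)
  have lim: "(\<lambda>N. invpoch q (int N + k)) \<longlonglongrightarrow> 1 / L" for k
  proof -
    have "filterlim (\<lambda>N. nat (int N + k)) at_top sequentially"
      unfolding filterlim_at_top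
    proof
      fix Z
      show "\<forall>\<^sub>F N in sequentially. Z \<le> nat (int N + k)"
        using eventually_ge_at_top[of "nat (int Z - k)"] by eventually_elim auto
    qed
    then have "(\<lambda>N. 1 / qpoch q (nat (int N + k))) \<longlonglongrightarrow> 1 / L"
      by (intro tendsto_divide tendsto_const filterlim_compose[OF L(2)]) (use L(1) in auto)
    moreover have "\<forall>\<^sub>F N in sequentially. 1 / qpoch q (nat (int N + k)) = invpoch q (int N + k)"
      using eventually_ge_at_top[of "nat (- k)"] by eventually_elim (auto simp: invpoch_def)
    ultimately show ?thesis by (rule Lim_transform_eventually)
  qed
  have main: "(\<lambda>N. tpprod q N W) \<longlonglongrightarrow> of_real (1 / L) * thetaW q W" if W: "W \<noteq> 0" for W
  proof -
    define e where "e = int_decode"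
    have e: "bij_betw e UNIV UNIV" unfolding e_def by (rule bij_int_decode)
    define g where "g = (\<lambda>k. of_real (q powi (k * k)) * W powi k)"
    define a where "a = (\<lambda>i N. of_real (invpoch q (int N - e i) * invpoch q (int N + e i)) * g (e i))"
    have sg: "summable (\<lambda>i. norm (g (e i)))"
    proof -
      have "(\<lambda>k. norm (g k)) summable_on UNIV"
        unfolding g_def norm_thetaW_term[OF q(1)] using summable_on_gaussian[OF q, of "norm W"] W by simp
      then have "(\<lambda>i. norm (g (e i))) summable_on UNIV"
        by (subst summable_on_reindex_bij_betw[OF e])
      then show ?thesis by (rule summable_on_imp_summable)
    qed
    have "eventually (\<lambda>N. summable (\<lambda>i. norm (a i N))) sequentially \<and>
        summable (\<lambda>i. norm (of_real (1 / L * (1 / L)) * g (e i))) \<and>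
        ((\<lambda>N. \<Sum>i. a i N) \<longlongrightarrow> (\<Sum>i. of_real (1 / L * (1 / L)) * g (e i))) sequentially"
    proof (rule tannerys_theorem)
      show "(\<lambda>N. a i N) \<longlonglongrightarrow> of_real (1 / L * (1 / L)) * g (e i)" for i
        unfolding a_def using lim[of "- e i"] lim[of "e i"]
        by (intro tendsto_mult tendsto_of_real tendsto_const) auto
      show "summable (\<lambda>i. 1 / L * (1 / L) * norm (g (e i)))"
        by (rule summable_mult[OF sg])
      have "norm (a i N) \<le> 1 / L * (1 / L) * norm (g (e i))" for i N
      proof -
        have "norm (a i N) = (invpoch q (int N - e i) * invpoch q (int N + e i)) * norm (g (e i))"
          unfolding a_def using iv by (simp add: norm_mult)
        also have "\<dots> \<le> 1 / L * (1 / L) * norm (g (e i))"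
          using iv L(1) by (intro mult_right_mono mult_mono) auto
        finally show ?thesis .
      qed
      then show "\<forall>\<^sub>F (i, N) in at_top \<times>\<^sub>F sequentially. norm (a i N) \<le> 1 / L * (1 / L) * norm (g (e i))"
        by (intro always_eventually) auto
    qed simp
    then have t: "(\<lambda>N. \<Sum>i. a i N) \<longlonglongrightarrow> (\<Sum>i. of_real (1 / L * (1 / L)) * g (e i))" by blast
    have "((\<lambda>i. g (e i)) has_sum thetaW q W) UNIV"
      using thetaW_has_sum[OF q W] unfolding g_def by (subst has_sum_reindex_bij_betw[OF e])
    then have "(\<lambda>i. of_real (1 / L * (1 / L)) * g (e i)) sums (of_real (1 / L * (1 / L)) * thetaW q W)"
      by (intro sums_mult has_sum_imp_sums)
    then have r: "(\<Sum>i. of_real (1 / L * (1 / L)) * g (e i)) = of_real (1 / L * (1 / L)) * thetaW q W"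
      by (rule sums_unique[symmetric])
    have l: "tpprod q N W = of_real (qpoch q (2 * N)) * (\<Sum>i. a i N)" for N
    proof -
      have qn: "qpoch q (2 * N) \<noteq> 0" using qpoch_pos[OF q, of "2 * N"] by simp
      have "((\<lambda>i. of_real (tpcoef q N (e i)) * W powi e i) has_sum tpprod q N W) UNIV"
        using triple_product_finite[OF q W, of N] by (subst has_sum_reindex_bij_betw[OF e])
      then have "(\<lambda>i. of_real (tpcoef q N (e i)) * W powi e i) sums tpprod q N W"
        by (rule has_sum_imp_sums)
      moreover have "of_real (tpcoef q N (e i)) * W powi e i = of_real (qpoch q (2 * N)) * a i N" for i
        by (simp add: tpcoef_def a_def g_def)
      ultimately have "(\<lambda>i. of_real (qpoch q (2 * N)) * a i N) sums tpprod q N W" by simp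
      then have "(\<lambda>i. a i N) sums (tpprod q N W / of_real (qpoch q (2 * N)))"
        using sums_mult_iff[of "of_real (qpoch q (2 * N)) :: complex" "\<lambda>i. a i N" "tpprod q N W / of_real (qpoch q (2 * N))"] qn by simp
      then show ?thesis using qn by (simp add: sums_iff)
    qed
    have "strict_mono (\<lambda>N::nat. 2 * N)" by (simp add: strict_mono_def)
    then have "(\<lambda>N. qpoch q (2 * N)) \<longlonglongrightarrow> L"
      using filterlim_compose[OF L(2) filterlim_subseq] by blast
    then have "(\<lambda>N. of_real (qpoch q (2 * N)) * (\<Sum>i. a i N)) \<longlonglongrightarrow> of_real L * (of_real (1 / L * (1 / L)) * thetaW q W)"
      unfolding r[symmetric] by (intro tendsto_mult tendsto_of_real t)
    moreover have "of_real L * (of_real (1 / L * (1 / L)) * thetaW q W) = of_real (1 / L) * thetaW q W"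
      using L(1) by simp
    ultimately show ?thesis unfolding l by simp
  qed
  show ?thesis
    by (rule that[of "of_real (1 / L)"]) (use L(1) main in auto)
qed

section \<open>Zeros of the theta function for the nome exp(-pi)\<close>

lemma powi_square_eq: "(q::real) powi (k * k) = q ^ nat (k\<^sup>2)"
  by (simp add: power_int_def power2_eq_square)

lemma exp_i_powi: "exp (2 * \<i> * z) powi k = exp (2 * \<i> * of_int k * z)"
  by (simp add: exp_power_int mult_ac)

text \<open>Expanding the exponentials and exchanging the sums leaves the moments of the weights
  \<open>q^(k^2)\<close>: the odd ones vanish under \<open>k \<mapsto> - k\<close>, the even ones
  are the \<open>theta j\<close>. Thus the derivatives of the theta constant are the Taylor
  coefficients of the theta function.\<close>

lemma thetaW_series:
  assumes q: "0 < q" "q < 1"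
  shows "(\<lambda>j. (-1) ^ j * of_real (theta j q) * (2 * z) ^ (2 * j) / fact (2 * j)) sums thetaW q (exp (2 * \<i> * z))"
proof -
  define f :: "int \<times> nat \<Rightarrow> complex" where
    "f = (\<lambda>(k, n). of_real (q powi (k * k)) * ((2 * \<i> * of_int k * z) ^ n / fact n))"
  define r where "r = exp (2 * norm z)"
  have inner: "((\<lambda>n. f (k, n)) has_sum of_real (q powi (k * k)) * exp (2 * \<i> * z) powi k) UNIV" for k
  proof -
    have "(\<lambda>n. (2 * \<i> * of_int k * z) ^ n / fact n) sums exp (2 * \<i> * of_int k * z)"
      using exp_converges[of "2 * \<i> * of_int k * z"] by (simp add: scaleR_conv_of_real field_simps)
    moreover have "summable (\<lambda>n. norm ((2 * \<i> * of_int k * z) ^ n / fact n))"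
      using summable_norm_exp[of "2 * \<i> * of_int k * z"] by (simp add: norm_divide norm_power norm_mult norm_inverse divide_inverse mult_ac)
    ultimately have "((\<lambda>n. (2 * \<i> * of_int k * z) ^ n / fact n) has_sum exp (2 * \<i> * of_int k * z)) UNIV"
      by (intro norm_summable_imp_has_sum)
    from has_sum_cmult_right[OF this, of "of_real (q powi (k * k))"] show ?thesis
      unfolding exp_i_powi f_def by simp
  qed
  have innern: "((\<lambda>n. norm (f (k, n))) has_sum q powi (k * k) * exp (2 * \<bar>real_of_int k\<bar> * norm z)) UNIV" for k
  proof -
    have "(\<lambda>n. (2 * \<bar>real_of_int k\<bar> * norm z) ^ n / fact n) sums exp (2 * \<bar>real_of_int k\<bar> * norm z)"
      using exp_converges[of "2 * \<bar>real_of_int k\<bar> * norm z"] by (simp add: field_simps)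
    then have "((\<lambda>n. (2 * \<bar>real_of_int k\<bar> * norm z) ^ n / fact n) has_sum exp (2 * \<bar>real_of_int k\<bar> * norm z)) UNIV"
      by (intro norm_summable_imp_has_sum) (auto simp: sums_iff)
    from has_sum_cmult_right[OF this, of "q powi (k * k)"] show ?thesis
      using q by (simp add: f_def norm_mult norm_divide norm_power norm_power_int)
  qed
  have "(\<lambda>k::int. q powi (k * k) * r powi k + q powi (k * k) * (1 / r) powi k) summable_on UNIV"
    using q by (intro summable_on_add summable_on_gaussian) (auto simp: r_def)
  then have out: "(\<lambda>k::int. q powi (k * k) * exp (2 * \<bar>real_of_int k\<bar> * norm z)) summable_on UNIV"
  proof (rule summable_on_comparison_test)
    fix k :: int
    have "exp (2 * \<bar>real_of_int k\<bar> * norm z) \<le> r powi k + (1 / r) powi k"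
    proof -
      have "r powi k = exp (2 * real_of_int k * norm z)" "(1 / r) powi k = exp (- (2 * real_of_int k * norm z))"
        unfolding r_def by (simp_all add: exp_power_int power_int_divide_distrib exp_minus inverse_eq_divide mult_ac)
      then show ?thesis by (cases "k \<ge> 0") auto
    qed
    from mult_left_mono[OF this, of "q powi (k * k)"] q
    show "q powi (k * k) * exp (2 * \<bar>real_of_int k\<bar> * norm z) \<le> q powi (k * k) * r powi k + q powi (k * k) * (1 / r) powi k"
      by (simp add: distrib_left)
  qed (use q in auto)
  have "(\<lambda>x. norm (f x)) summable_on UNIV \<times> UNIV"
  proof (subst Infinite_Sum.abs_summable_on_Sigma_iff, intro conjI ballI)
    show "(\<lambda>n. norm (f (k, n))) summable_on UNIV" for k
      using innern by (rule has_sum_imp_summable)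
    have "norm (infsum (\<lambda>n. norm (f (k, n))) UNIV) = q powi (k * k) * exp (2 * \<bar>real_of_int k\<bar> * norm z)" for k
      using infsumI[OF innern[of k]] q by simp
    then show "(\<lambda>k. norm (infsum (\<lambda>n. norm (f (k, n))) UNIV)) summable_on UNIV"
      using out by simp
  qed
  then have sf: "f summable_on UNIV \<times> UNIV" by (rule abs_summable_summable)
  have tot: "(f has_sum thetaW q (exp (2 * \<i> * z))) (UNIV \<times> UNIV)"
    by (rule has_sum_SigmaI[OF inner thetaW_has_sum[OF q] sf]) simp
  have bij: "bij_betw (\<lambda>x :: nat \<times> int. (snd x, fst x)) (UNIV \<times> UNIV) (UNIV \<times> UNIV)"
    by (rule bij_betwI[where g = "\<lambda>x. (snd x, fst x)"]) auto
  have tot': "((\<lambda>x :: nat \<times> int. f (snd x, fst x)) has_sum thetaW q (exp (2 * \<i> * z))) (UNIV \<times> UNIV)"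
    using tot by (subst has_sum_reindex_bij_betw[OF bij])
  define g where "g = (\<lambda>n. if even n then (2 * \<i> * z) ^ n / fact n * of_real (theta (n div 2) q) else 0)"
  have "(g has_sum thetaW q (exp (2 * \<i> * z))) UNIV"
  proof (rule has_sum_SigmaD[OF tot'])
    fix n :: nat
    have "((\<lambda>k. f (k, n)) has_sum g n) UNIV"
    proof (cases "even n")
      case True
      then have n: "2 * (n div 2) = n" by simp
      have "((\<lambda>k. of_real (real_of_int k ^ (2 * (n div 2)) * q ^ nat (k\<^sup>2))) has_sum (of_real (theta (n div 2) q) :: complex)) UNIV"
        using theta_has_sum[of q "n div 2"] q by (subst has_sum_of_real_iff) auto
      from has_sum_cmult_right[OF this, of "(2 * \<i> * z) ^ n / fact n"]
      show ?thesis
        unfolding n using True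
        by (simp add: f_def g_def powi_square_eq power_mult_distrib mult_ac)
    next
      case False
      have s: "(\<lambda>k. f (k, n)) summable_on UNIV"
      proof -
        have "(\<lambda>(n, k). f (k, n)) summable_on UNIV \<times> UNIV"
          using has_sum_imp_summable[OF tot'] by (simp add: case_prod_unfold)
        then show ?thesis by (rule summable_on_SigmaD1) simp
      qed
      have b: "bij_betw uminus (UNIV :: int set) UNIV"
        by (rule bij_betwI[where g = uminus]) auto
      have "infsum (\<lambda>k. f (k, n)) UNIV = infsum (\<lambda>k. f (- k, n)) UNIV"
        using infsum_reindex_bij_betw[OF b, of "\<lambda>k. f (k, n)"] by simp
      also have "\<dots> = infsum (\<lambda>k. - f (k, n)) UNIV"
      proof -
        have "(- (2 * \<i> * of_int k * z)) ^ n = - ((2 * \<i> * of_int k * z) ^ n)" for k :: int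
          using False by simp
        then have "f (- k, n) = - f (k, n)" for k by (simp add: f_def)
        then show ?thesis by simp
      qed
      also have "\<dots> = - infsum (\<lambda>k. f (k, n)) UNIV" by (rule infsum_uminus)
      finally have "infsum (\<lambda>k. f (k, n)) UNIV = 0" by simp
      then show ?thesis using has_sum_infsum[OF s] False by (simp add: g_def)
    qed
    then show "((\<lambda>y. f (snd (n, y), fst (n, y))) has_sum g n) UNIV" by simp
  qed
  then have "(g has_sum thetaW q (exp (2 * \<i> * z))) (range (\<lambda>j. 2 * j))"
    by (rule has_sum_cong_neutral[THEN iffD1, rotated -1]) (auto simp: g_def elim!: evenE)
  then have "((\<lambda>j. g (2 * j)) has_sum thetaW q (exp (2 * \<i> * z))) UNIV"
    by (subst (asm) has_sum_reindex) (auto simp: inj_on_def o_def)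
  moreover have "g (2 * j) = (-1) ^ j * of_real (theta j q) * (2 * z) ^ (2 * j) / fact (2 * j)" for j
  proof -
    have "(2 * \<i> * z) ^ (2 * j) = (- 1 * (2 * z)\<^sup>2) ^ j"
      unfolding power_mult by (rule arg_cong[where f = "\<lambda>x. x ^ j"]) (simp add: power_mult_distrib)
    also have "\<dots> = (-1) ^ j * (2 * z) ^ (2 * j)"
      unfolding power_mult by (rule power_mult_distrib)
    finally have "(2 * \<i> * z) ^ (2 * j) = (-1) ^ j * (2 * z) ^ (2 * j)" .
    then show ?thesis by (simp add: g_def)
  qed
  ultimately show ?thesis using has_sum_imp_sums by fastforce
qed

lemma thetaW_1:
  assumes q: "0 < q" "q < 1"
  shows "thetaW q 1 = of_real (theta 0 q)"
proof -
  have "((\<lambda>k. of_real (real_of_int k ^ (2 * 0) * q ^ nat (k\<^sup>2)) :: complex) has_sum of_real (theta 0 q)) UNIV"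
    using theta_has_sum[of q 0] q by (subst has_sum_of_real_iff) auto
  then have "((\<lambda>k. of_real (q powi (k * k)) * 1 powi k :: complex) has_sum of_real (theta 0 q)) UNIV"
    by (simp add: powi_square_eq)
  with thetaW_has_sum[OF q, of 1] show ?thesis by (intro has_sum_unique) auto
qed

text \<open>Coefficients of \<open>theta(t) theta(i t)\<close> in powers of \<open>(2 t)^2\<close>;
  turning the argument by \<open>i\<close> removes the alternating sign from one of the two
  factors.\<close>

definition thetacauchy :: "real \<Rightarrow> nat \<Rightarrow> real" where
  "thetacauchy q n = (\<Sum>j\<le>n. (-1) ^ j * (theta j q / fact (2 * j)) * (theta (n - j) q / fact (2 * (n - j))))"

lemma thetaW_product:
  fixes t :: real
  assumes q: "0 < q" "q < 1"
  shows "(\<lambda>n. of_real (thetacauchy q n * ((2 * t)\<^sup>2) ^ n) :: complex) sums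
     (thetaW q (exp (2 * \<i> * of_real t)) * thetaW q (exp (2 * \<i> * (\<i> * of_real t))))"
proof -
  let ?a = "\<lambda>j. of_real ((-1) ^ j * (theta j q / fact (2 * j)) * ((2 * t)\<^sup>2) ^ j) :: complex"
  let ?b = "\<lambda>j. of_real ((theta j q / fact (2 * j)) * ((2 * t)\<^sup>2) ^ j) :: complex"
  have a: "?a sums thetaW q (exp (2 * \<i> * of_real t))"
    using thetaW_series[OF q, of "of_real t"] by (simp add: power_mult)
  have b: "?b sums thetaW q (exp (2 * \<i> * (\<i> * of_real t)))"
  proof -
    have "(-1) ^ j * of_real (theta j q) * (2 * (\<i> * of_real t)) ^ (2 * j) / fact (2 * j) = ?b j" for j
    proof -
      have "(2 * (\<i> * of_real t)) ^ (2 * j) = (- 1 * (of_real ((2 * t)\<^sup>2))) ^ j"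
        unfolding power_mult by (rule arg_cong[where f = "\<lambda>x. x ^ j"]) (simp add: power_mult_distrib)
      also have "\<dots> = ((-1) ^ j * of_real (((2 * t)\<^sup>2) ^ j) :: complex)"
        by (simp only: power_mult_distrib[of "- 1"] of_real_power)
      finally have "(2 * (\<i> * of_real t)) ^ (2 * j) = ((-1) ^ j * of_real (((2 * t)\<^sup>2) ^ j) :: complex)" .
      moreover have "(-1) ^ j * ((-1) ^ j * x) = (x :: complex)" for x
        by (simp add: mult.assoc[symmetric] flip: power_add)
      ultimately show ?thesis by (simp add: mult.commute mult.left_commute)
    qed
    then show ?thesis using thetaW_series[OF q, of "\<i> * of_real t"] by (simp only:)
  qed
  have nb: "norm (?b j) = (theta j q / fact (2 * j)) * ((2 * t)\<^sup>2) ^ j" for j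
    unfolding norm_of_real using theta_nonneg[of q j] q by simp
  have na: "norm (?a j) = norm (?b j)" for j
    unfolding norm_of_real by (simp add: abs_mult)
  have "summable (\<lambda>j. norm (?b j))"
  proof -
    have "summable ?b" using b by (rule sums_summable)
    then have "summable (\<lambda>j. Re (?b j))" by (rule summable_Re)
    then show ?thesis unfolding nb by (simp only: Re_complex_of_real)
  qed
  then have "(\<lambda>n. \<Sum>i\<le>n. ?a i * ?b (n - i)) sums ((\<Sum>j. ?a j) * (\<Sum>j. ?b j))"
    by (intro Cauchy_product_sums) (simp_all only: na)
  moreover have "(\<Sum>i\<le>n. ?a i * ?b (n - i)) = of_real (thetacauchy q n * ((2 * t)\<^sup>2) ^ n)" for n
  proof -
    have "(\<Sum>i\<le>n. ?a i * ?b (n - i)) = of_real (\<Sum>i\<le>n. ((-1) ^ i * (theta i q / fact (2 * i)) * (theta (n - i) q / fact (2 * (n - i)))) * (((2 * t)\<^sup>2) ^ i * ((2 * t)\<^sup>2) ^ (n - i)))"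
      by (simp only: of_real_mult[symmetric] of_real_sum[symmetric] mult_ac)
    also have "(\<Sum>i\<le>n. ((-1) ^ i * (theta i q / fact (2 * i)) * (theta (n - i) q / fact (2 * (n - i)))) * (((2 * t)\<^sup>2) ^ i * ((2 * t)\<^sup>2) ^ (n - i)))
       = thetacauchy q n * ((2 * t)\<^sup>2) ^ n"
      unfolding thetacauchy_def sum_distrib_right
      by (intro sum.cong refl) (simp only: power_add[symmetric] atMost_iff le_add_diff_inverse)
    finally show ?thesis .
  qed
  ultimately show ?thesis
    using a b by (simp only: sums_iff)
qed

lemma thetacauchy_even: "thetacauchy q (2 * p) = thetaform p q / fact (4 * p)"
  unfolding thetacauchy_def thetaform_def sum_divide_distrib
proof (intro sum.cong refl)
  fix j assume "j \<in> {..2 * p}"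
  then have "real (4 * p choose (2 * j)) = fact (4 * p) / (fact (2 * j) * fact (2 * (2 * p - j)))"
    using binomial_fact[of "2 * j" "4 * p", where 'a = real] by (simp add: diff_mult_distrib2)
  then show "(- 1) ^ j * (theta j q / fact (2 * j)) * (theta (2 * p - j) q / fact (2 * (2 * p - j))) =
      (- 1) ^ j * real (4 * p choose (2 * j)) * theta j q * theta (2 * p - j) q / fact (4 * p)"
    by simp
qed

section \<open>Theta quotients as products over rows of odd Gaussian integers\<close>

lemma cos_product:
  fixes v :: complex
  assumes v: "Im v \<noteq> 0"
  shows "(\<lambda>M. \<Prod>m<M. 1 - (2 * v)\<^sup>2 / of_nat (2 * m + 1) ^ 2) \<longlonglongrightarrow> cos (of_real pi * v)"
proof -
  let ?S = "\<lambda>z n. of_real pi * z * (\<Prod>k=1..n. 1 - z\<^sup>2 / of_nat k ^ 2) :: complex"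
  let ?Q = "\<lambda>M. \<Prod>m<M. 1 - (2 * v)\<^sup>2 / of_nat (2 * m + 1) ^ 2"
  have s0: "sin (of_real pi * v) \<noteq> 0"
  proof
    assume "sin (of_real pi * v) = 0"
    then obtain n :: int where "of_real pi * v = of_real (n * pi)" by (auto simp: sin_eq_0)
    then have "Im (of_real pi * v) = 0" by (metis Im_complex_of_real)
    then show False using v by simp
  qed
  \<comment> \<open>The even factors of the sine product for \<open>2 v\<close> form the sine
    product for \<open>v\<close>; the odd ones remain for the cosine, by
    \<open>sin (2 x) = 2 sin x cos x\<close>. The hypothesis on \<open>v\<close> keeps the divisor
    \<open>sin (pi v)\<close> away from 0.\<close>
  have split: "(\<Prod>k=1..2 * M. 1 - (2 * v)\<^sup>2 / of_nat k ^ 2) = (\<Prod>k=1..M. 1 - v\<^sup>2 / of_nat k ^ 2) * ?Q M" for M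
  proof (induction M)
    case (Suc M)
    have "(2 * v)\<^sup>2 / of_nat (2 * M + 2) ^ 2 = v\<^sup>2 / of_nat (Suc M) ^ 2"
    proof -
      have "of_nat (2 * M + 2) = (2 :: complex) * of_nat (Suc M)" by simp
      then show ?thesis by (simp only: power_mult_distrib mult_divide_mult_cancel_left_if) simp
    qed
    then show ?case using Suc by (simp add: mult_ac)
  qed simp
  have l1: "(\<lambda>M. ?S (2 * v) (2 * M)) \<longlonglongrightarrow> sin (of_real pi * (2 * v))"
  proof -
    have "strict_mono (\<lambda>M::nat. 2 * M)" by (simp add: strict_mono_def)
    from filterlim_compose[OF sin_product_formula_complex[of "2 * v"] filterlim_subseq[OF this]]
    show ?thesis .
  qed
  have "(\<lambda>M. ?S (2 * v) (2 * M) / (2 * ?S v M)) \<longlonglongrightarrow> sin (of_real pi * (2 * v)) / (2 * sin (of_real pi * v))"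
    using s0 by (intro tendsto_divide l1 tendsto_mult[OF tendsto_const] sin_product_formula_complex) auto
  moreover have "sin (of_real pi * (2 * v)) / (2 * sin (of_real pi * v)) = cos (of_real pi * v)"
    using sin_double[of "of_real pi * v"] s0 by (simp add: mult_ac)
  moreover have "\<forall>\<^sub>F M in sequentially. ?S (2 * v) (2 * M) / (2 * ?S v M) = ?Q M"
  proof -
    have "\<forall>\<^sub>F M in sequentially. ?S v M \<noteq> 0"
      by (rule tendsto_imp_eventually_ne[OF sin_product_formula_complex s0])
    moreover have "?S (2 * v) (2 * M) = 2 * ?S v M * ?Q M" for M
      unfolding split by (simp only: mult_ac)
    ultimately show ?thesis by (auto elim!: eventually_mono)
  qed
  ultimately show ?thesis using Lim_transform_eventually by force
qed

text \<open>Closed form of the product over the odd Gaussian integers with imaginary part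
  \<open>2 n + 1\<close> or its negative, normalized to 1 at \<open>u = 0\<close>.\<close>

definition rowratio :: "complex \<Rightarrow> nat \<Rightarrow> complex" where
  "rowratio u n = cos (of_real pi * ((u + \<i> * of_nat (2 * n + 1)) / 2)) * cos (of_real pi * ((u - \<i> * of_nat (2 * n + 1)) / 2))
     / (cos (of_real pi * (\<i> * of_nat (2 * n + 1) / 2)) * cos (of_real pi * (- \<i> * of_nat (2 * n + 1) / 2)))"

lemma cos_i_nonzero: "cos (of_real pi * (\<i> * of_nat n / 2)) \<noteq> 0" "cos (of_real pi * (- \<i> * of_nat n / 2)) \<noteq> 0"
proof -
  have "cos (of_real pi * (\<i> * of_nat n / 2)) = cos (\<i> * of_real (pi * real n / 2))" by (simp add: mult_ac)
  also have "\<dots> = of_real (cosh (pi * real n / 2))"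
    unfolding cosh_conv_cos[symmetric] by (simp add: cosh_def scaleR_conv_of_real exp_of_real[symmetric])
  finally have e: "cos (of_real pi * (\<i> * of_nat n / 2)) = of_real (cosh (pi * real n / 2))" .
  show 1: "cos (of_real pi * (\<i> * of_nat n / 2)) \<noteq> 0" unfolding e by (simp del: of_real_eq_0_iff add: of_real_eq_0_iff)
  have "of_real pi * (- \<i> * of_nat n / 2) = - (of_real pi * (\<i> * of_nat n / 2))" by simp
  then show "cos (of_real pi * (- \<i> * of_nat n / 2)) \<noteq> 0" using 1 by (metis cos_minus)
qed

text \<open>The four linear factors are regrouped:
  \<open>(y^2 - (u + i x)^2) (y^2 - (u - i x)^2)\<close> equals
  \<open>(w^2 - u^2) (w'^2 - u^2)\<close> with \<open>w = y + i x\<close> and its conjugate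
  \<open>w'\<close>. The bound on \<open>u\<close> keeps the arguments of the cosines off the real
  axis.\<close>

lemma row_limit:
  fixes u :: complex
  assumes u: "norm u < 1"
  shows "(\<lambda>M. \<Prod>m<M. (1 - u\<^sup>2 / oddw (n, m) ^ 2) * (1 - u\<^sup>2 / cnj (oddw (n, m)) ^ 2)) \<longlonglongrightarrow> rowratio u n"
proof -
  define x where "x = (of_nat (2 * n + 1) :: complex)"
  have Re: "\<bar>Im u\<bar> < 1" using abs_Im_le_cmod[of u] u by simp
  have x1: "1 \<le> real (2 * n + 1)" by simp
  have im: "Im ((u + \<i> * x) / 2) \<noteq> 0" "Im ((u - \<i> * x) / 2) \<noteq> 0" "Im (\<i> * x / 2) \<noteq> 0" "Im (- \<i> * x / 2) \<noteq> 0"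
    using Re x1 by (auto simp: x_def)
  have "(\<lambda>M. (\<Prod>m<M. 1 - (2 * ((u + \<i> * x) / 2))\<^sup>2 / of_nat (2 * m + 1) ^ 2) * (\<Prod>m<M. 1 - (2 * ((u - \<i> * x) / 2))\<^sup>2 / of_nat (2 * m + 1) ^ 2)
      / ((\<Prod>m<M. 1 - (2 * (\<i> * x / 2))\<^sup>2 / of_nat (2 * m + 1) ^ 2) * (\<Prod>m<M. 1 - (2 * (- \<i> * x / 2))\<^sup>2 / of_nat (2 * m + 1) ^ 2)))
     \<longlonglongrightarrow> rowratio u n"
    unfolding rowratio_def x_def[symmetric]
    by (intro tendsto_divide tendsto_mult cos_product im)
       (use cos_i_nonzero[of "2 * n + 1"] in \<open>auto simp: x_def\<close>)
  moreover have "(\<Prod>m<M. 1 - (2 * ((u + \<i> * x) / 2))\<^sup>2 / of_nat (2 * m + 1) ^ 2) * (\<Prod>m<M. 1 - (2 * ((u - \<i> * x) / 2))\<^sup>2 / of_nat (2 * m + 1) ^ 2)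
      / ((\<Prod>m<M. 1 - (2 * (\<i> * x / 2))\<^sup>2 / of_nat (2 * m + 1) ^ 2) * (\<Prod>m<M. 1 - (2 * (- \<i> * x / 2))\<^sup>2 / of_nat (2 * m + 1) ^ 2))
     = (\<Prod>m<M. (1 - u\<^sup>2 / oddw (n, m) ^ 2) * (1 - u\<^sup>2 / cnj (oddw (n, m)) ^ 2))" for M
    unfolding prod.distrib[symmetric] prod_dividef[symmetric]
  proof (intro prod.cong refl)
    fix m
    define y where "y = (of_nat (2 * m + 1) :: complex)"
    have w: "oddw (n, m) = y + \<i> * x" "cnj (oddw (n, m)) = y - \<i> * x"
      by (auto simp: oddw_def x_def y_def complex_eq_iff)
    have y0: "y \<noteq> 0" unfolding y_def by (metis add_eq_0_iff_both_eq_0 of_nat_eq_0_iff one_neq_zero)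
    have w0: "y + \<i> * x \<noteq> 0" "y - \<i> * x \<noteq> 0"
      by (auto simp: x_def y_def complex_eq_iff)
    have "(1 - (2 * ((u + \<i> * x) / 2))\<^sup>2 / y ^ 2) * (1 - (2 * ((u - \<i> * x) / 2))\<^sup>2 / y ^ 2) / ((1 - (2 * (\<i> * x / 2))\<^sup>2 / y ^ 2) * (1 - (2 * (- \<i> * x / 2))\<^sup>2 / y ^ 2))
       = ((y\<^sup>2 - (u + \<i> * x)\<^sup>2) * (y\<^sup>2 - (u - \<i> * x)\<^sup>2)) / ((y\<^sup>2 - (\<i> * x)\<^sup>2) * (y\<^sup>2 - (\<i> * x)\<^sup>2))"
    proof -
      have *: "1 - A / y ^ 2 = (y\<^sup>2 - A) / y\<^sup>2" for A using y0 by (simp add: diff_divide_distrib)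
      have h: "2 * (a / 2) = a" for a :: complex by simp
      have m: "- \<i> * x = - (\<i> * x)" by simp
      show ?thesis unfolding h * m power2_minus using y0 by simp
    qed
    also have "(y\<^sup>2 - (\<i> * x)\<^sup>2) * (y\<^sup>2 - (\<i> * x)\<^sup>2) = (y + \<i> * x)\<^sup>2 * (y - \<i> * x)\<^sup>2"
      by (simp add: power2_eq_square algebra_simps)
    also have "(y\<^sup>2 - (u + \<i> * x)\<^sup>2) * (y\<^sup>2 - (u - \<i> * x)\<^sup>2) = ((y + \<i> * x)\<^sup>2 - u\<^sup>2) * ((y - \<i> * x)\<^sup>2 - u\<^sup>2)"
      by (simp add: power2_eq_square algebra_simps)
    also have "\<dots> / ((y + \<i> * x)\<^sup>2 * (y - \<i> * x)\<^sup>2) = (1 - u\<^sup>2 / (y + \<i> * x)\<^sup>2) * (1 - u\<^sup>2 / (y - \<i> * x)\<^sup>2)"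
      using w0 by (simp add: diff_divide_distrib times_divide_times_eq[symmetric] del: times_divide_times_eq)
    finally show "(1 - (2 * ((u + \<i> * x) / 2))\<^sup>2 / of_nat (2 * m + 1) ^ 2) * (1 - (2 * ((u - \<i> * x) / 2))\<^sup>2 / of_nat (2 * m + 1) ^ 2) /
         ((1 - (2 * (\<i> * x / 2))\<^sup>2 / of_nat (2 * m + 1) ^ 2) * (1 - (2 * (- \<i> * x / 2))\<^sup>2 / of_nat (2 * m + 1) ^ 2))
       = (1 - u\<^sup>2 / oddw (n, m) ^ 2) * (1 - u\<^sup>2 / cnj (oddw (n, m)) ^ 2)"
      unfolding w(2) unfolding w(1) y_def .
  qed
  ultimately show ?thesis by simp
qed

text \<open>Taking exponentials out of the factors of the triple product leaves cosines at
  \<open>pi (u + i (2 n + 1)) / 2\<close> and \<open>pi (u - i (2 n + 1)) / 2\<close>. For the nome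
  \<open>exp (- pi)\<close> the shifts between rows have the same unit as the zeros within a row,
  which makes the lattice square; another nome would give a rectangular one.\<close>

lemma tpprod_rowratio: "tpprod (exp (- pi)) N (exp (2 * \<i> * (of_real pi * u / 2))) / tpprod (exp (- pi)) N 1 = (\<Prod>n<N. rowratio u n)"
proof -
  define c where "c = (\<lambda>u n. cos (of_real pi * ((u + \<i> * of_nat (2 * n + 1)) / 2)) * cos (of_real pi * ((u - \<i> * of_nat (2 * n + 1)) / 2)))"
  have f: "(1 + of_real (exp (- pi)) ^ (2 * n + 1) * W) * (1 + of_real (exp (- pi)) ^ (2 * n + 1) / W)
      = 4 * of_real (exp (- pi)) ^ (2 * n + 1) * c u n" if W: "W = exp (2 * \<i> * (of_real pi * u / 2))" for u W n
  proof -
    define E F where "E = exp (\<i> * (of_real pi * u / 2))" and "F = exp (- (of_real pi * of_nat (2 * n + 1) / 2 :: complex))"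
    have nz: "E \<noteq> 0" "F \<noteq> 0" by (auto simp: E_def F_def)
    have W': "W = E * E" unfolding W E_def by (simp add: exp_add[symmetric] mult_ac)
    have q: "of_real (exp (- pi)) ^ (2 * n + 1) = F * F"
    proof -
      have "of_real (exp (- pi)) ^ (2 * n + 1) = exp (of_nat (2 * n + 1) * complex_of_real (- pi))"
        unfolding exp_of_nat_mult exp_of_real ..
      also have "\<dots> = F * F" unfolding F_def exp_add[symmetric] by (rule arg_cong[where f = exp]) (simp add: field_simps)
      finally show ?thesis .
    qed
    have c1: "exp (\<i> * (of_real pi * ((u + \<i> * of_nat (2 * n + 1)) / 2))) = E * F"
      unfolding E_def F_def exp_add[symmetric] by (rule arg_cong[where f = exp]) (simp add: field_simps)
    have c2: "exp (\<i> * (of_real pi * ((u - \<i> * of_nat (2 * n + 1)) / 2))) = E / F"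
      unfolding E_def F_def exp_diff[symmetric] by (rule arg_cong[where f = exp]) (simp add: field_simps)
    have "c u n = (E * F + inverse (E * F)) / 2 * ((E / F + inverse (E / F)) / 2)"
      unfolding c_def cos_exp_eq exp_minus mult_minus_left minus_mult_left[symmetric] c1 c2 by simp
    then show ?thesis unfolding q W' using nz by (simp add: field_simps)
  qed
  have e: "(of_real (exp (- pi)) :: complex) ^ (2 * n + 1) \<noteq> 0" for n by simp
  have 1: "tpprod (exp (- pi)) N (exp (2 * \<i> * (of_real pi * u / 2))) = (\<Prod>n<N. 4 * of_real (exp (- pi)) ^ (2 * n + 1) * c u n)"
    unfolding tpprod_def by (intro prod.cong refl f)
  have 2: "tpprod (exp (- pi)) N 1 = (\<Prod>n<N. 4 * of_real (exp (- pi)) ^ (2 * n + 1) * c 0 n)"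
    unfolding tpprod_def by (intro prod.cong refl f) simp
  show ?thesis
    unfolding 1 2 prod_dividef[symmetric]
  proof (intro prod.cong refl)
    fix n
    show "4 * of_real (exp (- pi)) ^ (2 * n + 1) * c u n / (4 * of_real (exp (- pi)) ^ (2 * n + 1) * c 0 n) = rowratio u n"
      using e[of n] by (simp add: c_def rowratio_def del: power_Suc power_add)
  qed
qed

lemma thetaW_rowratio:
  "(\<lambda>N. \<Prod>n<N. rowratio u n) \<longlonglongrightarrow> thetaW (exp (- pi)) (exp (2 * \<i> * (of_real pi * u / 2))) / of_real (theta 0 (exp (- pi)))"
proof -
  have q: "0 < exp (- pi)" "exp (- pi) < 1" by auto
  obtain C where C: "C \<noteq> 0" "\<And>W. W \<noteq> 0 \<Longrightarrow> (\<lambda>N. tpprod (exp (- pi)) N W) \<longlonglongrightarrow> C * thetaW (exp (- pi)) W"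
    using triple_product[OF q] by blast
  have t: "of_real (theta 0 (exp (- pi))) \<noteq> (0 :: complex)" using theta_pos[OF q] by simp
  have "(\<lambda>N. tpprod (exp (- pi)) N (exp (2 * \<i> * (of_real pi * u / 2))) / tpprod (exp (- pi)) N 1)
      \<longlonglongrightarrow> C * thetaW (exp (- pi)) (exp (2 * \<i> * (of_real pi * u / 2))) / (C * thetaW (exp (- pi)) 1)"
    using C t by (intro tendsto_divide C(2)) (auto simp: thetaW_1[OF q])
  then show ?thesis unfolding tpprod_rowratio thetaW_1[OF q] using C(1) by simp
qed

text \<open>The summand is at most half of the product bound \<open>?b\<close>, whose total
  \<open>c * c\<close> is below 2. Being uniform in the finite set and in \<open>j\<close>, this
  supplies the radius \<open>B = 1\<close> for the Newton series.\<close>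

lemma odd_power_sum_bound:
  assumes F: "finite F" and j: "1 \<le> j"
  shows "(\<Sum>x\<in>F. \<bar>2 * Re (1 / oddw x ^ (4 * j))\<bar>) \<le> 1"
proof -
  obtain c where c: "((\<lambda>n. 1 / (2 * real n + 1)\<^sup>2) has_sum c) UNIV" "c \<le> 5 / 4"
    using odd_square_sum by blast
  let ?b = "\<lambda>(n, m). 1 / (2 * real n + 1)\<^sup>2 * (1 / (2 * real m + 1)\<^sup>2)"
  have c0: "0 \<le> c" by (rule has_sum_nonneg[OF c(1)]) simp
  have b: "(?b has_sum c * c) UNIV"
    using has_sum_prod_real[OF c(1) c(1)] by simp
  have "\<bar>2 * Re (1 / oddw x ^ (4 * j))\<bar> \<le> 1 / 2 * ?b x" for x
  proof -
    obtain n m where x: "x = (n, m)" by (cases x)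
    have r: "2 \<le> (cmod (oddw x))\<^sup>2" unfolding x by (rule norm_oddw_ge)
    then have "2 * 2 \<le> (cmod (oddw x))\<^sup>2 * (cmod (oddw x))\<^sup>2" by (intro mult_mono) auto
    then have r4: "4 \<le> cmod (oddw x) ^ 4" by (simp add: power2_eq_square power4_eq_xxxx)
    have "\<bar>2 * Re (1 / oddw x ^ (4 * j))\<bar> \<le> 2 * cmod (1 / oddw x ^ (4 * j))"
      using abs_Re_le_cmod[of "1 / oddw x ^ (4 * j)"] by (simp add: abs_mult)
    also have "\<dots> = 2 * (1 / cmod (oddw x) ^ 4) ^ j"
      by (simp add: norm_divide norm_power power_divide power_mult)
    also have "\<dots> \<le> 2 * (1 / cmod (oddw x) ^ 4) ^ 1"
      using r4 j by (intro mult_left_mono power_decreasing) (auto simp: divide_le_eq_1)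
    also have "\<dots> \<le> 1 / 2 * ?b x"
      using norm_oddw_bound[of n m] by (simp add: x)
    finally show ?thesis .
  qed
  then have "(\<Sum>x\<in>F. \<bar>2 * Re (1 / oddw x ^ (4 * j))\<bar>) \<le> (\<Sum>x\<in>F. 1 / 2 * ?b x)"
    by (rule sum_mono)
  also have "\<dots> = 1 / 2 * sum ?b F" by (simp only: sum_distrib_left)
  also have "sum ?b F \<le> c * c"
    by (rule has_sum_mono2[OF has_sum_finite[OF F] b]) auto
  also have "c * c \<le> 5 / 4 * (5 / 4)" using c0 c(2) by (intro mult_mono) auto
  finally show ?thesis by simp
qed

text \<open>The argument \<open>i u\<close> pairs \<open>1 - u^2 / w^2\<close> with
  \<open>1 + u^2 / w^2\<close>, so only fourth powers of \<open>w\<close> survive, and their power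
  sums converge absolutely. The Newton series is then carried through two limits: along the rows
  (\<open>M\<close>), then over the rows (\<open>N\<close>).\<close>

lemma rowratio_product:
  fixes u :: real
  assumes u: "0 < u" "u < 1"
  shows "(\<lambda>N. \<Prod>n<N. rowratio u n * rowratio (\<i> * u) n)
     \<longlonglongrightarrow> (\<Sum>k. newtonE (\<lambda>j. of_real (oddS j)) k * of_real (u ^ 4) ^ k)"
proof -
  define Z where "Z = complex_of_real (u ^ 4)"
  have "u ^ 4 < 1" using u by (simp add: power_less_one_iff)
  then have Z: "norm Z * 1 < 1" by (simp add: Z_def norm_power flip: of_real_power)
  define b where "b = (\<lambda>j x. 2 * Re (1 / oddw x ^ (4 * j)))"
  define s where "s = (\<lambda>N M j. complex_of_real (\<Sum>n<N. \<Sum>m<M. b j (n, m)))"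
  define r where "r = (\<lambda>j n. \<Sum>\<^sub>\<infinity>m. b j (n, m))"
  have hs: "(b (Suc j) has_sum oddS (Suc j)) (UNIV \<times> UNIV)" for j
    using has_sum_odd_lattice(2)[of "Suc j"] by (simp add: b_def)
  have hr: "((\<lambda>m. b (Suc j) (n, m)) has_sum r (Suc j) n) UNIV" for j n
  proof -
    have "(\<lambda>(n, m). b (Suc j) (n, m)) summable_on UNIV \<times> UNIV"
      using has_sum_imp_summable[OF hs[of j]] by simp
    then have "(\<lambda>m. b (Suc j) (n, m)) summable_on UNIV" by (rule summable_on_SigmaD1) simp
    then show ?thesis unfolding r_def by (rule has_sum_infsum)
  qed
  have ho: "(r (Suc j) has_sum oddS (Suc j)) UNIV" for j
    by (rule has_sum_SigmaD[OF hs hr])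
  have lim1: "(\<lambda>M. s N M (Suc j)) \<longlonglongrightarrow> of_real (\<Sum>n<N. r (Suc j) n)" for N j
    unfolding s_def
    by (intro tendsto_of_real tendsto_sum) (use has_sum_imp_sums[OF hr] in \<open>simp add: sums_def\<close>)
  have lim2: "(\<lambda>N. of_real (\<Sum>n<N. r (Suc j) n) :: complex) \<longlonglongrightarrow> of_real (oddS (Suc j))" for j
    by (intro tendsto_of_real) (use has_sum_imp_sums[OF ho] in \<open>simp add: sums_def\<close>)
  have bound1: "norm (s N M (Suc j)) \<le> 1 ^ Suc j" for N M j
  proof -
    have "norm (s N M (Suc j)) = \<bar>\<Sum>x\<in>{..<N} \<times> {..<M}. b (Suc j) x\<bar>"
      unfolding s_def norm_of_real by (simp add: sum.cartesian_product)
    also have "\<dots> \<le> (\<Sum>x\<in>{..<N} \<times> {..<M}. \<bar>b (Suc j) x\<bar>)" by (rule sum_abs)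
    also have "\<dots> \<le> 1" unfolding b_def by (rule odd_power_sum_bound) auto
    finally show ?thesis by simp
  qed
  have bound2: "norm (of_real (\<Sum>n<N. r (Suc j) n) :: complex) \<le> 1 ^ Suc j" for N j
    by (rule LIMSEQ_le_const2[OF tendsto_norm[OF lim1]]) (use bound1 in auto)
  have fin: "(\<Sum>k. newtonE (s N M) k * Z ^ k) = (\<Prod>n<N. \<Prod>m<M. (1 - Z / oddw (n, m) ^ 4) * (1 - Z / cnj (oddw (n, m)) ^ 4))" for N M
  proof -
    \<comment> \<open>The Boolean selects \<open>w\<close> or its conjugate, so that equal values
      keep separate indices.\<close>
    define a where "a = (\<lambda>(x, t). if t then 1 / oddw x ^ 4 else 1 / cnj (oddw x) ^ 4)"
    let ?I = "({..<N} \<times> {..<M}) \<times> (UNIV :: bool set)"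
    have a2: "(1 / oddw x ^ 4) ^ j + (1 / cnj (oddw x) ^ 4) ^ j = of_real (b j x)" for x j
    proof -
      have "(1 / cnj (oddw x) ^ 4) ^ j = cnj ((1 / oddw x ^ 4) ^ j)" by simp
      then have "(1 / oddw x ^ 4) ^ j + (1 / cnj (oddw x) ^ 4) ^ j = of_real (2 * Re ((1 / oddw x ^ 4) ^ j))"
        by (simp only: complex_add_cnj)
      then show ?thesis by (simp add: b_def power_divide power_mult)
    qed
    have "(\<Sum>i\<in>?I. a i ^ j) = (\<Sum>x\<in>{..<N} \<times> {..<M}. \<Sum>t\<in>UNIV. a (x, t) ^ j)" for j
      by (simp add: sum.cartesian_product)
    then have sj: "(\<lambda>j. \<Sum>i\<in>?I. a i ^ j) = s N M"
      by (simp add: fun_eq_iff UNIV_bool a_def a2 add.commute s_def sum.cartesian_product case_prod_unfold)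
    have "(\<lambda>n. newtonE (\<lambda>j. \<Sum>i\<in>?I. a i ^ j) n * Z ^ n) sums (\<Prod>i\<in>?I. 1 - a i * Z)"
      by (rule newton_finite) auto
    moreover have "(\<Prod>i\<in>?I. 1 - a i * Z) = (\<Prod>x\<in>{..<N} \<times> {..<M}. \<Prod>t\<in>UNIV. 1 - a (x, t) * Z)"
      by (simp add: prod.cartesian_product)
    moreover have "(\<Prod>x\<in>{..<N} \<times> {..<M}. \<Prod>t\<in>UNIV. 1 - a (x, t) * Z) = (\<Prod>n<N. \<Prod>m<M. (1 - Z / oddw (n, m) ^ 4) * (1 - Z / cnj (oddw (n, m)) ^ 4))"
      by (simp add: UNIV_bool a_def prod.cartesian_product case_prod_unfold mult.commute)
    ultimately show ?thesis unfolding sj by (simp add: sums_iff)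
  qed
  have row: "(\<Prod>n<N. rowratio u n * rowratio (\<i> * u) n) = (\<Sum>k. newtonE (\<lambda>j. of_real (\<Sum>n<N. r j n)) k * Z ^ k)" for N
  proof (rule LIMSEQ_unique)
    show "(\<lambda>M. \<Sum>k. newtonE (s N M) k * Z ^ k) \<longlonglongrightarrow> (\<Sum>k. newtonE (\<lambda>j. of_real (\<Sum>n<N. r j n)) k * Z ^ k)"
      by (rule newton_series_tendsto[where B = 1]) (use lim1 bound1 Z in auto)
    have R: "(\<lambda>M. \<Prod>m<M. (1 - Z / oddw (n, m) ^ 4) * (1 - Z / cnj (oddw (n, m)) ^ 4)) \<longlonglongrightarrow> rowratio u n * rowratio (\<i> * u) n" for n
    proof -
      have "(\<lambda>M. (\<Prod>m<M. (1 - (of_real u)\<^sup>2 / oddw (n, m) ^ 2) * (1 - (of_real u)\<^sup>2 / cnj (oddw (n, m)) ^ 2))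
          * (\<Prod>m<M. (1 - (\<i> * of_real u)\<^sup>2 / oddw (n, m) ^ 2) * (1 - (\<i> * of_real u)\<^sup>2 / cnj (oddw (n, m)) ^ 2)))
          \<longlonglongrightarrow> rowratio u n * rowratio (\<i> * u) n"
        using u by (intro tendsto_mult row_limit) (auto simp: norm_mult)
      moreover have "((1 - (of_real u)\<^sup>2 / w ^ 2) * (1 - (of_real u)\<^sup>2 / w' ^ 2)) * ((1 - (\<i> * of_real u)\<^sup>2 / w ^ 2) * (1 - (\<i> * of_real u)\<^sup>2 / w' ^ 2))
          = (1 - Z / w ^ 4) * (1 - Z / w' ^ 4)" for w w' :: complex
      proof -
        have "(1 - (of_real u)\<^sup>2 / w ^ 2) * (1 - (\<i> * of_real u)\<^sup>2 / w ^ 2) = 1 - Z / w ^ 4" for w :: complex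
        proof -
          have "(1 - A) * (1 + A) = 1 - A * A" for A :: complex by (simp add: algebra_simps)
          moreover have "(\<i> * of_real u)\<^sup>2 = - ((of_real u)\<^sup>2)" by (simp add: power_mult_distrib)
          ultimately have "(1 - (of_real u)\<^sup>2 / w ^ 2) * (1 - (\<i> * of_real u)\<^sup>2 / w ^ 2)
              = 1 - (of_real u)\<^sup>2 / w ^ 2 * ((of_real u)\<^sup>2 / w ^ 2)" by simp
          also have "(of_real u)\<^sup>2 / w ^ 2 * ((of_real u)\<^sup>2 / w ^ 2) = Z / w ^ 4"
            by (simp add: Z_def power2_eq_square power4_eq_xxxx mult.assoc)
          finally show ?thesis .
        qed
        from this[of w, symmetric] this[of w', symmetric] show ?thesis by (simp only: mult_ac)
      qed
      ultimately show ?thesis by (simp only: prod.distrib[symmetric])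
    qed
    show "(\<lambda>M. \<Sum>k. newtonE (s N M) k * Z ^ k) \<longlonglongrightarrow> (\<Prod>n<N. rowratio u n * rowratio (\<i> * u) n)"
      unfolding fin by (intro tendsto_prod R)
  qed
  show ?thesis
    unfolding row Z_def[symmetric]
    by (rule newton_series_tendsto[where B = 1]) (use lim2 bound2 Z in auto)
qed

text \<open>The two expansions to be compared are parametrized by \<open>sqrt v\<close>, hence agree
  on positive reals only. After division by \<open>v^n\<close> the constant coefficient is recovered
  as the limit along \<open>1 / (m + 2)\<close>.\<close>

lemma powser_zero_right:
  fixes h :: "nat \<Rightarrow> complex"
  assumes "\<And>v::real. 0 < v \<Longrightarrow> v < 1 \<Longrightarrow> (\<lambda>n. h n * of_real v ^ n) sums 0"
  shows "h n = 0"
proof (induction n rule: less_induct)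
  case (less n)
  have z: "(\<lambda>k. h (k + n) * of_real v ^ k) sums 0" if v: "0 < v" "v < 1" for v :: real
  proof -
    have "(\<lambda>k. h (k + n) * of_real v ^ (k + n)) sums (0 - (\<Sum>i<n. h i * of_real v ^ i))"
      using sums_split_initial_segment[OF assms[OF v], of n] by simp
    moreover have "(\<Sum>i<n. h i * of_real v ^ i) = 0" using less by simp
    ultimately have "(\<lambda>k. (h (k + n) * of_real v ^ k) * of_real v ^ n) sums (0 * of_real v ^ n)"
      by (simp add: power_add mult.assoc)
    then show ?thesis using v by (subst (asm) sums_mult2_iff) auto
  qed
  define f where "f = (\<lambda>x::complex. \<Sum>k. h (k + n) * x ^ k)"
  have "(f \<longlongrightarrow> h (0 + n)) (at 0)"
  proof (rule powser_limit_0[of "1/2"])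
    fix x :: complex assume x: "norm x < 1 / 2"
    have "summable (\<lambda>k. h (k + n) * of_real (1 / 2) ^ k)"
      using z[of "1 / 2"] by (intro sums_summable) auto
    then have "summable (\<lambda>k. h (k + n) * x ^ k)"
      by (rule powser_inside) (use x in simp)
    then show "(\<lambda>k. h (k + n) * x ^ k) sums f x" unfolding f_def by (rule summable_sums)
  qed simp
  moreover have "filterlim (\<lambda>m. complex_of_real (1 / (real m + 2))) (at 0) sequentially"
  proof (rule filterlim_atI)
    have "(\<lambda>m. 1 / (real m + 2)) \<longlonglongrightarrow> 0" by real_asymp
    then show "(\<lambda>m. complex_of_real (1 / (real m + 2))) \<longlonglongrightarrow> 0"
      by (rule tendsto_of_real[where a = 0, unfolded of_real_0])
    show "\<forall>\<^sub>F m in sequentially. complex_of_real (1 / (real m + 2)) \<noteq> 0"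
      by (intro always_eventually) (simp del: of_real_divide of_real_add add: of_real_eq_0_iff)
  qed
  ultimately have "(\<lambda>m. f (complex_of_real (1 / (real m + 2)))) \<longlonglongrightarrow> h n"
    by (simp add: filterlim_compose[of f "nhds (h n)" "at 0"])
  moreover have "f (complex_of_real (1 / (real m + 2))) = 0" for m
    unfolding f_def using z[of "1 / (real m + 2)"] by (simp only: sums_iff) simp
  ultimately show ?case by (simp add: LIMSEQ_const_iff)
qed

text \<open>\<open>theta(t) theta(i t)\<close> is expanded twice in \<open>v = (2 t)^2\<close>: by
  the Cauchy product of the Taylor series, and by the Newton series of the zeros. The coefficients
  of \<open>v^(2 p)\<close> give the claim, as \<open>thetaform\<close> at \<open>lam = 1/2\<close>
  is a multiple of \<open>poly (Bpoly p) (1 / 2)\<close>.\<close>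

lemma newtonE_oddS:
  "newtonE (\<lambda>j. of_real (oddS j)) p
     = of_real (pi ^ (4 * p) * theta 0 (exp (- pi)) ^ (8 * p) * poly (Bpoly p) (1 / 2) / (16 ^ p * fact (4 * p)))"
proof -
  define q where "q = exp (- pi)"
  have q: "0 < q" "q < 1" by (auto simp: q_def)
  define x where "x = theta 0 q"
  have x: "x > 0" using theta_pos[OF q] by (simp add: x_def)
  let ?E = "newtonE (\<lambda>j. of_real (oddS j))"
  define g where "g = (\<lambda>n. if even n then of_real (x\<^sup>2) * ?E (n div 2) / of_real pi ^ (2 * n) else 0)"
  have h: "of_real (thetacauchy q n) - g n = 0" for n
  proof (rule powser_zero_right)
    fix v :: real assume v: "0 < v" "v < 1"
    define t u where "t = sqrt v / 2" and "u = sqrt v / pi"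
    have t2: "(2 * t)\<^sup>2 = v" using v by (simp add: t_def)
    have tu: "complex_of_real t = of_real pi * of_real u / 2" "\<i> * complex_of_real t = of_real pi * (\<i> * of_real u) / 2"
      by (auto simp: t_def u_def)
    have "sqrt v < 1" using v by simp
    then have "sqrt v < pi" using pi_gt3 by linarith
    then have u: "0 < u" "u < 1" using v by (auto simp: u_def)
    have u4: "u ^ 4 = v\<^sup>2 / pi ^ 4"
    proof -
      have "sqrt v ^ 4 = ((sqrt v)\<^sup>2)\<^sup>2" by (simp add: power_mult[symmetric])
      then show ?thesis using v by (simp add: u_def power_divide)
    qed
    let ?P = "thetaW q (exp (2 * \<i> * of_real t)) * thetaW q (exp (2 * \<i> * (\<i> * of_real t)))"
    have "(\<lambda>N. (\<Prod>n<N. rowratio u n) * (\<Prod>n<N. rowratio (\<i> * u) n)) \<longlonglongrightarrow>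
        (thetaW q (exp (2 * \<i> * (of_real pi * of_real u / 2))) / of_real x) * (thetaW q (exp (2 * \<i> * (of_real pi * (\<i> * of_real u) / 2))) / of_real x)"
      unfolding q_def x_def by (intro tendsto_mult thetaW_rowratio)
    then have "(\<lambda>N. \<Prod>n<N. rowratio u n * rowratio (\<i> * u) n) \<longlonglongrightarrow> ?P / of_real (x\<^sup>2)"
      unfolding tu[symmetric] by (simp add: prod.distrib power2_eq_square)
    then have eq: "(\<Sum>k. ?E k * of_real (u ^ 4) ^ k) = ?P / of_real (x\<^sup>2)"
      using LIMSEQ_unique[OF rowratio_product[OF u]] by blast
    have bd: "norm (?E k) \<le> 1 ^ k" for k
    proof (rule newtonE_bound)
      show "norm (complex_of_real (oddS (Suc j))) \<le> 1 ^ Suc j" for j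
      proof -
        have "\<bar>oddS (Suc j)\<bar> \<le> 1"
        proof -
          have s: "((\<lambda>x. 2 * Re (1 / oddw x ^ (4 * Suc j))) has_sum oddS (Suc j)) UNIV"
            by (rule has_sum_odd_lattice(2)) simp
          have sa: "(\<lambda>x. norm (2 * Re (1 / oddw x ^ (4 * Suc j)))) summable_on UNIV"
            using has_sum_imp_summable[OF s] by (subst (asm) summable_on_iff_abs_summable_on_real)
          have "norm (oddS (Suc j)) \<le> infsum (\<lambda>x. norm (2 * Re (1 / oddw x ^ (4 * Suc j)))) UNIV"
            by (rule norm_has_sum_bound[OF has_sum_infsum[OF sa] s])
          also have "\<dots> \<le> 1"
            by (rule infsum_le_finite_sums[OF sa]) (use odd_power_sum_bound[of _ "Suc j"] in simp)
          finally show ?thesis by simp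
        qed
        then show ?thesis by simp
      qed
    qed simp
    have "summable (\<lambda>k. ?E k * of_real (u ^ 4) ^ k)"
    proof (rule summable_comparison_test)
      have "u ^ 4 < 1" using u by (simp add: power_less_one_iff)
      then show "summable (\<lambda>k. (u ^ 4) ^ k)" using u by (intro summable_geometric) auto
      have "norm (?E k * of_real (u ^ 4) ^ k) \<le> (u ^ 4) ^ k" for k
      proof -
        have "norm (?E k * of_real (u ^ 4) ^ k) = norm (?E k) * (u ^ 4) ^ k"
          using u by (simp add: norm_mult norm_power)
        also have "\<dots> \<le> 1 * (u ^ 4) ^ k" using bd[of k] u by (intro mult_right_mono) auto
        finally show ?thesis by simp
      qed
      then show "\<exists>N. \<forall>k\<ge>N. norm (?E k * of_real (u ^ 4) ^ k) \<le> (u ^ 4) ^ k" by blast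
    qed
    then have "(\<lambda>k. ?E k * of_real (u ^ 4) ^ k) sums (?P / of_real (x\<^sup>2))"
      using eq summable_sums by fastforce
    from sums_mult[OF this, of "of_real (x\<^sup>2)"]
    have "(\<lambda>k. of_real (x\<^sup>2) * (?E k * of_real (u ^ 4) ^ k)) sums ?P" using x by simp
    moreover have "of_real (x\<^sup>2) * (?E k * of_real (u ^ 4) ^ k) = g (2 * k) * of_real v ^ (2 * k)" for k
      unfolding u4 g_def by (simp add: power_divide power_mult[symmetric])
    ultimately have "(\<lambda>k. g (2 * k) * of_real v ^ (2 * k)) sums ?P" by simp
    then have "(\<lambda>n. g n * of_real v ^ n) sums ?P"
      by (subst (asm) sums_mono_reindex[of "\<lambda>k. 2 * k" "\<lambda>n. g n * of_real v ^ n"])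
         (auto simp: strict_mono_def g_def elim!: evenE)
    moreover have "(\<lambda>n. of_real (thetacauchy q n) * of_real v ^ n) sums ?P"
      using thetaW_product[OF q, of t] unfolding t2 by simp
    ultimately show "(\<lambda>n. (of_real (thetacauchy q n) - g n) * of_real v ^ n) sums 0"
      using sums_diff by (fastforce simp: left_diff_distrib)
  qed
  have lam: "lam q = 1 / 2" unfolding q_def by (rule lam_lemniscatic)
  from h[of "2 * p"] have "of_real (x\<^sup>2) * ?E p / of_real pi ^ (4 * p) = of_real (thetaform p q / fact (4 * p))"
    by (simp add: g_def thetacauchy_even)
  also have "thetaform p q = x ^ (8 * p) * x\<^sup>2 * poly (Bpoly p) (1 / 2) / 16 ^ p"
    using thetaform_eq[OF q, of p] by (simp add: lam x_def power_add power2_eq_square)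
  finally have *: "of_real (x\<^sup>2) * ?E p / of_real pi ^ (4 * p) = of_real (x ^ (8 * p) * x\<^sup>2 * poly (Bpoly p) (1 / 2) / 16 ^ p / fact (4 * p))" .
  have "?E p = of_real (x\<^sup>2) * ?E p / of_real pi ^ (4 * p) * of_real (pi ^ (4 * p) / x\<^sup>2)"
    using x by simp
  also have "\<dots> = of_real (x ^ (8 * p) * x\<^sup>2 * poly (Bpoly p) (1 / 2) / 16 ^ p / fact (4 * p) * (pi ^ (4 * p) / x\<^sup>2))"
    unfolding * of_real_mult[symmetric] ..
  also have "x ^ (8 * p) * x\<^sup>2 * poly (Bpoly p) (1 / 2) / 16 ^ p / fact (4 * p) * (pi ^ (4 * p) / x\<^sup>2)
      = pi ^ (4 * p) * x ^ (8 * p) * poly (Bpoly p) (1 / 2) / (16 ^ p * fact (4 * p))"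
    using x by simp
  finally show ?thesis by (simp only: x_def q_def)
qed

section \<open>Recursive functions\<close>

abbreviation pi1 :: "nat \<Rightarrow> nat" where "pi1 x \<equiv> fst (prod_decode x)"
abbreviation pi2 :: "nat \<Rightarrow> nat" where "pi2 x \<equiv> snd (prod_decode x)"

named_theorems tr_intros

lemma tr_const [tr_intros]: "total_recursive (\<lambda>_. c)"
proof (induction c)
  case (Suc c)
  from total_recursive.comp[OF total_recursive.succ Suc] show ?case .
qed (rule total_recursive.zero)

lemma tr_id [tr_intros]: "total_recursive (\<lambda>n. n)"
  using total_recursive.pair[OF total_recursive.left total_recursive.right] by simp

lemma tr_pi1 [tr_intros]: "total_recursive f \<Longrightarrow> total_recursive (\<lambda>n. pi1 (f n))"
  by (rule total_recursive.comp[OF total_recursive.left])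

lemma tr_pi2 [tr_intros]: "total_recursive f \<Longrightarrow> total_recursive (\<lambda>n. pi2 (f n))"
  by (rule total_recursive.comp[OF total_recursive.right])

lemma tr_Suc [tr_intros]: "total_recursive f \<Longrightarrow> total_recursive (\<lambda>n. Suc (f n))"
  by (rule total_recursive.comp[OF total_recursive.succ])

lemmas tr_pair [tr_intros] = total_recursive.pair

text \<open>A function of several arguments is recursive if its uncurried form on codes of pairs is;
  under a binder the bound variables become projections of the code.\<close>

lemma tr_comp2:
  assumes "total_recursive (\<lambda>x. h (pi1 x) (pi2 x))" "total_recursive f" "total_recursive g"
  shows "total_recursive (\<lambda>n. h (f n) (g n))"
  using total_recursive.comp[OF assms(1) total_recursive.pair[OF assms(2,3)]] by simp

lemma tr_rec:
  assumes "total_recursive a" "total_recursive m"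
    and "total_recursive (\<lambda>x. b (pi1 x) (pi1 (pi2 x)) (pi2 (pi2 x)))"
  shows "total_recursive (\<lambda>n. rec_nat (a n) (\<lambda>i r. b n i r) (m n))"
  using total_recursive.comp[OF total_recursive.prec[OF assms(1,3)] total_recursive.pair[OF tr_id assms(2)]]
  by simp

lemma tr_add [tr_intros]:
  assumes "total_recursive f" "total_recursive g"
  shows "total_recursive (\<lambda>n. f n + g n)"
proof -
  have "rec_nat a (\<lambda>i r. Suc r) b = a + b" for a b :: nat by (induction b) auto
  moreover have "total_recursive (\<lambda>n. rec_nat (f n) (\<lambda>i r. Suc r) (g n))"
    by (rule tr_rec) (intro tr_intros assms)+
  ultimately show ?thesis by simp
qed

lemma tr_mult [tr_intros]:
  assumes "total_recursive f" "total_recursive g"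
  shows "total_recursive (\<lambda>n. f n * g n)"
proof -
  have "rec_nat 0 (\<lambda>i r. r + a) b = a * b" for a b :: nat by (induction b) auto
  moreover have "total_recursive (\<lambda>n. rec_nat 0 (\<lambda>i r. r + f n) (g n))"
    by (rule tr_rec) (intro tr_intros assms total_recursive.comp[of f])+
  ultimately show ?thesis by simp
qed

lemma tr_pow [tr_intros]:
  assumes "total_recursive f" "total_recursive g"
  shows "total_recursive (\<lambda>n. f n ^ g n)"
proof -
  have "rec_nat 1 (\<lambda>i r. r * a) b = a ^ b" for a b :: nat by (induction b) auto
  moreover have "total_recursive (\<lambda>n. rec_nat 1 (\<lambda>i r. r * f n) (g n))"
    by (rule tr_rec) (intro tr_intros assms total_recursive.comp[of f])+
  ultimately show ?thesis by simp
qed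

lemma tr_pred [tr_intros]:
  assumes "total_recursive f"
  shows "total_recursive (\<lambda>n. f n - 1)"
proof -
  have "rec_nat 0 (\<lambda>i r. i) b = b - 1" for b :: nat by (induction b) auto
  moreover have "total_recursive (\<lambda>n. rec_nat 0 (\<lambda>i r. i) (f n))"
    by (rule tr_rec) (intro tr_intros assms)+
  ultimately show ?thesis by simp
qed

lemma tr_diff [tr_intros]:
  assumes "total_recursive f" "total_recursive g"
  shows "total_recursive (\<lambda>n. f n - g n)"
proof -
  have "rec_nat a (\<lambda>i r. r - 1) b = a - b" for a b :: nat by (induction b) auto
  moreover have "total_recursive (\<lambda>n. rec_nat (f n) (\<lambda>i r. r - 1) (g n))"
    by (rule tr_rec) (intro tr_intros assms)+
  ultimately show ?thesis by simp
qed

lemma tr_if [tr_intros]: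
  assumes "total_recursive c" "total_recursive f" "total_recursive g"
  shows "total_recursive (\<lambda>n. if c n = 0 then f n else g n)"
proof -
  have "rec_nat a (\<lambda>_ _. b) k = (if k = 0 then a else b)" for a b k :: nat by (cases k) auto
  moreover have "total_recursive (\<lambda>n. rec_nat (f n) (\<lambda>_ _. g n) (c n))"
    by (rule tr_rec) (intro tr_intros assms total_recursive.comp[of g])+
  ultimately show ?thesis by simp
qed

lemma tr_mod2 [tr_intros]:
  assumes "total_recursive f"
  shows "total_recursive (\<lambda>n. f n mod 2)"
proof -
  have "rec_nat 0 (\<lambda>i r. 1 - r) k = k mod 2" for k :: nat
    by (induction k) (auto simp: mod_Suc)
  moreover have "total_recursive (\<lambda>n. rec_nat 0 (\<lambda>i r. 1 - r) (f n))"
    by (rule tr_rec) (intro tr_intros assms)+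
  ultimately show ?thesis by simp
qed

lemma tr_div2 [tr_intros]:
  assumes "total_recursive f"
  shows "total_recursive (\<lambda>n. f n div 2)"
proof -
  \<comment> \<open>Half of \<open>k\<close>, rounded down, is the number of odd numbers below
    \<open>k\<close>.\<close>
  have "rec_nat 0 (\<lambda>i r. r + i mod 2) k = k div 2" for k :: nat
    by (induction k) (auto, presburger)
  moreover have "total_recursive (\<lambda>n. rec_nat 0 (\<lambda>i r. r + i mod 2) (f n))"
    by (rule tr_rec) (intro tr_intros assms)+
  ultimately show ?thesis by simp
qed

lemma tr_sum:
  assumes "total_recursive (\<lambda>x. f (pi1 x) (pi2 x))" "total_recursive m"
  shows "total_recursive (\<lambda>n. \<Sum>j<m n. f n j)"
proof -
  have "rec_nat 0 (\<lambda>i r. r + h i) k = (\<Sum>j<k. h j)" for h :: "nat \<Rightarrow> nat" and k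
    by (induction k) auto
  moreover have "total_recursive (\<lambda>n. rec_nat 0 (\<lambda>i r. r + f n i) (m n))"
    by (rule tr_rec) (intro tr_intros assms tr_comp2[of f, OF assms(1)])+
  ultimately show ?thesis by simp
qed

text \<open>A nonempty list is coded as the successor of a pair, the empty one as 0, and both
  projections of 0 are 0. Hence positions past the end read as 0 without any test.\<close>

definition look :: "nat \<Rightarrow> nat \<Rightarrow> nat" where
  "look c i = pi1 (rec_nat c (\<lambda>_ r. pi2 (r - 1)) i - 1)"

lemma prod_decode_0: "prod_decode 0 = (0, 0)"
  by (simp add: prod_decode_def prod_decode_aux.simps)

lemma look_list_encode: "look (list_encode xs) i = (if i < length xs then xs ! i else 0)"
proof -
  have "rec_nat (list_encode xs) (\<lambda>_ r. pi2 (r - 1)) i = list_encode (drop i xs)"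
  proof (induction i)
    case (Suc i)
    have "pi2 (list_encode ys - 1) = list_encode (drop 1 ys)" for ys
      by (cases ys) (auto simp: prod_decode_0)
    then show ?case by (simp only: nat.rec Suc drop_drop plus_1_eq_Suc)
  qed simp
  moreover have "pi1 (list_encode ys - 1) = (if ys = [] then 0 else hd ys)" for ys
    by (cases ys) (auto simp: prod_decode_0)
  ultimately show ?thesis by (simp add: look_def hd_drop_conv_nth)
qed

lemma tr_look [tr_intros]:
  assumes "total_recursive f" "total_recursive g"
  shows "total_recursive (\<lambda>n. look (f n) (g n))"
  unfolding look_def by (rule tr_pi1, rule tr_pred, rule tr_rec) (intro tr_intros assms)+

lemma tr_tabulate:
  assumes "total_recursive (\<lambda>x. h (pi1 x) (pi2 x))" "total_recursive m"
  shows "total_recursive (\<lambda>n. list_encode (map (h n) [0..<m n]))"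
proof -
  \<comment> \<open>Coded lists grow at the head, so the table is built from its last entry
    backwards.\<close>
  have "rec_nat 0 (\<lambda>i r. Suc (prod_encode (g (k - 1 - i), r))) l = list_encode (map g [k - l..<k])"
    if "l \<le> k" for g :: "nat \<Rightarrow> nat" and k l
    using that
  proof (induction l)
    case (Suc l)
    then have "[k - Suc l..<k] = (k - Suc l) # [k - l..<k]"
      by (metis Suc_diff_Suc Suc_le_lessD diff_less upt_conv_Cons zero_less_Suc less_le_trans)
    with Suc show ?case by simp
  qed simp
  from this[of "m n" "m n" "h n" for n]
  have "rec_nat 0 (\<lambda>i r. Suc (prod_encode (h n (m n - 1 - i), r))) (m n) = list_encode (map (h n) [0..<m n])" for n
    by simp
  moreover have "total_recursive (\<lambda>n. rec_nat 0 (\<lambda>i r. Suc (prod_encode (h n (m n - 1 - i), r))) (m n))"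
    by (rule tr_rec) (intro tr_intros assms tr_comp2[of h, OF assms(1)] total_recursive.comp[of m, OF assms(2)])+
  ultimately show ?thesis by simp
qed

text \<open>Course-of-values recursion: the values computed so far are kept in a list, most recent first.\<close>

definition history :: "(nat \<Rightarrow> nat) \<Rightarrow> nat \<Rightarrow> nat" where
  "history F n = list_encode (map F (rev [0..<n]))"

lemma look_history: "look (history F n) i = (if i < n then F (n - 1 - i) else 0)"
  by (auto simp: history_def look_list_encode rev_nth)

lemma tr_course_of_values:
  assumes "total_recursive (\<lambda>x. \<Phi> (pi1 x) (pi2 x))" "\<And>n. F n = \<Phi> n (history F n)"
  shows "total_recursive F"
proof -
  have h: "rec_nat 0 (\<lambda>i r. Suc (prod_encode (\<Phi> i r, r))) n = history F n" for n
  proof (induction n)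
    case (Suc n)
    then show ?case using assms(2)[of n] by (simp add: history_def)
  qed (simp add: history_def)
  have "total_recursive (\<lambda>n. rec_nat 0 (\<lambda>i r. Suc (prod_encode (\<Phi> i r, r))) n)"
    by (rule tr_rec) (intro tr_intros tr_comp2[of \<Phi>, OF assms(1)])+
  then have "total_recursive (\<lambda>n. \<Phi> n (history F n))"
    unfolding h by (intro tr_comp2[of \<Phi>, OF assms(1)] tr_id)
  then show ?thesis unfolding assms(2)[symmetric] .
qed

text \<open>Integers are represented as differences of naturals, so that the ring operations
  preserve computability without a case distinction on signs.\<close>

definition ztr :: "(nat \<Rightarrow> int) \<Rightarrow> bool" where
  "ztr f \<longleftrightarrow> (\<exists>a b. total_recursive a \<and> total_recursive b \<and> (\<forall>n. f n = int (a n) - int (b n)))"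

lemma ztrI: "total_recursive a \<Longrightarrow> total_recursive b \<Longrightarrow> (\<And>n. f n = int (a n) - int (b n)) \<Longrightarrow> ztr f"
  by (auto simp: ztr_def)

lemma ztr_int [tr_intros]: "total_recursive f \<Longrightarrow> ztr (\<lambda>n. int (f n))"
  by (rule ztrI[OF _ tr_const[of 0]]) auto

lemma ztr_const [tr_intros]: "ztr (\<lambda>_. c)"
  by (rule ztrI[OF tr_const[of "nat c"] tr_const[of "nat (- c)"]]) auto

lemma ztr_add [tr_intros]:
  assumes "ztr f" "ztr g"
  shows "ztr (\<lambda>n. f n + g n)"
proof -
  obtain a b c d where *: "total_recursive a" "total_recursive b" "total_recursive c" "total_recursive d"
    "\<And>n. f n = int (a n) - int (b n)" "\<And>n. g n = int (c n) - int (d n)"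
    using assms unfolding ztr_def by blast
  show ?thesis
    by (rule ztrI[of "\<lambda>n. a n + c n" "\<lambda>n. b n + d n"]) (auto intro!: tr_intros simp: *)
qed

lemma ztr_minus [tr_intros]:
  assumes "ztr f"
  shows "ztr (\<lambda>n. - f n)"
proof -
  obtain a b where *: "total_recursive a" "total_recursive b" "\<And>n. f n = int (a n) - int (b n)"
    using assms unfolding ztr_def by blast
  show ?thesis by (rule ztrI[OF *(2,1)]) (simp add: *)
qed

lemma ztr_diff [tr_intros]: "ztr f \<Longrightarrow> ztr g \<Longrightarrow> ztr (\<lambda>n. f n - g n)"
  using ztr_add[OF _ ztr_minus, of f g] by simp

lemma ztr_mult [tr_intros]:
  assumes "ztr f" "ztr g"
  shows "ztr (\<lambda>n. f n * g n)"
proof -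
  obtain a b c d where *: "total_recursive a" "total_recursive b" "total_recursive c" "total_recursive d"
    "\<And>n. f n = int (a n) - int (b n)" "\<And>n. g n = int (c n) - int (d n)"
    using assms unfolding ztr_def by blast
  show ?thesis
    by (rule ztrI[of "\<lambda>n. a n * c n + b n * d n" "\<lambda>n. a n * d n + b n * c n"])
       (auto intro!: tr_intros simp: * algebra_simps)
qed

lemma ztr_if [tr_intros]:
  assumes "total_recursive k" "ztr f" "ztr g"
  shows "ztr (\<lambda>n. if k n = 0 then f n else g n)"
proof -
  obtain a b c d where *: "total_recursive a" "total_recursive b" "total_recursive c" "total_recursive d"
    "\<And>n. f n = int (a n) - int (b n)" "\<And>n. g n = int (c n) - int (d n)"
    using assms unfolding ztr_def by blast
  show ?thesis
    by (rule ztrI[of "\<lambda>n. if k n = 0 then a n else c n" "\<lambda>n. if k n = 0 then b n else d n"])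
       (auto intro!: tr_intros assms simp: *)
qed

lemma ztr_sum:
  assumes "ztr (\<lambda>x. f (pi1 x) (pi2 x))" "total_recursive m"
  shows "ztr (\<lambda>n. \<Sum>j<m n. f n j)"
proof -
  obtain a b where *: "total_recursive a" "total_recursive b" "\<And>x. f (pi1 x) (pi2 x) = int (a x) - int (b x)"
    using assms unfolding ztr_def by blast
  have f: "f n j = int (a (prod_encode (n, j))) - int (b (prod_encode (n, j)))" for n j
    using *(3)[of "prod_encode (n, j)"] by simp
  have "total_recursive (\<lambda>n. \<Sum>j<m n. a (prod_encode (n, j)))" "total_recursive (\<lambda>n. \<Sum>j<m n. b (prod_encode (n, j)))"
    using tr_sum[of "\<lambda>n j. a (prod_encode (n, j))" m] tr_sum[of "\<lambda>n j. b (prod_encode (n, j))" m] * assms(2) by auto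
  then show ?thesis
    by (rule ztrI) (simp add: f sum_subtractf)
qed

lemma int_encode_if: "int_encode z = (if 0 \<le> z then 2 * nat z else 2 * nat (- z) - 1)"
  by (auto simp: int_encode_def sum_encode_def)

lemma int_decode_if: "int_decode n = (if n mod 2 = 0 then int (n div 2) else - int (n div 2) - 1)"
  by (auto simp: int_decode_def sum_decode_def even_iff_mod_2_eq_zero)

lemma ztr_int_decode [tr_intros]: "total_recursive f \<Longrightarrow> ztr (\<lambda>n. int_decode (f n))"
  unfolding int_decode_if by (intro tr_intros)

lemma tr_int_encode [tr_intros]:
  assumes "ztr f"
  shows "total_recursive (\<lambda>n. int_encode (f n))"
proof -
  obtain a b where *: "total_recursive a" "total_recursive b" "\<And>n. f n = int (a n) - int (b n)"
    using assms unfolding ztr_def by blast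
  have "int_encode (f n) = (if b n - a n = 0 then 2 * (a n - b n) else 2 * (b n - a n) - 1)" for n
  proof (cases "b n \<le> a n")
    case True
    then have "f n = int (a n - b n)" by (simp add: *)
    then show ?thesis using True by (simp add: int_encode_if)
  next
    case False
    then have "f n = - int (b n - a n)" by (simp add: *)
    then show ?thesis using False by (simp add: int_encode_if)
  qed
  moreover have "total_recursive (\<lambda>n. if b n - a n = 0 then 2 * (a n - b n) else 2 * (b n - a n) - 1)"
    by (intro tr_intros *)
  ultimately show ?thesis by simp
qed

lemma tr_nat_abs [tr_intros]:
  assumes "ztr f"
  shows "total_recursive (\<lambda>n. nat \<bar>f n\<bar>)"
proof -
  obtain a b where *: "total_recursive a" "total_recursive b" "\<And>n. f n = int (a n) - int (b n)"
    using assms unfolding ztr_def by blast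
  have "nat \<bar>f n\<bar> = (a n - b n) + (b n - a n)" for n unfolding * by auto
  then show ?thesis by (simp add: tr_intros *)
qed

text \<open>Pascal's rule. A whole row is coded as one value of \<open>F\<close>, since the
  recursion scheme runs over a single argument; entries beyond the row read as 0, as they
  should.\<close>

lemma tr_binomial [tr_intros]:
  assumes "total_recursive f" "total_recursive g"
  shows "total_recursive (\<lambda>n. f n choose g n)"
proof -
  define F where "F = (\<lambda>n. list_encode (map (\<lambda>k. n choose k) [0..<n + 1]))"
  let ?\<Phi> = "\<lambda>n r. list_encode (map (\<lambda>k. if k = 0 then 1 else look (look r 0) (k - 1) + look (look r 0) k) [0..<n + 1])"
  have lF: "look (F n) k = n choose k" for n k
    by (auto simp: F_def look_list_encode simp del: upt_Suc)
  have F: "total_recursive F"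
  proof (rule tr_course_of_values)
    show "total_recursive (\<lambda>x. ?\<Phi> (pi1 x) (pi2 x))"
      by (intro tr_tabulate tr_intros)
    show "F n = ?\<Phi> n (history F n)" for n
    proof -
      have "n choose k = (if k = 0 then 1 else look (look (history F n) 0) (k - 1) + look (look (history F n) 0) k)" if "k < n + 1" for k
        using that by (cases n; cases k) (auto simp: look_history lF)
      then have "map (\<lambda>k. n choose k) [0..<n + 1] = map (\<lambda>k. if k = 0 then 1 else look (look (history F n) 0) (k - 1) + look (look (history F n) 0) k) [0..<n + 1]"
        by (intro map_cong refl) (simp del: upt_Suc)
      then show ?thesis by (subst F_def) (simp only:)
    qed
  qed
  have "total_recursive (\<lambda>n. look (F (f n)) (g n))"
    by (rule tr_look[OF total_recursive.comp[OF F assms(1)] assms(2)])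
  then show ?thesis unfolding lF .
qed

section \<open>The algebraic functions\<close>

text \<open>The coefficient of degree \<open>i\<close> in the recursion of \<open>beta\<close>,
  where \<open>j\<close> is the index of the new polynomial and \<open>u\<close>, \<open>v\<close>
  are the coefficients of its two predecessors. The two lines stem from the factors \<open>t\<close>
  and \<open>- t^2\<close>; by truncation, \<open>i - 1 = 0\<close> covers the degrees 0 and
  1.\<close>

definition betastep :: "nat \<Rightarrow> (nat \<Rightarrow> int) \<Rightarrow> (nat \<Rightarrow> int) \<Rightarrow> nat \<Rightarrow> int" where
  "betastep j u v i =
     (if i = 0 then 0 else 4 * int i * u i + 2 * (int j - 1) * (2 * int j - 3) * v (i - 1))
   - (if i - 1 = 0 then 0 else 4 * int (i - 1) * u (i - 1) + 2 * (int j - 1) * (2 * int j - 3) * v (i - 2))"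

fun betacoef :: "nat \<Rightarrow> nat \<Rightarrow> int" where
  "betacoef 0 = (\<lambda>i. if i = 0 then 1 else 0)"
| "betacoef (Suc 0) = (\<lambda>i. 0)"
| "betacoef (Suc (Suc j)) = betastep (Suc (Suc j)) (betacoef (Suc j)) (betacoef j)"

lemma coeff_beta: "coeff (beta j) i = of_int (betacoef j i)"
proof (induction j arbitrary: i rule: betacoef.induct)
  case (3 j)
  have "coeff ([:0, 1, -1:] * r) i = (if i = 0 then 0 else coeff r (i - 1)) - (if i - 1 = 0 then 0 else coeff r (i - 2))" for r :: "real poly"
    by (cases i; cases "i - 1") (auto simp: coeff_pCons)
  note c = this
  show ?case
  proof (cases i)
    case 0
    then show ?thesis unfolding beta.simps c by (simp add: betastep_def)
  next
    case (Suc a)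
    then show ?thesis unfolding beta.simps c betacoef.simps betastep_def
      by (cases a) (simp_all add: 3 coeff_pderiv algebra_simps)
  qed
qed auto

lemma betacoef_eq_0: "j < i \<Longrightarrow> betacoef j i = 0"
proof (induction j arbitrary: i rule: betacoef.induct)
  case (3 j)
  then show ?case by (auto simp: betastep_def)
qed auto

definition Bcoef :: "nat \<Rightarrow> nat \<Rightarrow> int" where
  "Bcoef p i = (\<Sum>j<2 * p + 1. (if j mod 2 = 0 then 1 else -1) * int (4 * p choose (2 * j)) *
     (\<Sum>l<i + 1. betacoef j l * betacoef (2 * p - j) (i - l)))"

lemma coeff_Bpoly: "coeff (Bpoly p) i = of_int (Bcoef p i)"
proof -
  have s: "(-1 :: real) ^ j = of_int (if j mod 2 = 0 then 1 else -1)" for j :: nat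
    by (cases "even j") (auto simp: even_iff_mod_2_eq_zero)
  show ?thesis
    unfolding Bpoly_def Bcoef_def coeff_sum coeff_smult coeff_mult coeff_beta s
    by (simp only: of_int_sum of_int_mult of_int_of_nat_eq lessThan_Suc_atMost add_Suc_right Suc_eq_plus1[symmetric])
qed

lemma Bcoef_eq_0:
  assumes "2 * p < i"
  shows "Bcoef p i = 0"
proof -
  have "betacoef j l * betacoef (2 * p - j) (i - l) = 0" if "j < 2 * p + 1" "l < i + 1" for j l
  proof (cases "j < l")
    case False
    then have "2 * p - j < i - l" using that assms by linarith
    then show ?thesis by (simp add: betacoef_eq_0)
  qed (simp add: betacoef_eq_0)
  then have "(\<Sum>l<i + 1. betacoef j l * betacoef (2 * p - j) (i - l)) = 0" if "j < 2 * p + 1" for j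
    using that by (intro sum.neutral ballI) (simp only: lessThan_iff)
  then show ?thesis unfolding Bcoef_def by (intro sum.neutral ballI) (simp only: lessThan_iff mult_zero_right)
qed

lemma poly_Bpoly: "poly (Bpoly p) x = (\<Sum>i<2 * p + 1. of_int (Bcoef p i) * x ^ i)"
proof -
  have "degree (Bpoly p) \<le> 2 * p"
    by (rule degree_le) (auto simp: coeff_Bpoly Bcoef_eq_0)
  then have "poly (Bpoly p) x = (\<Sum>i\<le>2 * p. coeff (Bpoly p) i * x ^ i)"
    unfolding poly_altdef by (intro sum.mono_neutral_left) (auto simp: coeff_eq_0)
  then show ?thesis by (simp add: coeff_Bpoly lessThan_Suc_atMost)
qed

text \<open>The value of \<open>Bpoly p\<close> at 1/2, made integral by \<open>4 ^ p\<close>; this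
  suffices because the degree is at most \<open>2 * p\<close>.\<close>

definition Bhalf :: "nat \<Rightarrow> int" where
  "Bhalf p = (\<Sum>i<2 * p + 1. Bcoef p i * int (2 ^ (2 * p - i)))"

lemma Bhalf_eq: "of_int (Bhalf p) = 4 ^ p * poly (Bpoly p) (1 / 2)"
  unfolding Bhalf_def poly_Bpoly of_int_sum sum_distrib_left
proof (intro sum.cong refl)
  fix i assume "i \<in> {..<2 * p + 1}"
  then have "(2::real) ^ (2 * p - i) * 2 ^ i = 4 ^ p"
    by (simp add: power_add[symmetric] power_mult)
  then show "real_of_int (Bcoef p i * int (2 ^ (2 * p - i))) = 4 ^ p * (real_of_int (Bcoef p i) * (1 / 2) ^ i)"
    by (simp add: power_divide field_simps)
qed

text \<open>Newton's recursion solved for the last power sum and multiplied by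
  \<open>fact (4 * p)\<close>, which merges the factorials into binomial coefficients and keeps
  everything integral. The factor \<open>p\<close> makes the value at 0 vanish, so the term
  \<open>j = 0\<close> of the sum contributes nothing.\<close>

fun newtonS :: "nat \<Rightarrow> int" where
  "newtonS p = - int p * Bhalf p - (\<Sum>j<p. int (4 * p choose (4 * j)) * newtonS j * Bhalf (p - j))"

declare newtonS.simps [simp del]

text \<open>The recursion is homogeneous, so the transcendental part of the \<open>k\<close>-th
  coefficient, \<open>L ^ k\<close>, factors out. The denominator 64 combines the 16 of
  \<open>newtonE_oddS\<close> with the 4 of \<open>Bhalf\<close>.\<close>

lemma oddS_eq:
  assumes "1 \<le> p"
  shows "oddS p = (pi ^ 4 * theta 0 (exp (- pi)) ^ 8 / 64) ^ p * of_int (newtonS p) / fact (4 * p)"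
  using assms
proof (induction p rule: less_induct)
  case (less p)
  define L where "L = pi ^ 4 * theta 0 (exp (- pi)) ^ 8 / 64"
  define e where "e = (\<lambda>k. real_of_int (Bhalf k) / fact (4 * k))"
  define \<sigma> where "\<sigma> = (\<lambda>k. real_of_int (newtonS k) / fact (4 * k))"
  have E: "newtonE (\<lambda>j. of_real (oddS j)) k = of_real (L ^ k * e k)" for k
  proof -
    have "pi ^ (4 * k) * theta 0 (exp (- pi)) ^ (8 * k) * poly (Bpoly k) (1 / 2) / (16 ^ k * fact (4 * k)) = L ^ k * e k"
    proof -
      have "(64 :: real) ^ k = 16 ^ k * 4 ^ k" by (simp add: power_mult_distrib[symmetric])
      then show ?thesis
        by (simp add: L_def e_def Bhalf_eq power_mult power_divide power_mult_distrib)
    qed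
    then show ?thesis unfolding newtonE_oddS by simp
  qed
  from less.prems obtain m where p: "p = Suc m" by (cases p) auto
  have "complex_of_real (real p * (L ^ p * e p)) = complex_of_real (- (\<Sum>j<p. oddS (Suc j) * (L ^ (p - Suc j) * e (p - Suc j))))"
    using newtonE_Suc[of p "\<lambda>j. of_real (oddS j)"] less.prems unfolding E by simp
  then have "real p * (L ^ p * e p) = - (\<Sum>j<p. oddS (Suc j) * (L ^ (p - Suc j) * e (p - Suc j)))"
    unfolding of_real_eq_iff .
  also have "(\<Sum>j<p. oddS (Suc j) * (L ^ (p - Suc j) * e (p - Suc j))) = (\<Sum>j<m. oddS (Suc j) * (L ^ (p - Suc j) * e (p - Suc j))) + oddS p"
  proof -
    have "complex_of_real (L ^ 0 * e 0) = 1" using E[of 0] by (simp add: newtonE_0)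
    then have "e 0 = 1" by (simp only: power_0 mult_1 of_real_eq_1_iff)
    then show ?thesis unfolding p by simp
  qed
  also have "(\<Sum>j<m. oddS (Suc j) * (L ^ (p - Suc j) * e (p - Suc j))) = (\<Sum>j<m. L ^ p * (\<sigma> (Suc j) * e (p - Suc j)))"
  proof (intro sum.cong refl)
    fix j assume "j \<in> {..<m}"
    then have j: "Suc j < p" using p by simp
    have o: "oddS (Suc j) = L ^ Suc j * \<sigma> (Suc j)"
      using less.IH[OF j] by (simp add: L_def \<sigma>_def)
    have l: "L ^ Suc j * L ^ (p - Suc j) = L ^ p"
      using j by (subst power_add[symmetric]) simp
    show "oddS (Suc j) * (L ^ (p - Suc j) * e (p - Suc j)) = L ^ p * (\<sigma> (Suc j) * e (p - Suc j))"
      unfolding o l[symmetric] by (simp only: mult_ac)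
  qed
  also have "\<dots> = L ^ p * (\<Sum>j<p. \<sigma> j * e (p - j))"
  proof -
    have "newtonS 0 = 0" by (subst newtonS.simps) simp
    then have "\<sigma> 0 = 0" by (simp add: \<sigma>_def)
    then show ?thesis unfolding p sum.lessThan_Suc_shift by (simp add: sum_distrib_left)
  qed
  finally have "oddS p = L ^ p * (- real p * e p - (\<Sum>j<p. \<sigma> j * e (p - j)))"
    by (simp add: algebra_simps)
  also have "- real p * e p - (\<Sum>j<p. \<sigma> j * e (p - j)) = \<sigma> p"
  proof -
    have "real (4 * p choose (4 * j)) = fact (4 * p) / (fact (4 * j) * fact (4 * (p - j)))" if "j < p" for j
      using binomial_fact[of "4 * j" "4 * p", where 'a = real] that by (simp add: diff_mult_distrib2)
    then have A: "(\<Sum>j<p. \<sigma> j * e (p - j)) = (\<Sum>j<p. real (4 * p choose (4 * j)) * of_int (newtonS j) * of_int (Bhalf (p - j))) / fact (4 * p)"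
      unfolding sum_divide_distrib by (intro sum.cong refl) (simp add: \<sigma>_def e_def)
    have B: "of_int (newtonS p) = - real p * of_int (Bhalf p) - (\<Sum>j<p. real (4 * p choose (4 * j)) * of_int (newtonS j) * of_int (Bhalf (p - j)))"
      by (subst newtonS.simps) simp
    show ?thesis unfolding A unfolding \<sigma>_def B by (simp only: e_def diff_divide_distrib times_divide_eq_right)
  qed
  finally show ?case by (simp add: L_def \<sigma>_def)
qed

lemma newtonS_nonzero: "1 \<le> p \<Longrightarrow> newtonS p \<noteq> 0"
  using oddS_eq[of p] oddS_nonzero[of p] by auto

text \<open>The normalization that makes the integral come out exactly: \<open>(-4)^p - 1\<close>
  undoes the passage to odd lattice points, \<open>64 ^ p\<close> the denominator in
  \<open>oddS_eq\<close>, and \<open>2 p\<close> is \<open>fact (4 p) / fact (4 p - 1)\<close>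
  divided by the 2 in \<open>2 * oddS p\<close>.\<close>

definition gnum :: "nat \<Rightarrow> int" where
  "gnum p = 2 * int p * int (64 ^ p) * ((if p mod 2 = 0 then 1 else -1) * int (4 ^ p) - 1)"

lemma gnum_eq: "of_int (gnum p) = 2 * real p * 64 ^ p * ((-4) ^ p - 1)"
proof -
  have "(-4 :: real) ^ p = of_int (if p mod 2 = 0 then 1 else -1) * 4 ^ p"
    by (cases "even p") (auto simp: even_iff_mod_2_eq_zero)
  then show ?thesis by (simp add: gnum_def)
qed

definition gfun :: "nat \<Rightarrow> real \<Rightarrow> real" where
  "gfun p k = of_int (gnum p) * poly (Bpoly p) (k\<^sup>2) / (of_int (newtonS p) * (k * (1 - k\<^sup>2)))"

lemma gfun_has_integral:
  assumes p: "1 \<le> p"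
  shows "((\<lambda>k. gfun p k * ellK' k ^ (4 * p - 1)) has_integral Gamma (1 / 4) ^ (8 * p) / pi ^ (2 * p)) {0<..<1}"
proof -
  let ?f = "\<lambda>k. gfun p k * ellK' k ^ (4 * p - 1)"
  let ?T = "Gamma (1 / 4) ^ (8 * p) / pi ^ (2 * p) :: real"
  define c where "c = real_of_int (gnum p) / of_int (newtonS p)"
  define \<phi> where "\<phi> = (\<lambda>x. modulus (exp (- (pi * x))))"
  define \<phi>' where "\<phi>' = (\<lambda>x. - (pi / 2 * (\<phi> x * (1 - (\<phi> x)\<^sup>2)) * theta 0 (exp (- (pi * x))) ^ 4))"
  have q: "0 < exp (- (pi * x))" "exp (- (pi * x)) < 1" if "x \<in> {0<..}" for x using that by auto
  have "bij_betw (\<lambda>x. exp (- (pi * x))) {0<..} {0<..<1::real}"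
    by (rule bij_betwI[where g = "\<lambda>y. - ln y / pi"]) (auto simp: field_simps)
  from bij_betw_trans[OF this bij_betw_modulus]
  have bij: "bij_betw \<phi> {0<..} {0<..<1}" by (simp add: \<phi>_def o_def)
  have D: "(\<phi> has_real_derivative \<phi>' x) (at x within {0<..})" if x: "x \<in> {0<..}" for x
  proof -
    have "((\<lambda>x. exp (- (pi * x))) has_real_derivative - pi * exp (- (pi * x))) (at x)"
      by (auto intro!: derivative_eq_intros)
    from DERIV_chain2[OF modulus_has_derivative[OF q[OF x]] this]
    have "(\<phi> has_real_derivative \<phi>' x) (at x)"
      unfolding \<phi>_def \<phi>'_def by (simp add: mult_ac)
    then show ?thesis by (rule has_field_derivative_at_within)
  qed
  have eq: "\<bar>\<phi>' x\<bar> * ?f (\<phi> x) = c * pi ^ (4 * p) * (thetaform p (exp (- (pi * x))) * x ^ (4 * p - 1))" if x: "x \<in> {0<..}" for x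
  proof -
    define Q where "Q = exp (- (pi * x))"
    have Q: "0 < Q" "Q < 1" using q[OF x] by (auto simp: Q_def)
    define k t where "k = \<phi> x" and "t = theta 0 Q"
    have k: "0 < k" "k < 1" using modulus_bounds[OF Q] by (auto simp: k_def \<phi>_def Q_def)
    have k2: "0 < 1 - k\<^sup>2" using square_less_1[OF k] by simp
    have lam: "k\<^sup>2 = lam Q" using modulus_square[OF Q] by (simp add: k_def \<phi>_def Q_def)
    have K: "ellK' k = t\<^sup>2 * (pi * x) / 2"
      using ellK'_modulus[OF Q] by (simp add: k_def \<phi>_def Q_def t_def ln_div)
    have 1: "\<bar>\<phi>' x\<bar> = pi / 2 * (k * (1 - k\<^sup>2)) * t ^ 4"
      unfolding \<phi>'_def k_def[symmetric] Q_def[symmetric] t_def[symmetric] using k k2 by (simp add: abs_mult)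
    have 2: "k * (1 - k\<^sup>2) * gfun p k = c * poly (Bpoly p) (lam Q)"
      using k k2 by (simp add: gfun_def c_def lam)
    obtain r where r: "4 * p = Suc r" using p by (cases "4 * p") auto
    have 3: "pi / 2 * t ^ 4 * (t\<^sup>2 * (pi * x) / 2) ^ r = pi ^ (4 * p) * (t ^ (8 * p + 2) / 16 ^ p) * x ^ r"
    proof -
      have "t ^ 4 * (t\<^sup>2) ^ r = t ^ (8 * p + 2)"
        unfolding power_mult[symmetric] power_add[symmetric] using r by (intro arg_cong[where f = "\<lambda>n. t ^ n"]) linarith
      moreover have "(2::real) ^ Suc r = 16 ^ p" unfolding r[symmetric] by (simp add: power_mult)
      moreover have "pi / 2 * t ^ 4 * (t\<^sup>2 * (pi * x) / 2) ^ r = pi ^ Suc r * (t ^ 4 * (t\<^sup>2) ^ r) / 2 ^ Suc r * x ^ r"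
        by (simp add: power_mult_distrib power_divide)
      ultimately show ?thesis by (simp only: r) simp
    qed
    have r1: "4 * p - 1 = r" using r by simp
    have "\<bar>\<phi>' x\<bar> * ?f (\<phi> x) = (k * (1 - k\<^sup>2) * gfun p k) * (pi / 2 * t ^ 4 * (t\<^sup>2 * (pi * x) / 2) ^ r)"
      unfolding 1 r1 k_def[symmetric] K by (simp only: mult_ac)
    also have "\<dots> = c * pi ^ (4 * p) * (t ^ (8 * p + 2) * poly (Bpoly p) (lam Q) / 16 ^ p * x ^ r)"
      unfolding 2 3 by simp
    also have "t ^ (8 * p + 2) * poly (Bpoly p) (lam Q) / 16 ^ p = thetaform p Q"
      using thetaform_eq[OF Q] by (simp add: t_def)
    finally show ?thesis by (simp only: r1 Q_def)
  qed
  have I: "(\<lambda>x. c * pi ^ (4 * p) * (thetaform p (exp (- (pi * x))) * x ^ (4 * p - 1))) absolutely_integrable_on {0<..}"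
    by (rule set_integrable_mult_right) (use thetaform_integral(1)[OF p] in simp)
  have "integral {0<..} (\<lambda>x. c * pi ^ (4 * p) * (thetaform p (exp (- (pi * x))) * x ^ (4 * p - 1)))
      = c * pi ^ (4 * p) * (fact (4 * p - 1) / pi ^ (4 * p) * Re (gaussE p))"
    using thetaform_integral(2)[OF p] by simp
  also have "\<dots> = ?T"
  proof -
    define A where "A = (-4 :: real) ^ p - 1"
    define L where "L = pi ^ 4 * theta 0 (exp (- pi)) ^ 8"
    have L: "L \<noteq> 0" using theta_pos[of "exp (- pi)"] by (simp add: L_def)
    have n: "real_of_int (newtonS p) \<noteq> 0" using newtonS_nonzero[OF p] by simp
    have f: "fact (4 * p) = 4 * real p * fact (4 * p - 1)"
      using p fact_reduce[of "4 * p", where 'a = real] by simp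
    have G: "A * Re (gaussE p) = 16 ^ p * (2 * oddS p)"
      using oddS_gaussE[OF p] by (simp add: A_def)
    have "c * pi ^ (4 * p) * (fact (4 * p - 1) / pi ^ (4 * p) * Re (gaussE p))
        = 2 * real p * 64 ^ p * fact (4 * p - 1) * (A * Re (gaussE p)) / of_int (newtonS p)"
      by (simp add: c_def gnum_eq A_def mult_ac)
    also have "\<dots> = fact (4 * p) * 64 ^ p * 16 ^ p * oddS p / of_int (newtonS p)"
      unfolding G f by simp
    also have "\<dots> = 16 ^ p * L ^ p"
      unfolding oddS_eq[OF p] L_def[symmetric] using n by (simp add: power_divide)
    also have "\<dots> = pi ^ (4 * p) * theta 0 (exp (- pi)) ^ (8 * p) * 16 ^ p"
      by (simp add: L_def power_mult_distrib power_mult)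
    finally show ?thesis unfolding theta_lemniscatic .
  qed
  finally have V: "integral {0<..} (\<lambda>x. c * pi ^ (4 * p) * (thetaform p (exp (- (pi * x))) * x ^ (4 * p - 1))) = ?T" .
  have "(\<lambda>x. \<bar>\<phi>' x\<bar> * ?f (\<phi> x)) absolutely_integrable_on {0<..}"
    using I eq by (subst set_integrable_cong[OF refl]) auto
  moreover have "integral {0<..} (\<lambda>x. \<bar>\<phi>' x\<bar> * ?f (\<phi> x)) = ?T"
    using V eq integral_cong[of "{0<..}" "\<lambda>x. \<bar>\<phi>' x\<bar> * ?f (\<phi> x)"] by simp
  ultimately have "?f absolutely_integrable_on (\<phi> ` {0<..}) \<and> integral (\<phi> ` {0<..}) ?f = ?T"
    using has_absolute_integral_change_of_variables_1'[of "{0<..}" \<phi> \<phi>' ?f ?T] D bij_betw_imp_inj_on[OF bij]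
    by auto
  then have "?f absolutely_integrable_on {0<..<1}" "integral {0<..<1} ?f = ?T"
    using bij_betw_imp_surj_on[OF bij] by auto
  then show ?thesis
    using absolutely_integrable_on_def integrable_integral by metis
qed

section \<open>Analyticity and uniqueness of the branch\<close>

lemma beta_dvd: "1 \<le> j \<Longrightarrow> [:0, 1, -1:] dvd beta j"
  by (cases j rule: beta.cases) (simp_all only: beta.simps dvd_triv_left dvd_0_right not_one_le_zero)

text \<open>In every term of \<open>Bpoly p\<close> one of the two indices is positive, so
  \<open>t (1 - t)\<close> divides it. At \<open>t = k^2\<close> this cancels the denominator of
  \<open>gfun\<close>, which is thus a polynomial on the open interval and clearly analytic
  there.\<close>

lemma gfun_poly:
  assumes p: "1 \<le> p"
  obtains R where "\<And>k. 0 < k \<Longrightarrow> k < 1 \<Longrightarrow> gfun p k = poly R k"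
proof -
  have "[:0, 1, -1:] dvd Bpoly p"
    unfolding Bpoly_def
  proof (intro dvd_sum dvd_smult)
    fix j assume "j \<in> {..2 * p}"
    show "[:0, 1, -1:] dvd beta j * beta (2 * p - j)"
    proof (cases "1 \<le> j")
      case False
      then have "1 \<le> 2 * p - j" using p by simp
      then show ?thesis by (intro dvd_mult beta_dvd)
    qed (intro dvd_mult2 beta_dvd)
  qed
  then obtain C where C: "Bpoly p = [:0, 1, -1:] * C" by (elim dvdE)
  define R where "R = smult (of_int (gnum p) / of_int (newtonS p)) ([:0, 1:] * pcompose C [:0, 0, 1:])"
  have "gfun p k = poly R k" if k: "0 < k" "k < 1" for k
  proof -
    have "1 - k\<^sup>2 \<noteq> 0" using square_less_1[OF k] by simp
    moreover have "poly (Bpoly p) (k\<^sup>2) = k * (k * (1 - k\<^sup>2)) * poly C (k\<^sup>2)"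
      by (simp add: C power2_eq_square algebra_simps)
    moreover have "poly R k = of_int (gnum p) / of_int (newtonS p) * (k * poly C (k\<^sup>2))"
      by (simp add: R_def poly_pcompose power2_eq_square)
    ultimately show ?thesis using k by (simp add: gfun_def)
  qed
  then show ?thesis using that by blast
qed

lemma real_analytic_on_poly:
  assumes "open S" "\<And>x. x \<in> S \<Longrightarrow> g x = poly R x"
  shows "real_analytic_on g S"
  unfolding real_analytic_on_def
proof
  fix x assume "x \<in> S"
  then obtain r where r: "r > 0" "\<And>y. dist y x < r \<Longrightarrow> y \<in> S"
    using assms(1) unfolding open_dist by blast
  define T where "T = pcompose R [:x, 1:]"
  have "(\<lambda>n. coeff T n * (y - x) ^ n) sums g y" if y: "\<bar>y - x\<bar> < r" for y
  proof -
    have "(\<lambda>n. coeff T n * (y - x) ^ n) sums (\<Sum>n\<le>degree T. coeff T n * (y - x) ^ n)"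
      by (rule sums_finite) (auto simp: coeff_eq_0)
    also have "(\<Sum>n\<le>degree T. coeff T n * (y - x) ^ n) = poly R y"
      by (simp add: poly_altdef[symmetric] T_def poly_pcompose)
    finally show ?thesis using assms(2)[of y] r(2)[of y] y by (simp add: dist_real_def)
  qed
  then show "\<exists>r>0. \<exists>a. \<forall>y. \<bar>y - x\<bar> < r \<longrightarrow> (\<lambda>n. a n * (y - x) ^ n) sums g y"
    using r(1) by blast
qed

definition zcode :: "int \<Rightarrow> nat" where
  "zcode z = prod_encode (int_encode z, 0)"

lemma rat_decode_zcode: "rat_decode (zcode z) = of_int z"
  by (simp add: rat_decode_def zcode_def Fract_of_int_eq)

text \<open>The zeros at odd places substitute \<open>x^2\<close> into
  \<open>Bpoly p\<close>.\<close>

definition ccoef :: "nat \<Rightarrow> nat \<Rightarrow> int" where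
  "ccoef p i = (if i mod 2 = 0 then - gnum p * Bcoef p (i div 2) else 0)"

text \<open>At \<open>k = 1/2\<close> the factor \<open>1 / (k (1 - k^2))\<close> is 8/3, rounded up
  to 3; dividing by the nonzero integer \<open>newtonS p\<close> cannot enlarge the value, and the
  summand 1 makes the bound strict.\<close>

definition gbound :: "nat \<Rightarrow> nat" where
  "gbound p = 1 + 3 * (\<Sum>i<2 * p + 1. nat \<bar>gnum p * Bcoef p i\<bar>)"

text \<open>A polynomial linear in \<open>y\<close>; its leading coefficient,
  \<open>newtonS p\<close> times \<open>x - x^3\<close>, has no zero in the open interval, so every
  \<open>x\<close> there has exactly one root.\<close>

definition gpolycode :: "nat \<Rightarrow> nat" where
  "gpolycode p = list_encode [list_encode (map (\<lambda>i. zcode (ccoef p i)) [0..<4 * p + 1]),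
     list_encode [zcode 0, zcode (newtonS p), zcode 0, zcode (- newtonS p)]]"

text \<open>The base point is 1/2, written as numerator 1 and denominator less one; the interval is
  symmetric about 0 and has to contain the value at 1/2.\<close>

definition gcode :: "nat \<Rightarrow> nat" where
  "gcode p = prod_encode (gpolycode p, prod_encode (prod_encode (int_encode 1, 1),
     prod_encode (zcode (- int (gbound p)), zcode (int (gbound p)))))"

lemma poly_of_rat_Poly: "poly (map_poly real_of_rat (Poly rs)) x = (\<Sum>i<length rs. real_of_rat (rs ! i) * x ^ i)"
proof (induction rs)
  case (Cons r rs)
  have "poly (map_poly real_of_rat (Poly (r # rs))) x = of_rat r + x * poly (map_poly real_of_rat (Poly rs)) x"
    by (simp add: map_poly_pCons)
  also have "\<dots> = (\<Sum>i<length (r # rs). real_of_rat ((r # rs) ! i) * x ^ i)"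
    unfolding Cons by (simp add: sum.lessThan_Suc_shift sum_distrib_left mult_ac del: sum.lessThan_Suc)
  finally show ?case .
qed simp

lemma eval2_linear:
  "eval2 (Poly [P0, P1]) x y = poly (map_poly real_of_rat P0) x + y * poly (map_poly real_of_rat P1) x"
  by (simp add: eval2_def map_poly_pCons)

lemma eval2_gpolycode:
  "eval2 (poly2_decode (gpolycode p)) x y
     = of_int (newtonS p) * (x * (1 - x\<^sup>2)) * y - of_int (gnum p) * poly (Bpoly p) (x\<^sup>2)"
proof -
  have "map rat_decode (map (\<lambda>i. zcode (ccoef p i)) [0..<4 * p + 1]) = map (\<lambda>i. of_int (ccoef p i)) [0..<4 * p + 1]"
    by (simp add: rat_decode_zcode del: upt_Suc)
  then have d: "poly2_decode (gpolycode p) = Poly [Poly (map (\<lambda>i. of_int (ccoef p i)) [0..<4 * p + 1]),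
      Poly [0, of_int (newtonS p), 0, - of_int (newtonS p)]]"
    by (simp add: poly2_decode_def gpolycode_def poly_decode_def rat_decode_zcode o_def del: upt_Suc)
  have "(\<Sum>i<2 * m + 1. (if i mod 2 = 0 then h (i div 2) else 0) * x ^ i) = (\<Sum>i<m + 1. h i * (x\<^sup>2) ^ i)" for h :: "nat \<Rightarrow> real" and m
  proof (induction m)
    case (Suc m)
    have "2 * Suc m + 1 = Suc (Suc (2 * m + 1))" by simp
    then show ?case using Suc by (simp add: power_mult power2_eq_square mod_Suc)
  qed simp
  from this[of "\<lambda>i. - of_int (gnum p) * of_int (Bcoef p i)" "2 * p"]
  have "(\<Sum>i<4 * p + 1. real_of_int (ccoef p i) * x ^ i) = - of_int (gnum p) * poly (Bpoly p) (x\<^sup>2)"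
    by (simp add: ccoef_def poly_Bpoly sum_distrib_left if_distrib[where f = real_of_int] mult.assoc cong: if_cong del: sum.lessThan_Suc)
  then have a: "poly (map_poly real_of_rat (Poly (map (\<lambda>i. of_int (ccoef p i)) [0..<4 * p + 1]))) x = - of_int (gnum p) * poly (Bpoly p) (x\<^sup>2)"
    unfolding poly_of_rat_Poly by (simp del: upt_Suc sum.lessThan_Suc)
  have b: "poly (map_poly real_of_rat (Poly [0, of_int (newtonS p), 0, - of_int (newtonS p)])) x = of_int (newtonS p) * (x * (1 - x\<^sup>2))"
    unfolding poly_of_rat_Poly by (simp add: numeral_eq_Suc algebra_simps of_rat_minus)
  show ?thesis unfolding d eval2_linear a b by simp
qed

lemma branch_gpolycode_iff:
  assumes p: "1 \<le> p" and x: "0 < x" "x < 1"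
  shows "eval2 (poly2_decode (gpolycode p)) x y = 0 \<longleftrightarrow> y = gfun p x"
proof -
  have "1 - x\<^sup>2 \<noteq> 0" using square_less_1[OF x] by simp
  then have "of_int (newtonS p) * (x * (1 - x\<^sup>2)) \<noteq> (0 :: real)" using newtonS_nonzero[OF p] x by simp
  then show ?thesis unfolding eval2_gpolycode gfun_def by (simp add: field_simps)
qed

lemma gfun_branch:
  assumes p: "1 \<le> p"
  shows "branch_on (poly2_decode (gpolycode p)) {0<..<1} (gfun p)"
proof -
  obtain R where "\<And>k. 0 < k \<Longrightarrow> k < 1 \<Longrightarrow> gfun p k = poly R k" using gfun_poly[OF p] by blast
  then have "real_analytic_on (gfun p) {0<..<1}" by (intro real_analytic_on_poly) auto
  then show ?thesis unfolding branch_on_def using branch_gpolycode_iff[OF p] by auto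
qed

lemma gpolycode_nonzero:
  assumes p: "1 \<le> p"
  shows "poly2_decode (gpolycode p) \<noteq> 0"
proof
  assume "poly2_decode (gpolycode p) = 0"
  then have "eval2 (poly2_decode (gpolycode p)) (1 / 2) y = 0" for y by (simp add: eval2_def)
  then have "y = gfun p (1 / 2)" for y using branch_gpolycode_iff[OF p, of "1 / 2"] by auto
  from this[of 0] this[of 1] show False by simp
qed

lemma gfun_bound:
  assumes p: "1 \<le> p"
  shows "\<bar>gfun p (1 / 2)\<bar> < real (gbound p)"
proof -
  let ?S = "\<Sum>i<2 * p + 1. \<bar>real_of_int (gnum p * Bcoef p i)\<bar>"
  have S: "\<bar>of_int (gnum p) * poly (Bpoly p) ((1 / 2)\<^sup>2)\<bar> \<le> ?S"
  proof -
    have "of_int (gnum p) * poly (Bpoly p) ((1 / 2)\<^sup>2) = (\<Sum>i<2 * p + 1. real_of_int (gnum p * Bcoef p i) * (1 / 4) ^ i)"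
      unfolding poly_Bpoly sum_distrib_left by (simp add: power2_eq_square mult.assoc del: sum.lessThan_Suc)
    also have "\<bar>\<dots>\<bar> \<le> (\<Sum>i<2 * p + 1. \<bar>real_of_int (gnum p * Bcoef p i) * (1 / 4) ^ i\<bar>)" by (rule sum_abs)
    also have "\<dots> \<le> ?S"
    proof (rule sum_mono)
      fix i
      show "\<bar>real_of_int (gnum p * Bcoef p i) * (1 / 4) ^ i\<bar> \<le> \<bar>real_of_int (gnum p * Bcoef p i)\<bar>"
        unfolding abs_mult[of "real_of_int _" "(1 / 4) ^ i"] by (rule mult_left_le) (auto simp: power_le_one power_abs)
    qed
    finally show ?thesis .
  qed
  have n: "1 \<le> \<bar>real_of_int (newtonS p)\<bar>" using newtonS_nonzero[OF p] by linarith
  have "\<bar>gfun p (1 / 2)\<bar> = \<bar>of_int (gnum p) * poly (Bpoly p) ((1 / 2)\<^sup>2)\<bar> / \<bar>of_int (newtonS p)\<bar> * (8 / 3)"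
    by (simp add: gfun_def abs_mult power2_eq_square)
  also have "\<dots> \<le> ?S / 1 * (8 / 3)"
    by (intro mult_right_mono frac_le S n) (auto intro: sum_nonneg)
  also have "\<dots> < 1 + 3 * ?S"
  proof -
    have "0 \<le> ?S" by (rule sum_nonneg) simp
    then show ?thesis by linarith
  qed
  also have "\<dots> = real (gbound p)" by (simp add: gbound_def del: sum.lessThan_Suc)
  finally show ?thesis .
qed

lemma gcode_describes:
  assumes p: "1 \<le> p"
  shows "describes_algebraic_function_on {0<..<1} (gcode p) (gfun p)"
proof -
  have x: "real_of_rat (rat_decode (prod_encode (int_encode 1, 1))) = 1 / 2"
    by (simp add: rat_decode_def of_rat_rat)
  have M: "real_of_rat (rat_decode (zcode (- int (gbound p)))) = - real (gbound p)"
    "real_of_rat (rat_decode (zcode (int (gbound p)))) = real (gbound p)"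
    unfolding rat_decode_zcode by (simp_all add: of_rat_minus)
  have u: "h y = gfun p y" if "branch_on (poly2_decode (gpolycode p)) {0<..<1} h" "y \<in> {0<..<1}" for h y
    using that branch_gpolycode_iff[OF p, of y "h y"] by (auto simp: branch_on_def)
  show ?thesis
    unfolding describes_algebraic_function_on_def gcode_def Let_def
  proof (rule exI[of _ "gpolycode p"], rule exI[of _ "prod_encode (int_encode 1, 1)"],
      rule exI[of _ "zcode (- int (gbound p))"], rule exI[of _ "zcode (int (gbound p))"],
      intro conjI allI impI ballI)
    fix h y
    assume "branch_on (poly2_decode (gpolycode p)) {0<..<1} h \<and>
      real_of_rat (rat_decode (zcode (- int (gbound p)))) < h (real_of_rat (rat_decode (prod_encode (int_encode 1, 1)))) \<and>
      h (real_of_rat (rat_decode (prod_encode (int_encode 1, 1)))) < real_of_rat (rat_decode (zcode (int (gbound p))))"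
      and "y \<in> {0<..<1::real}"
    then show "h y = gfun p y" using u by blast
  qed (use gpolycode_nonzero[OF p] gfun_branch[OF p] gfun_bound[OF p] in \<open>auto simp: x[unfolded One_nat_def] M\<close>)
qed

section \<open>Computability of the description\<close>

lemma ztr_betacoef [tr_intros]:
  assumes "total_recursive f" "total_recursive g"
  shows "ztr (\<lambda>n. betacoef (f n) (g n))"
proof -
  define F where "F = (\<lambda>j. list_encode (map (\<lambda>i. int_encode (betacoef j i)) [0..<j + 1]))"
  \<comment> \<open>The history lists the most recent value first, so entries 0 and 1 are the coded
    coefficient lists of the two predecessors.\<close>
  let ?h = "\<lambda>j r i. int_encode (if j = 0 then (if i = 0 then 1 else 0) else if j - 1 = 0 then 0
     else betastep j (\<lambda>l. int_decode (look (look r 0) l)) (\<lambda>l. int_decode (look (look r 1) l)) i)"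
  have lF: "int_decode (look (F j) i) = betacoef j i" for j i
  proof (cases "i < j + 1")
    case False
    then show ?thesis by (simp add: F_def look_list_encode betacoef_eq_0 int_decode_if del: upt_Suc)
  qed (simp add: F_def look_list_encode del: upt_Suc)
  have F: "total_recursive F"
  proof (rule tr_course_of_values)
    show "total_recursive (\<lambda>x. list_encode (map (?h (pi1 x) (pi2 x)) [0..<pi1 x + 1]))"
      unfolding betastep_def by (intro tr_tabulate tr_intros)
    show "F j = list_encode (map (?h j (history F j)) [0..<j + 1])" for j
    proof -
      have "int_encode (betacoef j i) = ?h j (history F j) i" for i
      proof (cases j rule: betacoef.cases)
        case (3 m)
        then show ?thesis by (simp add: look_history lF)
      qed auto
      then show ?thesis unfolding F_def by simp
    qed
  qed
  have "ztr (\<lambda>n. int_decode (look (F (f n)) (g n)))"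
    by (rule ztr_int_decode[OF tr_look[OF total_recursive.comp[OF F assms(1)] assms(2)]])
  then show ?thesis unfolding lF .
qed

lemma ztr_Bcoef [tr_intros]:
  assumes "total_recursive f" "total_recursive g"
  shows "ztr (\<lambda>n. Bcoef (f n) (g n))"
proof -
  have "ztr (\<lambda>x. Bcoef (pi1 x) (pi2 x))"
    unfolding Bcoef_def by (intro ztr_sum tr_intros)
  then obtain a b where *: "total_recursive a" "total_recursive b" "\<And>x. Bcoef (pi1 x) (pi2 x) = int (a x) - int (b x)"
    unfolding ztr_def by blast
  have "Bcoef (f n) (g n) = int (a (prod_encode (f n, g n))) - int (b (prod_encode (f n, g n)))" for n
    using *(3)[of "prod_encode (f n, g n)"] by simp
  then show ?thesis
    by (rule ztrI[OF total_recursive.comp[OF *(1) tr_pair[OF assms]] total_recursive.comp[OF *(2) tr_pair[OF assms]]])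
qed

lemma ztr_comp:
  assumes "ztr h" "total_recursive f"
  shows "ztr (\<lambda>n. h (f n))"
proof -
  obtain a b where *: "total_recursive a" "total_recursive b" "\<And>n. h n = int (a n) - int (b n)"
    using assms(1) unfolding ztr_def by blast
  show ?thesis
    by (rule ztrI[OF total_recursive.comp[OF *(1) assms(2)] total_recursive.comp[OF *(2) assms(2)] *(3)])
qed

lemma ztr_Bhalf: "ztr Bhalf"
  unfolding Bhalf_def[abs_def] by (intro ztr_sum tr_intros)

lemma ztr_newtonS: "ztr newtonS"
proof -
  \<comment> \<open>In a history of length \<open>p\<close> with the most recent value first, the
    value at \<open>j\<close> sits at position \<open>p - 1 - j\<close>.\<close>
  let ?\<Phi> = "\<lambda>p r. int_encode (- int p * Bhalf p - (\<Sum>j<p. int (4 * p choose (4 * j)) * int_decode (look r (p - 1 - j)) * Bhalf (p - j)))"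
  have "total_recursive (\<lambda>p. int_encode (newtonS p))"
  proof (rule tr_course_of_values)
    show "total_recursive (\<lambda>x. ?\<Phi> (pi1 x) (pi2 x))"
      by (intro ztr_sum tr_intros ztr_comp[OF ztr_Bhalf])
    show "int_encode (newtonS p) = ?\<Phi> p (history (\<lambda>p. int_encode (newtonS p)) p)" for p
    proof -
      have "(\<Sum>j<p. int (4 * p choose (4 * j)) * newtonS j * Bhalf (p - j))
        = (\<Sum>j<p. int (4 * p choose (4 * j)) * int_decode (look (history (\<lambda>p. int_encode (newtonS p)) p) (p - 1 - j)) * Bhalf (p - j))"
        by (intro sum.cong refl) (auto simp: look_history)
      then show ?thesis by (subst newtonS.simps) (simp only:)
    qed
  qed
  from ztr_int_decode[OF this] show ?thesis by simp
qed

lemma tr_gcode: "total_recursive gcode"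
proof -
  have g: "ztr gnum" unfolding gnum_def[abs_def] by (intro tr_intros)
  have c: "total_recursive (\<lambda>x. zcode (ccoef (pi1 x) (pi2 x)))"
    unfolding zcode_def ccoef_def by (intro tr_intros ztr_comp[OF g])
  have b: "total_recursive gbound"
    unfolding gbound_def[abs_def] by (intro tr_sum tr_intros ztr_comp[OF g])
  have "total_recursive gpolycode"
    unfolding gpolycode_def[abs_def] list_encode.simps
    by (intro tr_intros tr_tabulate c) (unfold zcode_def, (intro tr_intros ztr_newtonS)+)
  then show ?thesis
    unfolding gcode_def[abs_def] zcode_def by (intro tr_intros b)
qed

theorem theorem2:
  "\<exists>g :: nat \<Rightarrow> real \<Rightarrow> real.
     effectively_computable_on {0<..<1} {1..} g \<and>
     (\<forall>p\<ge>1. algebraic_function_on {0<..<1} (g p) \<and>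
        ((\<lambda>k. g p k * ellK' k ^ (4 * p - 1)) has_integral
           Gamma (1 / 4) ^ (8 * p) / pi ^ (2 * p)) {0<..<1})"
proof (intro exI conjI allI impI)
  show "effectively_computable_on {0<..<1} {1..} gfun"
    unfolding effectively_computable_on_def using tr_gcode gcode_describes by auto
  fix p :: nat assume p: "1 \<le> p"
  show "algebraic_function_on {0<..<1} (gfun p)"
    unfolding algebraic_function_on_def using gpolycode_nonzero[OF p] gfun_branch[OF p] by blast
  show "((\<lambda>k. gfun p k * ellK' k ^ (4 * p - 1)) has_integral Gamma (1 / 4) ^ (8 * p) / pi ^ (2 * p)) {0<..<1}"
    by (rule gfun_has_integral[OF p])
qed

end
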